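(* Let $r\geq 2$ be an integer, let $n$ be a positive integer and $c$ a real number with $2/\ln n\leq c\leq r^{-(2r+9)(r+1)}$, and let $G$ be a graph of order $n$. If $\mu(G)>\mu(T_r(n))$, then $G$ contains a (not necessarily induced) subgraph isomorphic to $K_r^{+}(\lfloor c\ln n\rfloor,\ldots,\lfloor c\ln n\rfloor,\lceil n^{1-\sqrt{c}}\rceil)$, where the first $r-1$ arguments equal $\lfloor c\ln n\rfloor$.
   Context: All graphs are finite and simple; $\ln$ is the natural logarithm. For a graph $G$, $\mu(G)$ denotes the largest eigenvalue of the adjacency matrix of $G$. $T_r(n)$ is the $r$-partite Turán graph of order $n$, i.e. the complete $r$-partite graph on $n$ vertices whose part sizes differ by at most one. For integers $s_1\geq 2, s_2,\ldots,s_r\ge 1$, $K_r^{+}(s_1,\ldots,s_r)$ denotes the complete $r$-partite graph with parts of sizes $s_1,\ldots,s_r$ together with one additional edge joining two vertices of the first part (the part of size $s_1$). *)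

theory Defs
  imports
    Complex_Main
    "Graph_Theory.Pair_Digraph"
    "Graph_Theory.Digraph_Isomorphism"
    "Jordan_Normal_Form.Char_Poly"
begin

text \<open>
  Finite simple graphs are the symmetric, loop-free digraphs without multiple arcs of
  locale \<^locale>\<open>graph\<close>; an edge is a pair of opposite arcs.

  The rows and columns of the adjacency matrix follow an arbitrary enumeration of the vertices.
  By \<open>eigenvalue_adjacency_matrix_iff\<close> below the choice does not affect the eigenvalues.
\<close>

definition vertex_enum :: "('a, 'b) pre_digraph \<Rightarrow> 'a list" where
  "vertex_enum G = (SOME vs. distinct vs \<and> set vs = verts G)"

definition adjacency_matrix :: "('a, 'b) pre_digraph \<Rightarrow> real mat" where
  "adjacency_matrix G =
    (let vs = vertex_enum G; n = card (verts G)
     in mat n n (\<lambda>(i, j). if vs ! i \<rightarrow>\<^bsub>G\<^esub> vs ! j then 1 else 0))"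

definition largest_eigenvalue :: "('a, 'b) pre_digraph \<Rightarrow> real" where
  "largest_eigenvalue G = Max {k. eigenvalue (adjacency_matrix G) k}"

text \<open>The vertex \<open>(i, j)\<close> is the \<open>j\<close>-th vertex of the \<open>i\<close>-th part (both counted from 0).\<close>

definition complete_multipartite :: "nat list \<Rightarrow> (nat \<times> nat) pair_pre_digraph" where
  "complete_multipartite ss =
    (let V = {(i, j). i < length ss \<and> j < ss ! i}
     in \<lparr> pverts = V, parcs = {(u, v). u \<in> V \<and> v \<in> V \<and> fst u \<noteq> fst v} \<rparr>)"

text \<open>Meaningful if the first part has at least two vertices.\<close>

definition complete_multipartite_plus :: "nat list \<Rightarrow> (nat \<times> nat) pair_pre_digraph" where
  "complete_multipartite_plus ss =
    \<lparr> pverts = pverts (complete_multipartite ss),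
      parcs = parcs (complete_multipartite ss) \<union> {((0, 0), (0, 1)), ((0, 1), (0, 0))} \<rparr>"

text \<open>
  The part sizes \<open>n div r, (n + 1) div r, \<dots>, (n + r - 1) div r\<close> are the balanced ones; see
  \<open>turan_sizes_sum\<close> and \<open>turan_sizes_balanced\<close>. Parts are empty if \<open>n < r\<close>.
\<close>

definition turan_sizes :: "nat \<Rightarrow> nat \<Rightarrow> nat list" where
  "turan_sizes r n = map (\<lambda>i. (n + i) div r) [0..<r]"

definition turan_graph :: "nat \<Rightarrow> nat \<Rightarrow> (nat \<times> nat) pair_pre_digraph" where
  "turan_graph r n = complete_multipartite (turan_sizes r n)"

lemma vertex_enum:
  assumes "finite (verts G)"
  shows "distinct (vertex_enum G)" "set (vertex_enum G) = verts G"
    "length (vertex_enum G) = card (verts G)"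
proof -
  have "\<exists>vs. distinct vs \<and> set vs = verts G"
    using finite_distinct_list[OF assms] by blast
  then have *: "distinct (vertex_enum G) \<and> set (vertex_enum G) = verts G"
    unfolding vertex_enum_def by (rule someI_ex)
  then show "distinct (vertex_enum G)" "set (vertex_enum G) = verts G" by auto
  with * show "length (vertex_enum G) = card (verts G)"
    by (metis distinct_card)
qed

lemma eigenvalue_adjacency_matrix_iff:
  assumes fin: "finite (verts G)"
  shows "eigenvalue (adjacency_matrix G) k \<longleftrightarrow>
    (\<exists>x :: 'a \<Rightarrow> real. (\<exists>v\<in>verts G. x v \<noteq> 0) \<and>
      (\<forall>u\<in>verts (G :: ('a, 'b) pre_digraph). (\<Sum>v | v \<in> verts G \<and> u \<rightarrow>\<^bsub>G\<^esub> v. x v) = k * x u))"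
    (is "?L \<longleftrightarrow> ?R")
proof -
  define vs where "vs = vertex_enum G"
  define n where "n = card (verts G)"
  have d: "distinct vs" and s: "set vs = verts G" and l: "length vs = n"
    using vertex_enum[OF fin] by (auto simp: vs_def n_def)
  have bij: "bij_betw (\<lambda>i. vs ! i) {0..<n} (verts G)"
    using d s l bij_betw_nth[of vs "{0..<n}" "verts G"] by (auto simp: lessThan_atLeast0)
  define A where "A = adjacency_matrix G"
  have A: "A = mat n n (\<lambda>(i, j). if vs ! i \<rightarrow>\<^bsub>G\<^esub> vs ! j then 1 else 0)"
    by (simp add: A_def adjacency_matrix_def vs_def n_def Let_def)
  have row: "(A *\<^sub>v y) $ i = (\<Sum>v | v \<in> verts G \<and> vs ! i \<rightarrow>\<^bsub>G\<^esub> v. x v)"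
    if y: "y \<in> carrier_vec n" and i: "i < n" and xy: "\<And>j. j < n \<Longrightarrow> x (vs ! j) = y $ j" for x y i
  proof -
    have "(A *\<^sub>v y) $ i = (\<Sum>j\<in>{0..<n}. (if vs ! i \<rightarrow>\<^bsub>G\<^esub> vs ! j then 1 else 0) * y $ j)"
      using y i by (simp add: A scalar_prod_def)
    also have "\<dots> = (\<Sum>j\<in>{0..<n}. if vs ! i \<rightarrow>\<^bsub>G\<^esub> vs ! j then x (vs ! j) else 0)"
      using xy by (intro sum.cong) auto
    also have "\<dots> = (\<Sum>v\<in>verts G. if vs ! i \<rightarrow>\<^bsub>G\<^esub> v then x v else 0)"
      using sum.reindex_bij_betw[OF bij, of "\<lambda>v. if vs ! i \<rightarrow>\<^bsub>G\<^esub> v then x v else 0"] by simp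
    also have "\<dots> = (\<Sum>v | v \<in> verts G \<and> vs ! i \<rightarrow>\<^bsub>G\<^esub> v. x v)"
      using sum.inter_filter[OF fin, of x "\<lambda>v. vs ! i \<rightarrow>\<^bsub>G\<^esub> v"] by simp
    finally show ?thesis .
  qed
  have dim: "dim_row A = n" by (simp add: A)
  have ex: "\<exists>i<n. vs ! i = v" if "v \<in> verts G" for v
    using that s l by (metis in_set_conv_nth)
  have mem: "vs ! i \<in> verts G" if "i < n" for i
    using that s l nth_mem by blast
  show ?thesis
  proof
    assume ?L
    then obtain y where y: "y \<in> carrier_vec n" "y \<noteq> 0\<^sub>v n" "A *\<^sub>v y = k \<cdot>\<^sub>v y"
      unfolding eigenvalue_def eigenvector_def A_def[symmetric] dim by blast
    define x where "x v = y $ (the_inv_into {0..<n} (\<lambda>i. vs ! i) v)" for v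
    have xy: "x (vs ! j) = y $ j" if "j < n" for j
      using that bij by (simp add: x_def bij_betw_def the_inv_into_f_f)
    obtain j where "j < n" "y $ j \<noteq> 0"
      using y by (metis carrier_vecD eq_vecI index_zero_vec)
    then have "\<exists>v\<in>verts G. x v \<noteq> 0" using xy mem by metis
    moreover have "\<forall>u\<in>verts G. (\<Sum>v | v \<in> verts G \<and> u \<rightarrow>\<^bsub>G\<^esub> v. x v) = k * x u"
    proof
      fix u assume "u \<in> verts G"
      then obtain i where i: "i < n" "vs ! i = u" using ex by blast
      have "(A *\<^sub>v y) $ i = k * y $ i" using y i by simp
      then show "(\<Sum>v | v \<in> verts G \<and> u \<rightarrow>\<^bsub>G\<^esub> v. x v) = k * x u"
        using row[of y i x] y i xy by auto
    qed
    ultimately show ?R by blast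
  next
    assume ?R
    then obtain x where x: "\<exists>v\<in>verts G. x v \<noteq> 0"
      "\<And>u. u \<in> verts G \<Longrightarrow> (\<Sum>v | v \<in> verts G \<and> u \<rightarrow>\<^bsub>G\<^esub> v. x v) = k * x u" by blast
    define y where "y = vec n (\<lambda>i. x (vs ! i))"
    have y: "y \<in> carrier_vec n" by (simp add: y_def)
    obtain j where "j < n" "x (vs ! j) \<noteq> 0" using x(1) ex by metis
    then have "y \<noteq> 0\<^sub>v n" by (metis y_def index_vec index_zero_vec(1))
    moreover have "A *\<^sub>v y = k \<cdot>\<^sub>v y"
    proof (rule eq_vecI)
      fix i assume "i < dim_vec (k \<cdot>\<^sub>v y)"
      then have i: "i < n" by (simp add: y_def)
      have "(A *\<^sub>v y) $ i = (\<Sum>v | v \<in> verts G \<and> vs ! i \<rightarrow>\<^bsub>G\<^esub> v. x v)"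
        using y i by (intro row) (auto simp: y_def)
      then show "(A *\<^sub>v y) $ i = (k \<cdot>\<^sub>v y) $ i"
        using x(2)[OF mem[OF i]] i by (simp add: y_def)
    qed (simp add: A y_def)
    ultimately show ?L
      unfolding eigenvalue_def eigenvector_def A_def[symmetric] dim using y by blast
  qed
qed

lemma finite_parts: "finite {(i, j :: nat). i < length ss \<and> j < ss ! i}"
proof -
  have "{(i, j :: nat). i < length ss \<and> j < ss ! i} = (SIGMA i:{..<length ss}. {..<ss ! i})" by auto
  then show ?thesis by simp
qed

lemma card_complete_multipartite:
  "card (pverts (complete_multipartite ss)) = sum_list ss"
proof -
  have "{(i, j :: nat). i < length ss \<and> j < ss ! i} = (SIGMA i:{..<length ss}. {..<ss ! i})" by auto
  then show ?thesis
    by (simp add: complete_multipartite_def Let_def card_SigmaI sum_list_sum_nth lessThan_atLeast0)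
qed

lemma pair_graph_complete_multipartite: "pair_graph (complete_multipartite ss)"
proof unfold_locales
  show "finite (pverts (complete_multipartite ss))"
    using finite_parts by (simp add: complete_multipartite_def Let_def)
  then have "finite (pverts (complete_multipartite ss) \<times> pverts (complete_multipartite ss))"
    by simp
  then show "finite (parcs (complete_multipartite ss))"
    by (rule rev_finite_subset) (auto simp: complete_multipartite_def Let_def)
qed (auto simp: complete_multipartite_def Let_def symmetric_def sym_def)

lemma pair_graph_complete_multipartite_plus:
  assumes "ss \<noteq> []" "2 \<le> ss ! 0"
  shows "pair_graph (complete_multipartite_plus ss)"
proof -
  interpret pair_graph "complete_multipartite ss" by (rule pair_graph_complete_multipartite)
  have "(0, 0) \<in> pverts (complete_multipartite ss)" "(0, 1) \<in> pverts (complete_multipartite ss)"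
    using assms by (auto simp: complete_multipartite_def Let_def)
  then show ?thesis
    using pair_finite_verts pair_finite_arcs pair_no_loops arcs_ends_symmetric[OF pair_sym_arcs]
    by unfold_locales
      (auto simp: complete_multipartite_plus_def symmetric_def sym_def
        dest: arc_fst_in_verts arc_snd_in_verts)
qed

lemma turan_sizes_sum:
  assumes "0 < r"
  shows "sum_list (turan_sizes r n) = n"
proof -
  have "(\<Sum>i<r. (n + i) div r) = n"
  proof (induction n)
    case 0
    then show ?case by simp
  next
    case (Suc n)
    have "(\<Sum>i<r. (Suc n + i) div r) + n div r = (\<Sum>i<Suc r. (n + i) div r)"
      by (subst sum.lessThan_Suc_shift) simp
    also have "\<dots> = n + (n div r + 1)" using Suc assms by simp
    finally show ?case by simp
  qed
  then show ?thesis
    by (simp add: turan_sizes_def sum_list_sum_nth lessThan_atLeast0)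
qed

lemma turan_sizes_balanced:
  assumes "0 < r" "a \<in> set (turan_sizes r n)" "b \<in> set (turan_sizes r n)"
  shows "a \<le> b + 1"
proof -
  obtain i j where ij: "i < r" "a = (n + i) div r" "b = (n + j) div r"
    using assms by (auto simp: turan_sizes_def)
  have "a \<le> (n + r) div r" unfolding ij by (rule div_le_mono) (use ij in simp)
  also have "\<dots> = n div r + 1" using assms by simp
  also have "\<dots> \<le> b + 1" unfolding ij by (simp add: div_le_mono)
  finally show ?thesis .
qed

lemma card_turan_graph: "0 < r \<Longrightarrow> card (pverts (turan_graph r n)) = n"
  by (simp add: turan_graph_def card_complete_multipartite turan_sizes_sum)

end

theory Submission
  imports Defs "HOL-Analysis.Function_Topology" "HOL-Analysis.Convex"
begin

text \<open>
  Deleting a vertex of smallest entry in the principal eigenvector raises the ratio of the spectral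
  radius to the order as long as some vertex has degree at most \<open>(1 - 1/r - \<epsilon>)\<close> times the
  order. Either many deletions are possible, or after few of them all degrees are large.

  In the first case the ratio ends well above \<open>1 - 1/r\<close>. A Moon--Moser inequality for cliques weighted
  by the eigenvector then gives a positive proportion of all \<open>(r+1)\<close>-cliques, hence a large complete
  \<open>(r+1)\<close>-partite subgraph, and this contains the required graph.

  In the second case there is an \<open>(r+1)\<close>-clique: by the spectral Turan theorem if nothing was
  deleted, and because the ratio exceeds \<open>1 - 1/r\<close> otherwise. Large degrees allow its vertices to be
  replaced one after the other, until a single edge remains that lies in a positive proportion of all
  possible \<open>(r+1)\<close>-cliques. The other \<open>r - 1\<close> vertices of each have many common neighbours, so there
  are many \<open>r\<close>-cliques all of whose vertices but the first are joined to both ends of that edge.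
  In a blowup of these the edge is added to the first part.
\<close>

section \<open>Rayleigh principle\<close>

text \<open>The excess of the spectral radius over that of the Turan graph may be arbitrarily small,
  so counting cliques in the given graph proves nothing; deletions create the missing excess.
  Initially the ratio is only known to be at least \<open>1 - 1 / r - r / n ^ 2\<close>. One
  deletion gains \<open>\<epsilon> / (4 * n)\<close>, and since the bound on \<open>c\<close> makes
  \<open>n\<close> at least \<open>1024 * r ^ 5\<close>, this already outweighs the shortfall. With
  \<open>\<epsilon> = 1 / (4 * r ^ 3)\<close> the replacement of clique vertices retains about
  \<open>n / (2 * r)\<close> candidates per step; about \<open>n / (4 * r)\<close> deletions leave
  most vertices and raise the ratio by about \<open>1 / (64 * r ^ 4)\<close>. Both cases end with a
  share of order \<open>1 / h\<close> of all tuples, where \<open>h = blowup_base r\<close>. A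
  blowup with parts of size \<open>s\<close> needs \<open>h ^ r * s\<close> to be at most a quarter
  of \<open>ln n\<close>, hence \<open>4 * c * h ^ r \<le> 1\<close>. As
  \<open>(2 * r + 9) * (r + 1) = (2 * r + 11) * r + 9\<close>, the bound on \<open>c\<close> allows
  \<open>h = r ^ (2 * r + 11)\<close> with \<open>r ^ 9\<close> to spare for the 4. The exponent
  \<open>1 - sqrt c\<close> comes from \<open>h \<le> 1 / (2 * sqrt c)\<close>.\<close>

definition nbr_sum :: "('a \<Rightarrow> 'a \<Rightarrow> bool) \<Rightarrow> 'a set \<Rightarrow> ('a \<Rightarrow> real) \<Rightarrow> 'a \<Rightarrow> real" where
  "nbr_sum E S x u = (\<Sum>v | v \<in> S \<and> E u v. x v)"

text \<open>\<open>nbr_sum\<close> is an entry of the adjacency matrix times \<open>x\<close>, and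
  this is the associated quadratic form. With the vertex set \<open>S\<close> as a parameter,
  passing to an induced subgraph changes neither the relation nor the vector.\<close>

definition quad_form :: "('a \<Rightarrow> 'a \<Rightarrow> bool) \<Rightarrow> 'a set \<Rightarrow> ('a \<Rightarrow> real) \<Rightarrow> real" where
  "quad_form E S x = (\<Sum>u\<in>S. x u * nbr_sum E S x u)"

text \<open>The last clause ranges over all vectors: it makes \<open>\<mu>\<close> the largest
  eigenvalue and lets any test vector bound \<open>\<mu>\<close> from below.\<close>

definition principal_pair :: "('a \<Rightarrow> 'a \<Rightarrow> bool) \<Rightarrow> 'a set \<Rightarrow> real \<Rightarrow> ('a \<Rightarrow> real) \<Rightarrow> bool" where
  "principal_pair E S \<mu> x \<longleftrightarrow>
    (\<forall>u\<in>S. 0 \<le> x u) \<and> (\<Sum>u\<in>S. (x u)\<^sup>2) = 1 \<and>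
    (\<forall>u\<in>S. nbr_sum E S x u = \<mu> * x u) \<and>
    (\<forall>y. quad_form E S y \<le> \<mu> * (\<Sum>u\<in>S. (y u)\<^sup>2))"

lemma nbr_sum_eq: "finite S \<Longrightarrow> nbr_sum E S x u = (\<Sum>v\<in>S. if E u v then x v else 0)"
  unfolding nbr_sum_def by (rule sum.inter_filter)

lemma quad_form_eq:
  "finite S \<Longrightarrow> quad_form E S x = (\<Sum>u\<in>S. \<Sum>v\<in>S. if E u v then x u * x v else 0)"
  unfolding quad_form_def
  by (intro sum.cong) (auto simp: nbr_sum_eq sum_distrib_left intro!: sum.cong)

lemma nbr_sum_nonneg: "(\<And>v. v \<in> S \<Longrightarrow> 0 \<le> x v) \<Longrightarrow> 0 \<le> nbr_sum E S x u"
  unfolding nbr_sum_def by (rule sum_nonneg) auto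

text \<open>First-order optimality: if \<open>p\<close> were nonzero, a small \<open>t\<close> with
  the sign of \<open>p\<close> would let the linear term win. This turns maximality of the Rayleigh
  quotient into the eigenvalue equation.\<close>

lemma linear_le_square_imp_zero:
  fixes p q :: real
  assumes "\<And>t. t * p \<le> t\<^sup>2 * q"
  shows "p = 0"
proof (rule ccontr)
  assume "p \<noteq> 0"
  define k where "k = \<bar>q\<bar> + 1"
  have k: "k > 0" "q < k" unfolding k_def by auto
  have "p / k * p \<le> (p / k)\<^sup>2 * q" by (rule assms)
  also have "\<dots> < (p / k)\<^sup>2 * k"
    using k \<open>p \<noteq> 0\<close> by (intro mult_strict_left_mono) auto
  also have "\<dots> = p / k * p" using k by (simp add: power2_eq_square field_simps)
  finally show False by simp
qed

locale adjacency =
  fixes E :: "'a \<Rightarrow> 'a \<Rightarrow> bool"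
  assumes sym: "E u v \<Longrightarrow> E v u" and irrefl: "\<not> E u u"
begin

lemma sym_iff: "E u v \<longleftrightarrow> E v u"
  using sym by blast

text \<open>No term quadratic in \<open>t\<close> appears because \<open>E\<close> has no loops.
  Arbitrary \<open>t\<close> serves optimality, \<open>t = - x u\<close> the deletion of
  \<open>u\<close>.\<close>

lemma quad_form_add_indicator:
  assumes "finite S" "u \<in> S"
  shows "quad_form E S (\<lambda>v. x v + (if v = u then t else 0)) =
    quad_form E S x + 2 * t * nbr_sum E S x u"
proof -
  define e where "e v = (if v = u then t else 0)" for v
  have "quad_form E S (\<lambda>v. x v + e v) =
    (\<Sum>a\<in>S. \<Sum>b\<in>S. (if E a b then x a * x b else 0) + (if E a b then x a * e b else 0)
      + (if E a b then e a * x b else 0) + (if E a b then e a * e b else 0))"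
    unfolding quad_form_eq[OF assms(1)] by (intro sum.cong) (auto simp: algebra_simps)
  also have "\<dots> = quad_form E S x + (\<Sum>a\<in>S. \<Sum>b\<in>S. if E a b then x a * e b else 0)
      + (\<Sum>a\<in>S. \<Sum>b\<in>S. if E a b then e a * x b else 0)
      + (\<Sum>a\<in>S. \<Sum>b\<in>S. if E a b then e a * e b else 0)"
    by (simp add: sum.distrib quad_form_eq[OF assms(1)])
  also have "(\<Sum>a\<in>S. \<Sum>b\<in>S. if E a b then e a * e b else 0) = 0"
    by (intro sum.neutral ballI) (auto simp: e_def irrefl)
  also have "(\<Sum>a\<in>S. \<Sum>b\<in>S. if E a b then x a * e b else 0) =
      (\<Sum>a\<in>S. \<Sum>b\<in>S. if E a b then e a * x b else 0)"
    by (subst sum.swap) (intro sum.cong refl, simp add: sym_iff mult.commute)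
  also have "(\<Sum>a\<in>S. \<Sum>b\<in>S. if E a b then e a * x b else 0) =
      (\<Sum>a\<in>S. if a = u then t * nbr_sum E S x u else 0)"
    by (intro sum.cong refl)
      (auto simp: e_def nbr_sum_eq[OF assms(1)] sum_distrib_left intro!: sum.cong sum.neutral)
  also have "\<dots> = t * nbr_sum E S x u"
    using assms by simp
  finally show ?thesis by (simp add: e_def)
qed

text \<open>The form is maximized over the unit sphere. Absolute values cannot decrease it, and
  varying one coordinate of the nonnegative maximizer gives the eigenvalue equation.\<close>

lemma principal_pair_exists:
  assumes fin: "finite S" and ne: "S \<noteq> {}"
  shows "\<exists>\<mu> x. principal_pair E S \<mu> x"
proof -
  define N where "N x = (\<Sum>u\<in>S. (x u)\<^sup>2)" for x :: "'a \<Rightarrow> real"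
  \<comment> \<open>Coordinates outside \<open>S\<close> are pinned to 0, so that \<open>B\<close>
    is a product of compact sets even over an infinite vertex type.\<close>
  define B where "B = PiE UNIV (\<lambda>i. if i \<in> S then {-1..1} else {0 :: real})"
  define K where "K = B \<inter> {x. N x = 1}"
  have compB: "compact B"
  proof -
    have "compactin (product_topology (\<lambda>i. euclidean) UNIV) B"
      unfolding B_def by (subst compactin_PiE) auto
    then show ?thesis by (simp add: euclidean_product_topology)
  qed
  have contc: "continuous_on A (\<lambda>x :: 'a \<Rightarrow> real. x u)" for u A
    by (rule continuous_on_subset[OF continuous_on_product_coordinates]) simp
  have "closed {x. N x = 1}"
    unfolding N_def by (intro closed_Collect_eq continuous_intros contc)
  then have compK: "compact K"
    unfolding K_def using compB by (rule compact_Int_closed[rotated])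
  have contq: "continuous_on K (quad_form E S)"
  proof -
    have "continuous_on K (\<lambda>x. \<Sum>u\<in>S. x u * (\<Sum>v | v \<in> S \<and> E u v. x v))"
      by (intro continuous_intros contc)
    then show ?thesis by (simp add: quad_form_def nbr_sum_def[abs_def] cong: continuous_on_cong)
  qed
  obtain a where a: "a \<in> S" using ne by blast
  have "(\<lambda>v. if v = a then 1 else 0) \<in> K"
    using a fin by (auto simp: K_def B_def N_def PiE_def if_distrib[of "\<lambda>z. z ^ 2"] cong: if_cong)
  then have "K \<noteq> {}" by blast
  then obtain x0 where x0: "x0 \<in> K" "\<And>y. y \<in> K \<Longrightarrow> quad_form E S y \<le> quad_form E S x0"
    using continuous_attains_sup[OF compK _ contq] by blast
  define \<mu> where "\<mu> = quad_form E S x0"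
  have bound: "quad_form E S y \<le> \<mu> * N y" for y
  proof (cases "N y = 0")
    case True
    then have "\<forall>u\<in>S. y u = 0" unfolding N_def using fin by (simp add: sum_nonneg_eq_0_iff)
    then show ?thesis using True by (simp add: quad_form_def)
  next
    case False
    have Npos: "N y > 0" using False unfolding N_def by (simp add: less_le sum_nonneg)
    define z where "z v = (if v \<in> S then y v / sqrt (N y) else 0)" for v
    have "N z = (\<Sum>u\<in>S. (y u)\<^sup>2 / N y)" unfolding N_def[of z] z_def
      using Npos by (intro sum.cong) (auto simp: power_divide)
    also have "\<dots> = 1" using Npos by (simp add: sum_divide_distrib[symmetric] N_def)
    finally have Nz: "N z = 1" .
    have "\<bar>z v\<bar> \<le> 1" for v
    proof (cases "v \<in> S")
      case True
      have "(z v)\<^sup>2 \<le> N z" unfolding N_def using True fin by (intro member_le_sum) auto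
      then show ?thesis using Nz by (simp add: abs_square_le_1)
    qed (simp add: z_def)
    then have "-1 \<le> z v \<and> z v \<le> 1" for v by (simp add: abs_le_iff minus_le_iff)
    moreover have "z v = 0" if "v \<notin> S" for v using that by (simp add: z_def)
    ultimately have "z \<in> B" by (simp add: B_def PiE_def)
    then have "quad_form E S z \<le> \<mu>" unfolding \<mu>_def using x0(2) Nz by (auto simp: K_def)
    moreover have "quad_form E S z = quad_form E S y / N y"
    proof -
      have "quad_form E S z = (\<Sum>u\<in>S. \<Sum>v\<in>S. (if E u v then y u * y v else 0) / N y)"
        unfolding quad_form_eq[OF fin] using Npos
        by (intro sum.cong) (auto simp: z_def)
      then show ?thesis by (simp add: sum_divide_distrib quad_form_eq[OF fin])
    qed
    ultimately show ?thesis using Npos by (simp add: field_simps)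
  qed
  define x where "x v = \<bar>x0 v\<bar>" for v
  have Nx: "N x = 1" using x0(1) by (simp add: K_def N_def x_def)
  have "quad_form E S x0 \<le> quad_form E S x"
    unfolding quad_form_eq[OF fin] x_def
    by (intro sum_mono) (auto simp: abs_mult[symmetric])
  then have qx: "quad_form E S x = \<mu>" using bound[of x] Nx by (simp add: \<mu>_def)
  have eig: "nbr_sum E S x u = \<mu> * x u" if u: "u \<in> S" for u
  proof -
    have "t * (2 * (nbr_sum E S x u - \<mu> * x u)) \<le> t\<^sup>2 * \<mu>" for t
    proof -
      let ?y = "\<lambda>v. x v + (if v = u then t else 0)"
      have "N ?y = (\<Sum>v\<in>S. (x v)\<^sup>2 + (if v = u then 2 * t * x u + t\<^sup>2 else 0))"
        unfolding N_def by (intro sum.cong) (auto simp: power2_eq_square algebra_simps)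
      also have "\<dots> = 1 + 2 * t * x u + t\<^sup>2"
        using fin u Nx by (simp add: sum.distrib N_def)
      finally have "N ?y = 1 + 2 * t * x u + t\<^sup>2" .
      with bound[of ?y] quad_form_add_indicator[OF fin u, of x t] qx show ?thesis
        by (simp add: algebra_simps)
    qed
    then have "2 * (nbr_sum E S x u - \<mu> * x u) = 0" by (rule linear_le_square_imp_zero)
    then show ?thesis by simp
  qed
  have "principal_pair E S \<mu> x"
    unfolding principal_pair_def using Nx bound eig by (auto simp: N_def x_def)
  then show ?thesis by blast
qed

lemma principal_pair_quad_form:
  assumes "principal_pair E S \<mu> x"
  shows "quad_form E S x = \<mu>"
proof -
  have "quad_form E S x = (\<Sum>u\<in>S. \<mu> * (x u)\<^sup>2)"
    unfolding quad_form_def using assms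
    by (intro sum.cong) (auto simp: principal_pair_def power2_eq_square)
  also have "\<dots> = \<mu>" using assms by (simp add: sum_distrib_left[symmetric] principal_pair_def)
  finally show ?thesis .
qed

lemma principal_pair_nonneg:
  assumes "principal_pair E S \<mu> x"
  shows "0 \<le> \<mu>"
proof -
  have "\<forall>u\<in>S. 0 \<le> x u" using assms by (simp add: principal_pair_def)
  then have "0 \<le> quad_form E S x"
    unfolding quad_form_def by (intro sum_nonneg mult_nonneg_nonneg nbr_sum_nonneg) auto
  then show ?thesis by (simp add: principal_pair_quad_form[OF assms])
qed

end

section \<open>From the Rayleigh quotient to the eigenvalues of the adjacency matrix\<close>

lemma finite_eigenvalues:
  fixes A :: "real mat"
  assumes "A \<in> carrier_mat n n"
  shows "finite {k. eigenvalue A k}"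
proof -
  have "{k. eigenvalue A k} = {k. poly (char_poly A) k = 0}"
    using eigenvalue_root_char_poly[OF assms] by simp
  moreover have "char_poly A \<noteq> 0"
    using degree_monic_char_poly[OF assms] by auto
  ultimately show ?thesis using poly_roots_finite by simp
qed

lemma adjacency_graph:
  assumes "graph G"
  shows "adjacency (\<lambda>u v. u \<rightarrow>\<^bsub>G\<^esub> v)"
proof -
  interpret graph G by fact
  show ?thesis
    using adj_not_same by unfold_locales (auto intro: arcs_ends_symmetric[OF sym_arcs])
qed

text \<open>An eigenvector for \<open>k\<close>, inserted in the Rayleigh bound, gives
  \<open>k \<le> \<mu>\<close>. Finiteness of the set of eigenvalues makes its \<open>Max\<close>
  meaningful.\<close>

lemma largest_eigenvalue_eq_principal:
  assumes "graph G" and pp: "principal_pair (\<lambda>u v. u \<rightarrow>\<^bsub>G\<^esub> v) (verts G) \<mu> x"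
  shows "largest_eigenvalue G = \<mu>"
proof -
  interpret graph G by fact
  have fin: "finite (verts G)" by simp
  note iff = eigenvalue_adjacency_matrix_iff[OF fin]
  have carr: "adjacency_matrix G \<in> carrier_mat (card (verts G)) (card (verts G))"
    by (simp add: adjacency_matrix_def Let_def)
  have "\<exists>v\<in>verts G. x v \<noteq> 0"
  proof (rule ccontr)
    assume "\<not> ?thesis"
    then have "(\<Sum>u\<in>verts G. (x u)\<^sup>2) = 0" by simp
    then show False using pp by (simp add: principal_pair_def)
  qed
  then have ev: "eigenvalue (adjacency_matrix G) \<mu>"
    unfolding iff using pp by (auto simp: principal_pair_def nbr_sum_def)
  have le: "k \<le> \<mu>" if k: "eigenvalue (adjacency_matrix G) k" for k
  proof -
    obtain y v where v: "v \<in> verts G" "y v \<noteq> 0"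
      and y: "\<And>u. u \<in> verts G \<Longrightarrow> nbr_sum (\<lambda>u v. u \<rightarrow>\<^bsub>G\<^esub> v) (verts G) y u = k * y u"
      using k unfolding iff nbr_sum_def by blast
    have "k * (\<Sum>u\<in>verts G. (y u)\<^sup>2) = quad_form (\<lambda>u v. u \<rightarrow>\<^bsub>G\<^esub> v) (verts G) y"
      unfolding quad_form_def sum_distrib_left
      by (intro sum.cong) (auto simp: y power2_eq_square)
    also have "\<dots> \<le> \<mu> * (\<Sum>u\<in>verts G. (y u)\<^sup>2)" using pp by (simp add: principal_pair_def)
    finally have "k * (\<Sum>u\<in>verts G. (y u)\<^sup>2) \<le> \<mu> * (\<Sum>u\<in>verts G. (y u)\<^sup>2)" .
    moreover have "0 < (\<Sum>u\<in>verts G. (y u)\<^sup>2)" using v by (intro sum_pos2[of _ v]) auto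
    ultimately show ?thesis by simp
  qed
  show ?thesis unfolding largest_eigenvalue_def
    using finite_eigenvalues[OF carr] ev le by (intro Max_eqI) auto
qed

section \<open>The spectral Turan theorem\<close>

text \<open>Cliques are ordered tuples, so each one occurs once per ordering. The order makes sums
  over cliques recursive, and the coordinates later become the parts of a blowup.\<close>

definition cliques :: "('a \<Rightarrow> 'a \<Rightarrow> bool) \<Rightarrow> 'a set \<Rightarrow> nat \<Rightarrow> 'a list set" where
  "cliques E S k = {xs. length xs = k \<and> set xs \<subseteq> S \<and> sorted_wrt E xs}"

lemma finite_cliques: "finite S \<Longrightarrow> finite (cliques E S k)"
  by (rule finite_subset[OF _ finite_lists_length_eq[of S k]]) (auto simp: cliques_def)

lemma cliques_0: "cliques E S 0 = {[]}"
  by (auto simp: cliques_def)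

lemma Cons_in_cliques_iff:
  "v # xs \<in> cliques E S (Suc k) \<longleftrightarrow> v \<in> S \<and> (\<forall>w\<in>set xs. E v w) \<and> xs \<in> cliques E S k"
  by (auto simp: cliques_def)

context adjacency
begin

text \<open>Erdos's degree majorization for weighted degrees: the neighbourhood of a vertex of largest
  weighted degree is coloured recursively, and the remaining vertices form one more part.\<close>

lemma weighted_degree_majorization:
  fixes x :: "'a \<Rightarrow> real"
  assumes "finite S" "cliques E S (Suc r) = {}" "\<And>v. v \<in> S \<Longrightarrow> 0 \<le> x v"
  shows "\<exists>p :: 'a \<Rightarrow> nat. (\<forall>v\<in>S. p v < r) \<and>
    (\<forall>v\<in>S. nbr_sum E S x v \<le> (\<Sum>w | w \<in> S \<and> p w \<noteq> p v. x w))"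
  using assms
proof (induction r arbitrary: S)
  case 0
  have "S = {}"
  proof (rule ccontr)
    assume "S \<noteq> {}"
    then obtain v where "v \<in> S" by blast
    then have "[v] \<in> cliques E S (Suc 0)" by (simp add: cliques_def)
    then show False using 0 by blast
  qed
  then show ?case by simp
next
  case (Suc r)
  show ?case
  proof (cases "S = {}")
    case False
    obtain u where u: "u \<in> S" "\<And>v. v \<in> S \<Longrightarrow> nbr_sum E S x v \<le> nbr_sum E S x u"
    proof -
      have "Max (nbr_sum E S x ` S) \<in> nbr_sum E S x ` S" using Suc.prems(1) False by simp
      then obtain u where "u \<in> S" "nbr_sum E S x u = Max (nbr_sum E S x ` S)" by auto
      then show ?thesis using that[of u] Suc.prems(1) by simp
    qed
    define N where "N = {v \<in> S. E u v}"
    have finN: "finite N" using Suc.prems by (simp add: N_def)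
    have "cliques E N (Suc r) = {}"
    proof (rule ccontr)
      assume "cliques E N (Suc r) \<noteq> {}"
      then obtain xs where "xs \<in> cliques E N (Suc r)" by blast
      then have "u # xs \<in> cliques E S (Suc (Suc r))"
        using u(1) by (auto simp: cliques_def N_def)
      then show False using Suc.prems by blast
    qed
    then obtain p :: "'a \<Rightarrow> nat" where p: "\<forall>v\<in>N. p v < r"
      "\<forall>v\<in>N. nbr_sum E N x v \<le> (\<Sum>w | w \<in> N \<and> p w \<noteq> p v. x w)"
      using Suc.IH[of N] finN Suc.prems by (auto simp: N_def)
    define p' where "p' v = (if v \<in> N then p v else r)" for v
    have "nbr_sum E S x v \<le> (\<Sum>w | w \<in> S \<and> p' w \<noteq> p' v. x w)" if v: "v \<in> S" for v
    proof (cases "v \<in> N")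
      case True
      have "nbr_sum E S x v = (\<Sum>w\<in>{w\<in>N. E v w} \<union> {w\<in>S - N. E v w}. x w)"
        unfolding nbr_sum_def by (rule sum.cong) (auto simp: N_def)
      also have "\<dots> = nbr_sum E N x v + (\<Sum>w | w \<in> S - N \<and> E v w. x w)"
        unfolding nbr_sum_def using finN Suc.prems by (subst sum.union_disjoint) auto
      also have "\<dots> \<le> (\<Sum>w | w \<in> N \<and> p w \<noteq> p v. x w) + (\<Sum>w\<in>S - N. x w)"
        using p True Suc.prems by (intro add_mono sum_mono2) auto
      also have "\<dots> = (\<Sum>w\<in>{w\<in>N. p w \<noteq> p v} \<union> (S - N). x w)"
        using finN Suc.prems by (subst sum.union_disjoint) auto
      also have "\<dots> = (\<Sum>w | w \<in> S \<and> p' w \<noteq> p' v. x w)"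
      proof (rule sum.cong)
        have "p v \<noteq> r" using p True by auto
        then show "{w\<in>N. p w \<noteq> p v} \<union> (S - N) = {w \<in> S. p' w \<noteq> p' v}"
          using True by (auto simp: p'_def N_def)
      qed simp
      finally show ?thesis .
    next
      case False
      \<comment> \<open>For a vertex outside \<open>N\<close> the other colours make up exactly
        \<open>N\<close>, whose weight is the maximal weighted degree.\<close>
      have "nbr_sum E S x v \<le> nbr_sum E S x u" using u v by blast
      also have "\<dots> = (\<Sum>w | w \<in> S \<and> p' w \<noteq> p' v. x w)"
        unfolding nbr_sum_def
      proof (rule sum.cong)
        show "{v \<in> S. E u v} = {w \<in> S. p' w \<noteq> p' v}"
          using False p by (force simp: p'_def N_def)
      qed simp
      finally show ?thesis .
    qed
    moreover have "\<forall>v\<in>S. p' v < Suc r" using p by (auto simp: p'_def less_Suc_eq)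
    ultimately show ?thesis by blast
  qed simp
qed

text \<open>Equality to 1 is the equation for the spectral radius of the complete multipartite graph
  with parts \<open>k i\<close>; as the sum decreases in \<open>\<mu>\<close>, the conclusion says
  that this graph has spectral radius at least \<open>\<mu>\<close>. Majorization bounds
  \<open>\<mu>\<close> by the square of the total weight minus the squares of the class weights, and
  a suitably weighted Cauchy-Schwarz inequality removes the eigenvector.\<close>

lemma clique_free_part_sizes:
  assumes fin: "finite S" and free: "cliques E S (Suc r) = {}"
    and pp: "principal_pair E S \<mu> x" and pos: "0 < \<mu>"
  shows "\<exists>k :: nat \<Rightarrow> nat. (\<Sum>i<r. k i) = card S \<and> 1 \<le> (\<Sum>i<r. real (k i) / (\<mu> + real (k i)))"
proof -
  have x0: "\<And>v. v \<in> S \<Longrightarrow> 0 \<le> x v" and x1: "(\<Sum>v\<in>S. (x v)\<^sup>2) = 1"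
    using pp by (auto simp: principal_pair_def)
  obtain p :: "'a \<Rightarrow> nat" where p: "\<forall>v\<in>S. p v < r"
    "\<forall>v\<in>S. nbr_sum E S x v \<le> (\<Sum>w | w \<in> S \<and> p w \<noteq> p v. x w)"
    using weighted_degree_majorization[of S r x] fin free x0 by blast
  define P where "P i = {v \<in> S. p v = i}" for i
  define k where "k i = card (P i)" for i
  define X where "X i = (\<Sum>v\<in>P i. x v)" for i
  define XX where "XX = (\<Sum>v\<in>S. x v)"
  have finP: "finite (P i)" for i using fin by (simp add: P_def)
  have group: "(\<Sum>i<r. \<Sum>v\<in>P i. f v) = (\<Sum>v\<in>S. f v)" for f :: "'a \<Rightarrow> real"
    using p(1) unfolding P_def by (intro sum.group[OF fin]) auto
  have sumX: "(\<Sum>i<r. X i) = XX" unfolding X_def XX_def by (rule group)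
  have sumk: "(\<Sum>i<r. k i) = card S"
    using p(1) unfolding k_def P_def card_eq_sum by (intro sum.group[OF fin]) auto
  have XXpos: "0 < XX"
  proof (rule ccontr)
    assume "\<not> 0 < XX"
    moreover have "0 \<le> XX" unfolding XX_def using x0 by (rule sum_nonneg)
    ultimately have "XX = 0" by simp
    then have "\<forall>v\<in>S. x v = 0" using fin x0 by (simp add: XX_def sum_nonneg_eq_0_iff)
    then show False using x1 by simp
  qed
  have cauchy: "(X i)\<^sup>2 \<le> real (k i) * (\<Sum>v\<in>P i. (x v)\<^sup>2)" for i
    using Cauchy_Schwarz_ineq_sum[of "\<lambda>_. 1" x "P i"] by (simp add: X_def k_def)
  have "\<mu> = quad_form E S x" using principal_pair_quad_form[OF pp] by simp
  also have "\<dots> \<le> (\<Sum>v\<in>S. x v * (\<Sum>w | w \<in> S \<and> p w \<noteq> p v. x w))"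
    unfolding quad_form_def using p(2) x0 by (intro sum_mono mult_left_mono) auto
  also have "\<dots> = (\<Sum>v\<in>S. x v * (XX - X (p v)))"
  proof (intro sum.cong refl)
    fix v assume v: "v \<in> S"
    have "XX = (\<Sum>w\<in>{w\<in>S. p w \<noteq> p v} \<union> P (p v). x w)"
      unfolding XX_def by (rule sum.cong) (auto simp: P_def)
    also have "\<dots> = (\<Sum>w | w \<in> S \<and> p w \<noteq> p v. x w) + X (p v)"
      unfolding X_def using fin finP by (subst sum.union_disjoint) (auto simp: P_def)
    finally show "x v * (\<Sum>w | w \<in> S \<and> p w \<noteq> p v. x w) = x v * (XX - X (p v))" by simp
  qed
  also have "\<dots> = (\<Sum>i<r. \<Sum>v\<in>P i. x v * (XX - X (p v)))" by (rule group[symmetric])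
  also have "\<dots> = (\<Sum>i<r. X i * (XX - X i))"
    unfolding X_def sum_distrib_right by (intro sum.cong refl) (auto simp: P_def)
  also have "\<dots> = XX\<^sup>2 - (\<Sum>i<r. (X i)\<^sup>2)"
    by (simp add: algebra_simps sum_subtractf power2_eq_square sum_distrib_left[symmetric] sumX)
  finally have le: "\<mu> + (\<Sum>i<r. (X i)\<^sup>2) \<le> XX\<^sup>2" by simp
  \<comment> \<open>The squares of the \<open>a i\<close> are to add up to the left side of
    \<open>le\<close>; \<open>b i\<close> is then what Cauchy-Schwarz on the class
    \<open>P i\<close> requires for \<open>X i \<le> a i * b i\<close>.\<close>
  define a where "a i = sqrt (\<mu> * (\<Sum>v\<in>P i. (x v)\<^sup>2) + (X i)\<^sup>2)" for i
  define b where "b i = sqrt (real (k i) / (\<mu> + real (k i)))" for i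
  have nn: "0 \<le> (\<Sum>v\<in>P i. (x v)\<^sup>2)" for i by (simp add: sum_nonneg)
  have Xle: "X i \<le> a i * b i" for i
  proof -
    have "(X i)\<^sup>2 * (\<mu> + real (k i)) \<le> (\<mu> * (\<Sum>v\<in>P i. (x v)\<^sup>2) + (X i)\<^sup>2) * real (k i)"
      using mult_left_mono[OF cauchy[of i], of \<mu>] pos by (simp add: algebra_simps)
    then have "(X i)\<^sup>2 \<le> (\<mu> * (\<Sum>v\<in>P i. (x v)\<^sup>2) + (X i)\<^sup>2) * (real (k i) / (\<mu> + real (k i)))"
      using pos by (simp add: field_simps)
    then have "sqrt ((X i)\<^sup>2) \<le> a i * b i"
      unfolding a_def b_def real_sqrt_mult[symmetric] by (rule real_sqrt_le_mono)
    then show ?thesis by simp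
  qed
  have "XX\<^sup>2 \<le> (\<Sum>i<r. a i * b i)\<^sup>2"
    using Xle XXpos by (intro power_mono) (auto simp: sumX[symmetric] intro: sum_mono)
  also have "\<dots> \<le> (\<Sum>i<r. (a i)\<^sup>2) * (\<Sum>i<r. (b i)\<^sup>2)" by (rule Cauchy_Schwarz_ineq_sum)
  also have "(\<Sum>i<r. (a i)\<^sup>2) = \<mu> + (\<Sum>i<r. (X i)\<^sup>2)"
    unfolding a_def using pos nn
    by (simp add: sum.distrib sum_distrib_left[symmetric] group x1)
  also have "(\<Sum>i<r. (b i)\<^sup>2) = (\<Sum>i<r. real (k i) / (\<mu> + real (k i)))"
    unfolding b_def using pos by simp
  finally have "XX\<^sup>2 \<le> (\<mu> + (\<Sum>i<r. (X i)\<^sup>2)) * (\<Sum>i<r. real (k i) / (\<mu> + real (k i)))" .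
  also have "\<dots> \<le> XX\<^sup>2 * (\<Sum>i<r. real (k i) / (\<mu> + real (k i)))"
    using le pos by (intro mult_right_mono sum_nonneg) auto
  finally have "1 \<le> (\<Sum>i<r. real (k i) / (\<mu> + real (k i)))" using XXpos by simp
  then show ?thesis using sumk by blast
qed

end

text \<open>The line through the graph of the concave function at two consecutive integers lies above
  it at every integer.\<close>

lemma balanced_maximizes_sum:
  fixes m k :: "nat \<Rightarrow> nat"
  assumes pos: "0 < \<mu>" and eq: "(\<Sum>i<r. k i) = (\<Sum>i<r. m i)"
    and m: "\<And>i. i < r \<Longrightarrow> m i = q \<or> m i = Suc q"
  shows "(\<Sum>i<r. real (k i) / (\<mu> + real (k i))) \<le> (\<Sum>i<r. real (m i) / (\<mu> + real (m i)))"
proof -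
  \<comment> \<open>The increment of \<open>t / (\<mu> + t)\<close> from \<open>q\<close> to
    \<open>q + 1\<close>. The error in \<open>key\<close> contains a product of two consecutive
    integers, hence its sign.\<close>
  define s where "s = \<mu> / ((\<mu> + real q) * (\<mu> + real q + 1))"
  define L where "L t = real q / (\<mu> + real q) + (real t - real q) * s" for t :: nat
  have p: "\<mu> + real t > 0" for t using pos by simp
  have key: "L t - real t / (\<mu> + real t) =
      \<mu> * ((real t - real q) * (real t - real q - 1)) / ((\<mu> + real q) * (\<mu> + real q + 1) * (\<mu> + real t))" for t
    using p[of q] p[of t] p[of "Suc q"]
    unfolding L_def s_def by (simp add: divide_simps) (simp add: algebra_simps)
  have "0 \<le> (real t - real q) * (real t - real q - 1)" for t
  proof (cases "t \<le> q")
    case True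
    then show ?thesis by (intro mult_nonpos_nonpos) auto
  qed auto
  then have up: "real t / (\<mu> + real t) \<le> L t" for t
    using key[of t] p[of q] p[of t] p[of "Suc q"] pos
    by (smt (verit) divide_nonneg_pos mult_nonneg_nonneg mult_pos_pos of_nat_Suc)
  have "(\<Sum>i<r. real (k i) / (\<mu> + real (k i))) \<le> (\<Sum>i<r. L (k i))" by (intro sum_mono up)
  also have "\<dots> = (\<Sum>i<r. L (m i))"
  proof -
    have "(\<Sum>i<r. real (k i)) = (\<Sum>i<r. real (m i))" using eq by (metis of_nat_sum)
    then show ?thesis
      unfolding L_def by (simp add: sum.distrib sum_subtractf left_diff_distrib sum_distrib_right[symmetric])
  qed
  also have "\<dots> = (\<Sum>i<r. real (m i) / (\<mu> + real (m i)))"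
  proof (intro sum.cong refl)
    fix i assume "i \<in> {..<r}"
    then have "m i = q \<or> m i = Suc q" using m by simp
    then have "L (m i) - real (m i) / (\<mu> + real (m i)) = 0" unfolding key by auto
    then show "L (m i) = real (m i) / (\<mu> + real (m i))" by simp
  qed
  finally show ?thesis .
qed

section \<open>The Turan graph and its spectral radius\<close>

lemma turan_part_size: "0 < r \<Longrightarrow> i < r \<Longrightarrow> (n + i) div r = n div r \<or> (n + i) div r = Suc (n div r)"
proof -
  assume "0 < r" "i < r"
  then have "n div r \<le> (n + i) div r" "(n + i) div r \<le> (n + r) div r"
    by (intro div_le_mono; simp)+
  moreover have "(n + r) div r = Suc (n div r)" using \<open>0 < r\<close> by simp
  ultimately show ?thesis by linarith
qed

lemma turan_part_sizes_sum: "0 < (r :: nat) \<Longrightarrow> (\<Sum>i<r. (n + i) div r) = n"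
  using turan_sizes_sum[of r n] by (simp add: turan_sizes_def sum_list_sum_nth lessThan_atLeast0)

lemma pverts_turan_graph:
  "pverts (turan_graph r n) = (SIGMA i:{..<r}. {..<(n + i) div r})"
  by (auto simp: turan_graph_def complete_multipartite_def turan_sizes_def Let_def)

lemma sum_turan_graph:
  fixes g :: "nat \<Rightarrow> real"
  shows "(\<Sum>u\<in>pverts (turan_graph r n). g (fst u)) = (\<Sum>i<r. real ((n + i) div r) * g i)"
  unfolding pverts_turan_graph
  using sum.Sigma[of "{..<r}" "\<lambda>i. {..<(n + i) div r}" "\<lambda>i _. g i"] by (simp add: case_prod_unfold)

lemma nbr_sum_turan_graph:
  fixes g :: "nat \<Rightarrow> real"
  assumes u: "u \<in> pverts (turan_graph r n)"
  shows "nbr_sum (\<lambda>u v. u \<rightarrow>\<^bsub>with_proj (turan_graph r n)\<^esub> v) (pverts (turan_graph r n)) (\<lambda>v. g (fst v)) u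
    = (\<Sum>i<r. real ((n + i) div r) * g i) - real ((n + fst u) div r) * g (fst u)"
proof -
  let ?V = "pverts (turan_graph r n)"
  have fin: "finite ?V" by (simp add: pverts_turan_graph)
  have "nbr_sum (\<lambda>u v. u \<rightarrow>\<^bsub>with_proj (turan_graph r n)\<^esub> v) ?V (\<lambda>v. g (fst v)) u
      = (\<Sum>v\<in>?V. if fst v \<noteq> fst u then g (fst v) else 0)"
    unfolding nbr_sum_eq[OF fin] using u
    by (intro sum.cong) (auto simp: turan_graph_def complete_multipartite_def Let_def)
  also have "\<dots> = (\<Sum>i<r. real ((n + i) div r) * (if i \<noteq> fst u then g i else 0))"
    by (rule sum_turan_graph[where g = "\<lambda>i. if i \<noteq> fst u then g i else 0"])
  also have "\<dots> = (\<Sum>i<r. real ((n + i) div r) * g i - (if i = fst u then real ((n + i) div r) * g i else 0))"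
    by (intro sum.cong) auto
  also have "\<dots> = (\<Sum>i<r. real ((n + i) div r) * g i) - real ((n + fst u) div r) * g (fst u)"
    using u by (auto simp: sum_subtractf pverts_turan_graph)
  finally show ?thesis .
qed

lemma graph_turan_graph: "graph (with_proj (turan_graph r n))"
proof -
  interpret pair_graph "turan_graph r n"
    unfolding turan_graph_def by (rule pair_graph_complete_multipartite)
  show ?thesis by unfold_locales
qed

lemma turan_graph_rayleigh:
  assumes "0 < r" "0 < n"
  shows "quad_form (\<lambda>u v. u \<rightarrow>\<^bsub>with_proj (turan_graph r n)\<^esub> v) (pverts (turan_graph r n)) y
    \<le> largest_eigenvalue (with_proj (turan_graph r n)) * (\<Sum>u\<in>pverts (turan_graph r n). (y u)\<^sup>2)"
proof -
  let ?T = "with_proj (turan_graph r n)"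
  interpret adjacency "\<lambda>u v. u \<rightarrow>\<^bsub>?T\<^esub> v" by (rule adjacency_graph[OF graph_turan_graph])
  have "finite (verts ?T)" by (simp add: pverts_turan_graph)
  moreover have "card (verts ?T) = n" using assms card_turan_graph by simp
  ultimately obtain \<mu> x where pp: "principal_pair (\<lambda>u v. u \<rightarrow>\<^bsub>?T\<^esub> v) (verts ?T) \<mu> x"
    using principal_pair_exists[of "verts ?T"] assms by fastforce
  have "largest_eigenvalue ?T = \<mu>"
    by (rule largest_eigenvalue_eq_principal[OF graph_turan_graph pp])
  then show ?thesis using pp by (auto simp: principal_pair_def)
qed

text \<open>The all-ones vector gives the average degree. Part sizes differ from
  \<open>n / r\<close> by at most 1, so their squares exceed the even distribution by at most
  \<open>r\<close> in total. The resulting error \<open>r / n\<close> is small enough to be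
  recovered by one vertex deletion.\<close>

lemma largest_eigenvalue_turan_ge:
  assumes r: "0 < r" and n: "0 < n"
  shows "(1 - 1 / real r) * real n - real r / real n \<le> largest_eigenvalue (with_proj (turan_graph r n))"
proof -
  let ?V = "pverts (turan_graph r n)"
  let ?m = "\<lambda>i. real ((n + i) div r)"
  let ?E = "\<lambda>u v. u \<rightarrow>\<^bsub>with_proj (turan_graph r n)\<^esub> v"
  have sum_m: "(\<Sum>i<r. ?m i) = real n" using turan_part_sizes_sum[OF r, of n] by (metis of_nat_sum)
  have "quad_form ?E ?V (\<lambda>_. 1) = (\<Sum>u\<in>?V. real n - ?m (fst u))"
    unfolding quad_form_def using nbr_sum_turan_graph[where g = "\<lambda>_. 1" and n = n and r = r] sum_m
    by (intro sum.cong) auto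
  also have "\<dots> = (\<Sum>i<r. ?m i * (real n - ?m i))"
    by (rule sum_turan_graph[where g = "\<lambda>i. real n - ?m i"])
  also have "\<dots> = real n * real n - (\<Sum>i<r. (?m i)\<^sup>2)"
    by (simp add: right_diff_distrib sum_subtractf sum_distrib_right[symmetric] sum_m power2_eq_square)
  finally have q: "quad_form ?E ?V (\<lambda>_. 1) = real n * real n - (\<Sum>i<r. (?m i)\<^sup>2)" .
  have "(?m i - real n / real r)\<^sup>2 \<le> 1" if "i < r" for i
  proof -
    have "real n = real r * real (n div r) + real (n mod r)"
      by (metis mult_div_mod_eq of_nat_add of_nat_mult)
    then have "real n / real r = real (n div r) + real (n mod r) / real r"
      using r by (simp add: field_simps)
    moreover have "0 \<le> real (n mod r) / real r" "real (n mod r) / real r \<le> 1" using r by auto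
    ultimately have "\<bar>?m i - real n / real r\<bar> \<le> 1"
      using turan_part_size[OF r that, of n] by auto
    then show ?thesis by (simp add: abs_square_le_1)
  qed
  then have "(\<Sum>i<r. (?m i - real n / real r)\<^sup>2) \<le> (\<Sum>i<r. 1)" by (intro sum_mono) auto
  moreover have "(\<Sum>i<r. (?m i - real n / real r)\<^sup>2) =
      (\<Sum>i<r. (?m i)\<^sup>2) - 2 * (real n / real r) * (\<Sum>i<r. ?m i) + real r * (real n / real r)\<^sup>2"
    by (simp add: power2_diff sum.distrib sum_subtractf sum_distrib_left sum_distrib_right mult_ac)
  moreover have "2 * (real n / real r) * real n - real r * (real n / real r)\<^sup>2 = real n * real n / real r"
    using r by (simp add: power2_eq_square field_simps)
  ultimately have "(\<Sum>i<r. (?m i)\<^sup>2) \<le> real n * real n / real r + real r"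
    unfolding sum_m by simp
  then have "real n * real n - (real n * real n / real r + real r) \<le> quad_form ?E ?V (\<lambda>_. 1)"
    unfolding q by simp
  also have "\<dots> \<le> largest_eigenvalue (with_proj (turan_graph r n)) * (\<Sum>u\<in>?V. 1\<^sup>2)"
    by (rule turan_graph_rayleigh[OF r n])
  also have "(\<Sum>u\<in>?V. 1\<^sup>2) = real n" using card_turan_graph[OF r] by simp
  finally show ?thesis using n r by (simp add: field_simps)
qed

text \<open>Balancing the part sizes of the clique-free colouring preserves their inequality for
  \<open>\<mu>\<close>, and the balanced inequality supplies a test vector on the Turan
  graph.\<close>

theorem (in adjacency) spectral_turan:
  assumes fin: "finite S" and r: "0 < r" and free: "cliques E S (Suc r) = {}"
    and pp: "principal_pair E S \<mu> x"
  shows "\<mu> \<le> largest_eigenvalue (with_proj (turan_graph r (card S)))"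
proof -
  define n where "n = card S"
  let ?V = "pverts (turan_graph r n)"
  let ?m = "\<lambda>i. real ((n + i) div r)"
  let ?E = "\<lambda>u v. u \<rightarrow>\<^bsub>with_proj (turan_graph r n)\<^esub> v"
  have "S \<noteq> {}" using pp by (auto simp: principal_pair_def)
  then have n: "0 < n" using fin by (simp add: n_def card_gt_0_iff)
  note ray = turan_graph_rayleigh[OF r n]
  have cardV: "card ?V = n" by (rule card_turan_graph[OF r])
  have "\<mu> \<le> largest_eigenvalue (with_proj (turan_graph r n))"
  proof (cases "0 < \<mu>")
    \<comment> \<open>The quotients in the other case require \<open>\<mu> > 0\<close>; here it is
      enough that the Turan graph has nonnegative spectral radius.\<close>
    case False
    have "0 \<le> quad_form ?E ?V (\<lambda>_. 1)"
      unfolding quad_form_def by (intro sum_nonneg mult_nonneg_nonneg nbr_sum_nonneg) auto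
    also have "\<dots> \<le> largest_eigenvalue (with_proj (turan_graph r n)) * real n"
      using ray[of "\<lambda>_. 1"] cardV by simp
    finally show ?thesis using False n by (simp add: zero_le_mult_iff)
  next
    case True
    obtain k :: "nat \<Rightarrow> nat" where k: "(\<Sum>i<r. k i) = n" "1 \<le> (\<Sum>i<r. real (k i) / (\<mu> + real (k i)))"
      using clique_free_part_sizes[OF fin free pp True] unfolding n_def by blast
    have "(\<Sum>i<r. real (k i) / (\<mu> + real (k i))) \<le> (\<Sum>i<r. ?m i / (\<mu> + ?m i))"
      using turan_part_size[OF r] k(1) turan_part_sizes_sum[OF r]
      by (intro balanced_maximizes_sum[OF True, where q = "n div r"]) auto
    then have one: "1 \<le> (\<Sum>i<r. ?m i / (\<mu> + ?m i))" using k(2) by simp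
    \<comment> \<open>a subeigenvector: \<open>A g \<ge> \<mu> g\<close> holds because \<open>g\<close> sums to at least 1 over the vertices\<close>
    define g where "g i = 1 / (\<mu> + ?m i)" for i
    have gpos: "0 < g i" for i using True by (simp add: g_def)
    have "\<mu> * (g (fst u))\<^sup>2 \<le> g (fst u) * nbr_sum ?E ?V (\<lambda>v. g (fst v)) u" if u: "u \<in> ?V" for u
    proof -
      have "\<mu> * g (fst u) = 1 - ?m (fst u) * g (fst u)"
        using True by (simp add: g_def field_simps)
      also have "\<dots> \<le> nbr_sum ?E ?V (\<lambda>v. g (fst v)) u"
        unfolding nbr_sum_turan_graph[OF u] using one by (simp add: g_def)
      finally show ?thesis using gpos[of "fst u"] by (simp add: power2_eq_square)
    qed
    then have "\<mu> * (\<Sum>u\<in>?V. (g (fst u))\<^sup>2) \<le> quad_form ?E ?V (\<lambda>v. g (fst v))"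
      unfolding quad_form_def sum_distrib_left by (rule sum_mono)
    also have "\<dots> \<le> largest_eigenvalue (with_proj (turan_graph r n)) * (\<Sum>u\<in>?V. (g (fst u))\<^sup>2)"
      by (rule ray)
    finally have "\<mu> * (\<Sum>u\<in>?V. (g (fst u))\<^sup>2) \<le>
      largest_eigenvalue (with_proj (turan_graph r n)) * (\<Sum>u\<in>?V. (g (fst u))\<^sup>2)" .
    moreover have "0 < (\<Sum>u\<in>?V. (g (fst u))\<^sup>2)"
      using n gpos cardV by (intro sum_pos) (auto simp: card_gt_0_iff less_imp_neq[symmetric] intro: card_ge_0_finite)
    ultimately show ?thesis by simp
  qed
  then show ?thesis by (simp add: n_def)
qed

section \<open>Cliques weighted by the principal eigenvector\<close>

definition clique_weight :: "('a \<Rightarrow> 'a \<Rightarrow> bool) \<Rightarrow> 'a set \<Rightarrow> ('a \<Rightarrow> real) \<Rightarrow> nat \<Rightarrow> real" where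
  "clique_weight E S x k = (\<Sum>xs\<in>cliques E S k. prod_list (map x xs))"

definition common_nbr_sum :: "('a \<Rightarrow> 'a \<Rightarrow> bool) \<Rightarrow> 'a set \<Rightarrow> ('a \<Rightarrow> real) \<Rightarrow> 'a list \<Rightarrow> real" where
  "common_nbr_sum E S x ys = (\<Sum>v | v \<in> S \<and> (\<forall>w\<in>set ys. E v w). x v)"

lemma common_nbr_sum_eq:
  "finite S \<Longrightarrow> common_nbr_sum E S x ys = (\<Sum>v\<in>S. if \<forall>w\<in>set ys. E v w then x v else 0)"
  unfolding common_nbr_sum_def by (rule sum.inter_filter)

lemma prod_list_map_nonneg:
  fixes x :: "'a \<Rightarrow> real"
  shows "(\<And>v. v \<in> set xs \<Longrightarrow> 0 \<le> x v) \<Longrightarrow> 0 \<le> prod_list (map x xs)"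
  by (induction xs) auto

context adjacency
begin

lemma insert_in_cliques_iff:
  assumes "length ys = k" "i \<le> k"
  shows "take i ys @ v # drop i ys \<in> cliques E S (Suc k) \<longleftrightarrow>
    ys \<in> cliques E S k \<and> v \<in> S \<and> (\<forall>w\<in>set ys. E v w)"
proof -
  obtain as bs where ys: "ys = as @ bs" "as = take i ys" "bs = drop i ys"
    by (metis append_take_drop_id)
  have "as @ v # bs \<in> cliques E S (Suc k) \<longleftrightarrow>
      as @ bs \<in> cliques E S k \<and> v \<in> S \<and> (\<forall>w\<in>set (as @ bs). E v w)"
    using assms ys(1) by (auto simp: cliques_def sorted_wrt_append intro: sym)
  then show ?thesis using ys by metis
qed

text \<open>Deleting the \<open>i\<close>-th entry and inserting a common neighbour there are
  inverse to each other; symmetry of \<open>E\<close> admits every position. The position is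
  arbitrary because the Moon-Moser count deletes each entry in turn.\<close>

lemma sum_cliques_insert:
  fixes f :: "'a list \<Rightarrow> real"
  assumes fin: "finite S" and i: "i \<le> k"
  shows "(\<Sum>zs\<in>cliques E S (Suc k). f zs) =
    (\<Sum>ys\<in>cliques E S k. \<Sum>v | v \<in> S \<and> (\<forall>w\<in>set ys. E v w). f (take i ys @ v # drop i ys))"
proof -
  let ?D = "SIGMA ys:cliques E S k. {v \<in> S. \<forall>w\<in>set ys. E v w}"
  have "(\<Sum>zs\<in>cliques E S (Suc k). f zs) = (\<Sum>(ys, v)\<in>?D. f (take i ys @ v # drop i ys))"
  proof (rule sum.reindex_bij_witness[where
        i = "\<lambda>(ys, v). take i ys @ v # drop i ys" and
        j = "\<lambda>zs. (take i zs @ drop (Suc i) zs, zs ! i)"])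
    fix zs assume zs: "zs \<in> cliques E S (Suc k)"
    then have len: "length zs = Suc k" by (simp add: cliques_def)
    let ?ys = "take i zs @ drop (Suc i) zs"
    have eq: "take i ?ys @ zs ! i # drop i ?ys = zs"
      using len i by (simp add: id_take_nth_drop[symmetric])
    then show "(case (?ys, zs ! i) of (ys, v) \<Rightarrow> take i ys @ v # drop i ys) = zs" by simp
    have "length ?ys = k" using len i by simp
    then have "?ys \<in> cliques E S k \<and> zs ! i \<in> S \<and> (\<forall>w\<in>set ?ys. E (zs ! i) w)"
      using insert_in_cliques_iff[of ?ys k i "zs ! i" S] i zs eq by simp
    then show "(?ys, zs ! i) \<in> ?D" by auto
    show "(case (?ys, zs ! i) of (ys, v) \<Rightarrow> f (take i ys @ v # drop i ys)) = f zs"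
      using eq by simp
  next
    fix p assume p: "p \<in> ?D"
    obtain ys v where pv: "p = (ys, v)" by force
    have ys: "ys \<in> cliques E S k" "v \<in> S" "\<forall>w\<in>set ys. E v w" using p pv by auto
    then have len: "length ys = k" by (simp add: cliques_def)
    show "(case p of (ys, v) \<Rightarrow> take i ys @ v # drop i ys) \<in> cliques E S (Suc k)"
      using insert_in_cliques_iff[OF len i] ys by (simp add: pv)
    show "(take i (case p of (ys, v) \<Rightarrow> take i ys @ v # drop i ys) @
          drop (Suc i) (case p of (ys, v) \<Rightarrow> take i ys @ v # drop i ys),
         (case p of (ys, v) \<Rightarrow> take i ys @ v # drop i ys) ! i) = p"
      using len i by (simp add: pv nth_append min_def)
  qed
  also have "\<dots> = (\<Sum>ys\<in>cliques E S k. \<Sum>v | v \<in> S \<and> (\<forall>w\<in>set ys. E v w). f (take i ys @ v # drop i ys))"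
    using fin by (subst sum.Sigma) (auto simp: finite_cliques)
  finally show ?thesis .
qed

lemma clique_weight_Suc:
  assumes "finite S"
  shows "clique_weight E S x (Suc k) =
    (\<Sum>ys\<in>cliques E S k. prod_list (map x ys) * common_nbr_sum E S x ys)"
  unfolding clique_weight_def common_nbr_sum_def sum_cliques_insert[OF assms, of 0 k, simplified]
  by (simp add: sum_distrib_left mult.commute)

text \<open>For a fixed remainder \<open>ys\<close> the deleted entry runs over the common
  neighbours of \<open>ys\<close>, so their weight occurs twice: from the summation and from the
  summand.\<close>

lemma sum_common_nbr_sum_delete:
  assumes fin: "finite S" and i: "i \<le> k"
  shows "(\<Sum>zs\<in>cliques E S (Suc k). prod_list (map x zs) * common_nbr_sum E S x (take i zs @ drop (Suc i) zs))
    = (\<Sum>ys\<in>cliques E S k. prod_list (map x ys) * (common_nbr_sum E S x ys)\<^sup>2)"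
  unfolding sum_cliques_insert[OF fin i]
proof (intro sum.cong refl)
  fix ys assume "ys \<in> cliques E S k"
  then have len: "length ys = k" by (simp add: cliques_def)
  let ?N = "{v \<in> S. \<forall>w\<in>set ys. E v w}"
  have w: "prod_list (map x (take i ys @ v # drop i ys)) = prod_list (map x ys) * x v" for v
  proof -
    have "prod_list (map x ys) = prod_list (map x (take i ys)) * prod_list (map x (drop i ys))"
      by (metis append_take_drop_id map_append prod_list.append)
    then show ?thesis by simp
  qed
  have d: "take i (take i ys @ v # drop i ys) @ drop (Suc i) (take i ys @ v # drop i ys) = ys" for v
    using len i by (simp add: min_def)
  show "(\<Sum>v\<in>?N. prod_list (map x (take i ys @ v # drop i ys)) *
      common_nbr_sum E S x (take i (take i ys @ v # drop i ys) @ drop (Suc i) (take i ys @ v # drop i ys)))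
    = prod_list (map x ys) * (common_nbr_sum E S x ys)\<^sup>2"
    unfolding w d
    by (simp add: power2_eq_square common_nbr_sum_def sum_distrib_left[symmetric] sum_distrib_right[symmetric])
qed

text \<open>A vertex not adjacent to some entry of \<open>zs\<close> is counted only when that entry
  is deleted, so at most once; a common neighbour of all entries is counted \<open>k + 1\<close>
  times.\<close>

lemma common_nbr_sum_delete_le:
  assumes fin: "finite S" and x0: "\<And>v. v \<in> S \<Longrightarrow> 0 \<le> x v" and len: "length zs = Suc k"
  shows "(\<Sum>i<Suc k. common_nbr_sum E S x (take i zs @ drop (Suc i) zs))
    \<le> (\<Sum>v\<in>S. x v) + real k * common_nbr_sum E S x zs"
proof -
  define A where "A y = {i. i < Suc k \<and> (\<forall>w\<in>set (take i zs @ drop (Suc i) zs). E y w)}" for y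
  have A: "real (card (A y)) \<le> 1 + real k * (if \<forall>w\<in>set zs. E y w then 1 else 0)" for y
  proof (cases "\<forall>w\<in>set zs. E y w")
    case True
    have "card (A y) \<le> card {..<Suc k}" unfolding A_def by (intro card_mono) auto
    then show ?thesis using True by simp
  next
    case False
    then obtain j where j: "j < Suc k" "\<not> E y (zs ! j)" using len by (metis in_set_conv_nth)
    have "i = j" if "i \<in> A y" for i
    proof (rule ccontr)
      assume "i \<noteq> j"
      have i: "i < Suc k" using that by (simp add: A_def)
      have "zs ! j \<in> set (take i zs @ drop (Suc i) zs)"
      proof (cases "j < i")
        case True
        then have "zs ! j \<in> set (take i zs)" using len i by (auto simp: in_set_conv_nth intro!: exI[of _ j])
        then show ?thesis by simp
      next
        case False
        then have "Suc i \<le> j" using \<open>i \<noteq> j\<close> by simp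
        then have "zs ! j \<in> set (drop (Suc i) zs)"
          using len j(1) by (auto simp: in_set_conv_nth intro!: exI[of _ "j - Suc i"])
        then show ?thesis by simp
      qed
      then show False using that j(2) unfolding A_def by blast
    qed
    then have "A y \<subseteq> {j}" by blast
    then have "card (A y) \<le> card {j}" by (intro card_mono) auto
    then show ?thesis using False by auto
  qed
  have "(\<Sum>i<Suc k. common_nbr_sum E S x (take i zs @ drop (Suc i) zs)) =
      (\<Sum>y\<in>S. \<Sum>i<Suc k. if \<forall>w\<in>set (take i zs @ drop (Suc i) zs). E y w then x y else 0)"
    unfolding common_nbr_sum_eq[OF fin] by (rule sum.swap)
  also have "\<dots> = (\<Sum>y\<in>S. x y * real (card (A y)))"
  proof (intro sum.cong refl)
    fix y
    have "(\<Sum>i<Suc k. if \<forall>w\<in>set (take i zs @ drop (Suc i) zs). E y w then x y else 0) = (\<Sum>i\<in>A y. x y)"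
      unfolding A_def by (subst sum.inter_filter[symmetric]) (auto intro!: sum.cong)
    then show "(\<Sum>i<Suc k. if \<forall>w\<in>set (take i zs @ drop (Suc i) zs). E y w then x y else 0) = x y * real (card (A y))"
      by simp
  qed
  also have "\<dots> \<le> (\<Sum>y\<in>S. x y * (1 + real k * (if \<forall>w\<in>set zs. E y w then 1 else 0)))"
    using A x0 by (intro sum_mono mult_left_mono) auto
  also have "\<dots> = (\<Sum>y\<in>S. x y + real k * (if \<forall>w\<in>set zs. E y w then x y else 0))"
    by (intro sum.cong) (auto simp: algebra_simps)
  also have "\<dots> = (\<Sum>v\<in>S. x v) + real k * common_nbr_sum E S x zs"
    by (simp add: sum.distrib common_nbr_sum_eq[OF fin] sum_distrib_left[symmetric])
  finally show ?thesis .
qed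

text \<open>\<open>Q\<close> is the second moment of \<open>common_nbr_sum\<close> over the
  \<open>k\<close>-cliques: deleting entries of larger cliques bounds it from above, Cauchy-Schwarz
  with the clique weights from below. The form without division allows weights that vanish.\<close>

lemma weighted_moon_moser:
  assumes fin: "finite S" and x0: "\<And>v. v \<in> S \<Longrightarrow> 0 \<le> x v"
  shows "real (Suc k) * (clique_weight E S x (Suc k))\<^sup>2 \<le>
    (real k * clique_weight E S x (Suc (Suc k)) + (\<Sum>v\<in>S. x v) * clique_weight E S x (Suc k))
      * clique_weight E S x k"
proof -
  let ?w = "\<lambda>ys. prod_list (map x ys)"
  let ?D = "common_nbr_sum E S x"
  define Q where "Q = (\<Sum>ys\<in>cliques E S k. ?w ys * (?D ys)\<^sup>2)"
  have w0: "0 \<le> ?w ys" if "ys \<in> cliques E S j" for ys j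
    using that x0 by (intro prod_list_map_nonneg) (auto simp: cliques_def)
  have "real (Suc k) * Q = (\<Sum>i<Suc k. \<Sum>zs\<in>cliques E S (Suc k). ?w zs * ?D (take i zs @ drop (Suc i) zs))"
    unfolding Q_def by (simp add: sum_common_nbr_sum_delete[OF fin] del: sum.lessThan_Suc)
  also have "\<dots> = (\<Sum>zs\<in>cliques E S (Suc k). ?w zs * (\<Sum>i<Suc k. ?D (take i zs @ drop (Suc i) zs)))"
    unfolding sum_distrib_left by (rule sum.swap)
  also have "\<dots> \<le> (\<Sum>zs\<in>cliques E S (Suc k). ?w zs * ((\<Sum>v\<in>S. x v) + real k * ?D zs))"
    using common_nbr_sum_delete_le[OF fin x0] w0
    by (intro sum_mono mult_left_mono) (auto simp: cliques_def)
  also have "\<dots> = real k * clique_weight E S x (Suc (Suc k)) + (\<Sum>v\<in>S. x v) * clique_weight E S x (Suc k)"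
    unfolding clique_weight_Suc[OF fin, of x "Suc k"] clique_weight_def[of E S x "Suc k"]
    by (simp add: algebra_simps sum.distrib sum_distrib_left)
  finally have Q: "real (Suc k) * Q \<le>
    real k * clique_weight E S x (Suc (Suc k)) + (\<Sum>v\<in>S. x v) * clique_weight E S x (Suc k)" .
  have "(clique_weight E S x (Suc k))\<^sup>2 = (\<Sum>ys\<in>cliques E S k. sqrt (?w ys) * (sqrt (?w ys) * ?D ys))\<^sup>2"
    unfolding clique_weight_Suc[OF fin] using w0
    by (intro arg_cong[where f = "\<lambda>z. z\<^sup>2"] sum.cong) (auto simp: mult.assoc[symmetric])
  also have "\<dots> \<le> (\<Sum>ys\<in>cliques E S k. (sqrt (?w ys))\<^sup>2) * (\<Sum>ys\<in>cliques E S k. (sqrt (?w ys) * ?D ys)\<^sup>2)"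
    by (rule Cauchy_Schwarz_ineq_sum)
  also have "\<dots> = clique_weight E S x k * Q"
    unfolding clique_weight_def Q_def using w0 by (simp add: power_mult_distrib)
  finally have "real (Suc k) * (clique_weight E S x (Suc k))\<^sup>2 \<le> real (Suc k) * (clique_weight E S x k * Q)"
    by (intro mult_left_mono) auto
  also have "\<dots> = (real (Suc k) * Q) * clique_weight E S x k" by simp
  also have "\<dots> \<le> (real k * clique_weight E S x (Suc (Suc k)) + (\<Sum>v\<in>S. x v) * clique_weight E S x (Suc k))
      * clique_weight E S x k"
    using Q w0 by (intro mult_right_mono) (auto simp: clique_weight_def intro!: sum_nonneg)
  finally show ?thesis .
qed

text \<open>The entries of the eigenvector are at most \<open>X / \<mu>\<close>, where \<open>X\<close> is their sum, so that \<open>X\<close> cancels when the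
  weighted count is turned into a count.\<close>

theorem card_cliques_spectral_ge:
  assumes fin: "finite S" and pp: "principal_pair E S \<mu> x" and r: "0 < r"
    and \<sigma>: "\<sigma> = 1 - \<mu> / real (card S)" "real r * \<sigma> < 1"
  shows "\<mu> ^ Suc r * (\<Prod>k\<le>r. 1 - real k * \<sigma>) \<le> real (card (cliques E S (Suc r)))"
proof -
  let ?F = "clique_weight E S x"
  define X where "X = (\<Sum>v\<in>S. x v)"
  define n where "n = real (card S)"
  have x0: "\<And>v. v \<in> S \<Longrightarrow> 0 \<le> x v" and x1: "(\<Sum>v\<in>S. (x v)\<^sup>2) = 1"
    using pp by (auto simp: principal_pair_def)
  have "S \<noteq> {}" using x1 by auto
  then have n: "0 < n" using fin by (simp add: n_def card_gt_0_iff)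
  have \<mu>0: "0 \<le> \<mu>" by (rule principal_pair_nonneg[OF pp])
  then have "\<sigma> \<le> 1" using \<sigma> n by (simp add: n_def)
  have ks: "real k * \<sigma> < 1" if "k \<le> r" for k
  proof (cases "0 \<le> \<sigma>")
    case True
    then have "real k * \<sigma> \<le> real r * \<sigma>" using that by (intro mult_right_mono) auto
    then show ?thesis using \<sigma>(2) by simp
  next
    case False
    then have "real k * \<sigma> \<le> 0" by (simp add: mult_nonneg_nonpos)
    then show ?thesis by simp
  qed
  have \<mu>n: "\<mu> = (1 - \<sigma>) * n" using \<sigma>(1) n by (simp add: n_def)
  have \<mu>: "0 < \<mu>" using ks[of 1] r n unfolding \<mu>n by simp
  have F0: "?F 0 = 1" by (simp add: clique_weight_def cliques_0)
  have F1: "?F (Suc 0) = X"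
    unfolding clique_weight_Suc[OF fin] by (simp add: cliques_0 common_nbr_sum_def X_def)
  \<comment> \<open>The weight of the ordered edges is the quadratic form: here the spectral radius
    enters the count.\<close>
  have F2: "?F (Suc (Suc 0)) = \<mu>"
  proof -
    have "cliques E S (Suc 0) = (\<lambda>v. [v]) ` S"
      by (auto simp: cliques_def length_Suc_conv)
    then have "?F (Suc (Suc 0)) = (\<Sum>v\<in>S. x v * common_nbr_sum E S x [v])"
      unfolding clique_weight_Suc[OF fin] by (simp add: sum.reindex inj_on_def)
    also have "\<dots> = quad_form E S x"
      unfolding quad_form_def nbr_sum_def common_nbr_sum_def by (simp add: sym_iff)
    finally show ?thesis by (simp add: principal_pair_quad_form[OF pp])
  qed
  have X2: "X\<^sup>2 \<le> n"
    using Cauchy_Schwarz_ineq_sum[of "\<lambda>_. 1" x S] x1 by (simp add: X_def n_def)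
  have X: "0 < X"
  proof (rule ccontr)
    assume "\<not> 0 < X"
    moreover have "0 \<le> X" unfolding X_def using x0 by (rule sum_nonneg)
    ultimately have "X = 0" by simp
    then have "\<forall>v\<in>S. x v = 0" using fin x0 by (simp add: X_def sum_nonneg_eq_0_iff)
    then show False using x1 by simp
  qed
  \<comment> \<open>The recursion starts from \<open>X ^ 2 \<le> n\<close>. It reproduces its shape
    exactly because \<open>(k + 2) * p - 1 = (k + 1) * (1 - (k + 2) * \<sigma>)\<close> for
    \<open>p = 1 - (k + 1) * \<sigma>\<close>. Positivity is carried along for the cancellation of
    \<open>?F (Suc k)\<close>.\<close>
  have step: "0 < ?F (Suc k) \<and> (1 - real (Suc k) * \<sigma>) * X * ?F (Suc k) \<le> ?F (Suc (Suc k))"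
    if "Suc k \<le> r" for k
    using that
  proof (induction k)
    case 0
    have "(1 - \<sigma>) * X\<^sup>2 \<le> (1 - \<sigma>) * n" using X2 ks[of 1] r by (intro mult_left_mono) auto
    then show ?case using X by (simp add: F1 F2 \<mu>n[symmetric] power2_eq_square mult.assoc)
  next
    case (Suc k)
    define p where "p = 1 - real (Suc k) * \<sigma>"
    have IH: "0 < ?F (Suc k)" "p * X * ?F (Suc k) \<le> ?F (Suc (Suc k))"
      using Suc unfolding p_def by auto
    have p: "0 < p" using ks[of "Suc k"] Suc.prems by (simp add: p_def)
    have pos: "0 < ?F (Suc (Suc k))" using IH p X by (smt (verit) mult_pos_pos)
    have "real (Suc (Suc k)) * (?F (Suc (Suc k)) * (p * X * ?F (Suc k))) \<le>
        real (Suc (Suc k)) * (?F (Suc (Suc k)))\<^sup>2"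
      unfolding power2_eq_square using IH(2) pos by (intro mult_left_mono) auto
    also have "\<dots> \<le> (real (Suc k) * ?F (Suc (Suc (Suc k))) + X * ?F (Suc (Suc k))) * ?F (Suc k)"
      unfolding X_def by (rule weighted_moon_moser[OF fin x0])
    finally have "(real (Suc (Suc k)) * ?F (Suc (Suc k)) * (p * X)) * ?F (Suc k) \<le>
        (real (Suc k) * ?F (Suc (Suc (Suc k))) + X * ?F (Suc (Suc k))) * ?F (Suc k)"
      by (simp only: mult_ac)
    then have "real (Suc (Suc k)) * ?F (Suc (Suc k)) * (p * X) \<le>
        real (Suc k) * ?F (Suc (Suc (Suc k))) + X * ?F (Suc (Suc k))"
      using IH(1) by (simp only: mult_le_cancel_right_pos)
    then have "(real (Suc (Suc k)) * p - 1) * X * ?F (Suc (Suc k)) \<le> real (Suc k) * ?F (Suc (Suc (Suc k)))"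
      by (simp only: algebra_simps)
    moreover have "real (Suc (Suc k)) * p - 1 = real (Suc k) * (1 - real (Suc (Suc k)) * \<sigma>)"
      unfolding p_def by (simp add: algebra_simps)
    ultimately have "real (Suc k) * ((1 - real (Suc (Suc k)) * \<sigma>) * X * ?F (Suc (Suc k)))
        \<le> real (Suc k) * ?F (Suc (Suc (Suc k)))"
      by (simp only: mult.assoc)
    then show ?case using pos by (simp only: mult_le_cancel_left_pos of_nat_0_less_iff zero_less_Suc)
  qed
  have lower: "X ^ Suc k * (\<Prod>j\<le>k. 1 - real j * \<sigma>) \<le> ?F (Suc k)" if "k \<le> r" for k
    using that
  proof (induction k)
    case 0
    then show ?case by (simp add: F1)
  next
    case (Suc k)
    let ?p = "1 - real (Suc k) * \<sigma>"
    have "X ^ Suc (Suc k) * (\<Prod>j\<le>Suc k. 1 - real j * \<sigma>) =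
        ?p * X * (X ^ Suc k * (\<Prod>j\<le>k. 1 - real j * \<sigma>))"
      by (simp only: prod.atMost_Suc power_Suc mult_ac)
    also have "\<dots> \<le> ?p * X * ?F (Suc k)"
      using Suc ks[of "Suc k"] X by (intro mult_left_mono) auto
    also have "\<dots> \<le> ?F (Suc (Suc k))" using step Suc.prems by blast
    finally show ?case .
  qed
  have xle: "x v \<le> X / \<mu>" if v: "v \<in> S" for v
  proof -
    have "\<mu> * x v = nbr_sum E S x v" using pp v by (simp add: principal_pair_def)
    also have "\<dots> \<le> X" unfolding nbr_sum_def X_def using fin x0 by (intro sum_mono2) auto
    finally show ?thesis using \<mu> by (simp add: field_simps)
  qed
  have "prod_list (map x xs) \<le> (X / \<mu>) ^ length xs" if "set xs \<subseteq> S" for xs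
    using that
  proof (induction xs)
    case (Cons v xs)
    have "0 \<le> prod_list (map x xs)" using Cons.prems x0 by (intro prod_list_map_nonneg) auto
    then have "x v * prod_list (map x xs) \<le> X / \<mu> * (X / \<mu>) ^ length xs"
      using Cons X \<mu> xle by (intro mult_mono) auto
    then show ?case by simp
  qed simp
  then have "prod_list (map x xs) \<le> (X / \<mu>) ^ Suc r" if "xs \<in> cliques E S (Suc r)" for xs
    using that unfolding cliques_def by (metis (mono_tags, lifting) mem_Collect_eq)
  then have "?F (Suc r) \<le> (\<Sum>xs\<in>cliques E S (Suc r). (X / \<mu>) ^ Suc r)"
    unfolding clique_weight_def by (rule sum_mono)
  then have "X ^ Suc r * (\<Prod>j\<le>r. 1 - real j * \<sigma>) \<le> real (card (cliques E S (Suc r))) * (X / \<mu>) ^ Suc r"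
    using lower[of r] by simp
  then have "X ^ Suc r * (\<mu> ^ Suc r * (\<Prod>j\<le>r. 1 - real j * \<sigma>)) \<le> X ^ Suc r * real (card (cliques E S (Suc r)))"
    using \<mu> by (simp add: power_divide field_simps del: power_Suc)
  then show ?thesis using X by (simp only: mult_le_cancel_left_pos zero_less_power)
qed

end

text \<open>Only the last factor can be close to 0, so it is kept; in the others
  \<open>\<sigma>\<close> is replaced by its upper bound \<open>1 / r\<close>.\<close>

lemma prod_one_minus_ge:
  assumes r: "0 < r" and \<sigma>: "real r * \<sigma> \<le> 1"
  shows "fact r / real r ^ r * (1 - real r * \<sigma>) \<le> (\<Prod>k\<le>r. 1 - real k * \<sigma>)"
proof -
  have "fact r / real r ^ r = (\<Prod>k<r. 1 - real k / real r)"
  proof -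
    have "(\<Prod>k<r. 1 - real k / real r) = (\<Prod>k<r. real (r - k) / real r)"
      using r by (intro prod.cong) (auto simp: field_simps of_nat_diff)
    also have "\<dots> = real (\<Prod>k<r. r - k) / real r ^ r" by (simp add: prod_dividef)
    also have "(\<Prod>k<r. r - k) = fact r" by (simp add: fact_prod_rev lessThan_atLeast0)
    finally show ?thesis by simp
  qed
  also have "\<dots> \<le> (\<Prod>k<r. 1 - real k * \<sigma>)"
  proof (intro prod_mono conjI)
    fix k assume k: "k \<in> {..<r}"
    show "0 \<le> 1 - real k / real r" using k r by (simp add: field_simps)
    have "\<sigma> \<le> 1 / real r" using \<sigma> r by (simp add: field_simps)
    then have "real k * \<sigma> \<le> real k * (1 / real r)" by (intro mult_left_mono) auto
    then show "1 - real k / real r \<le> 1 - real k * \<sigma>" by simp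
  qed
  finally have "fact r / real r ^ r * (1 - real r * \<sigma>) \<le> (\<Prod>k<r. 1 - real k * \<sigma>) * (1 - real r * \<sigma>)"
    using \<sigma> by (intro mult_right_mono) auto
  then show ?thesis by (simp add: lessThan_Suc_atMost[symmetric])
qed

section \<open>Deleting vertices\<close>

text \<open>Here \<open>z\<close> is the square of the smallest entry, \<open>d\<close> the degree
  of a low-degree vertex and \<open>m\<close> the order. The deficit \<open>\<mu> - d\<close> forces
  \<open>z \<le> 1 / (m * (1 + \<epsilon>))\<close>. For \<open>z = 1 / m\<close>, the mean, the
  estimate for \<open>\<mu>'\<close> would just fail to preserve the ratio; the factor
  \<open>1 + \<epsilon>\<close> turns this loss into a gain.\<close>

lemma deletion_arith:
  fixes \<mu> \<mu>' m d z \<epsilon> :: real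
  assumes z: "z * (\<mu>\<^sup>2 + d * (m - d)) \<le> d" "0 \<le> z" and d: "0 \<le> d" "d + \<epsilon> / 2 * m \<le> \<mu>"
    and \<mu>': "\<mu> * (1 - 2 * z) \<le> \<mu>' * (1 - z)"
    and \<epsilon>: "0 < \<epsilon>" "\<epsilon> \<le> 1 / 10" "10 \<le> \<epsilon> * m" and \<mu>: "2 / 5 * m \<le> \<mu>"
  shows "\<mu> / m + \<epsilon> / (4 * m) \<le> \<mu>' / (m - 1)"
proof -
  define K where "K = m * (1 + \<epsilon>)"
  have "\<epsilon> * m \<le> 1 / 10 * m \<or> m < 0" using \<epsilon> by (metis mult_right_mono not_le)
  moreover have "\<not> m < 0" using \<epsilon> by (smt (verit) mult_pos_neg)
  ultimately have m: "100 \<le> m" using \<epsilon> by linarith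
  have \<mu>pos: "0 < \<mu>" using \<mu> m by linarith
  have zK: "z * K \<le> 1"
  proof (cases "d = 0")
    case True
    then have "z = 0" using z \<mu>pos by (simp add: mult_le_0_iff not_le)
    then show ?thesis by simp
  next
    case False
    have "(\<epsilon> / 2 * m) * (2 * d) \<le> (\<mu> - d) * (\<mu> + d)"
      using d \<epsilon> m by (intro mult_mono) auto
    then have "K * d \<le> \<mu>\<^sup>2 + d * (m - d)"
      unfolding K_def by (simp add: power2_eq_square algebra_simps)
    then have "z * (K * d) \<le> z * (\<mu>\<^sup>2 + d * (m - d))" using z(2) by (rule mult_left_mono)
    also have "\<dots> \<le> d" by (rule z(1))
    finally have "(z * K) * d \<le> 1 * d" by simp
    then show ?thesis by (rule mult_right_le_imp_le) (use False d in simp)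
  qed
  have K: "m \<le> K" "K \<le> 11 / 10 * m" unfolding K_def using \<epsilon> m by (auto simp: field_simps)
  have z1: "z < 1"
  proof (rule ccontr)
    assume "\<not> z < 1"
    then have "1 * K \<le> z * K" using K m by (intro mult_right_mono) auto
    then show False using zK K m by linarith
  qed
  have "(K - 2) * (1 - z) \<le> (K - 1) * (1 - 2 * z)"
    using zK by (simp add: algebra_simps)
  then have "\<mu> * ((K - 2) * (1 - z)) \<le> \<mu> * ((K - 1) * (1 - 2 * z))"
    using \<mu>pos by (intro mult_left_mono) auto
  also have "\<dots> = (K - 1) * (\<mu> * (1 - 2 * z))" by simp
  also have "\<dots> \<le> (K - 1) * (\<mu>' * (1 - z))" using \<mu>' K m by (intro mult_left_mono) auto
  finally have "(\<mu> * (K - 2)) * (1 - z) \<le> ((K - 1) * \<mu>') * (1 - z)" by (simp add: mult_ac)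
  then have le: "\<mu> * (K - 2) \<le> (K - 1) * \<mu>'" using z1 by (simp only: mult_le_cancel_right_pos diff_gt_0_iff_gt)
  have 1: "\<mu> * (K - 2) / ((K - 1) * (m - 1)) \<le> \<mu>' / (m - 1)"
  proof -
    from le have "\<mu> * (K - 2) / ((K - 1) * (m - 1)) \<le> (K - 1) * \<mu>' / ((K - 1) * (m - 1))"
      using K m by (intro divide_right_mono) auto
    also have "\<dots> = \<mu>' / (m - 1)" using K m by simp
    finally show ?thesis .
  qed
  have 2: "\<mu> * (K - 2) / ((K - 1) * (m - 1)) = \<mu> / m + (\<mu> / m) * ((\<epsilon> * m - 1) / ((K - 1) * (m - 1)))"
  proof -
    have "m * (K - 2) = (K - 1) * (m - 1) + (\<epsilon> * m - 1)" unfolding K_def by (simp add: algebra_simps)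
    then have "\<mu> * (K - 2) = (\<mu> / m) * ((K - 1) * (m - 1) + (\<epsilon> * m - 1))"
      using m by (simp add: field_simps)
    then show ?thesis using K m by (simp add: add_divide_distrib distrib_left)
  qed
  \<comment> \<open>The factor \<open>9 / 10\<close> absorbs the loss of 1 against
    \<open>\<epsilon> * m \<ge> 10\<close>, and \<open>11 / 10\<close> absorbs
    \<open>1 + \<epsilon>\<close>; \<open>(2 / 5) * (9 / 11)\<close> still exceeds
    \<open>1 / 4\<close>.\<close>
  have "\<epsilon> / (4 * m) \<le> (2 / 5) * ((9 / 10 * (\<epsilon> * m)) / ((11 / 10 * m) * m))"
    using m \<epsilon> by (simp add: field_simps)
  also have "\<dots> \<le> (\<mu> / m) * ((\<epsilon> * m - 1) / ((K - 1) * (m - 1)))"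
  proof (rule mult_mono[OF _ frac_le])
    show "2 / 5 \<le> \<mu> / m" using \<mu> m by (simp add: field_simps)
    show "(K - 1) * (m - 1) \<le> 11 / 10 * m * m" using K m by (intro mult_mono) auto
    show "0 < (K - 1) * (m - 1)" using K m by (intro mult_pos_pos) auto
  qed (use \<epsilon> m \<mu>pos in auto)
  finally show ?thesis using 1 2 by linarith
qed

context adjacency
begin

text \<open>Cauchy-Schwarz is applied to the eigenvalue equation at \<open>w\<close>, which has only
  \<open>d\<close> terms; every vertex outside the neighbourhood takes at least
  \<open>(x u) ^ 2\<close> from the total mass 1. The low-degree vertex \<open>w\<close> only
  certifies that \<open>x u\<close> is small: the vertex to be deleted is \<open>u\<close>.\<close>

lemma minimal_entry_le:
  assumes fin: "finite S" and pp: "principal_pair E S \<mu> x" and w: "w \<in> S"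
    and d: "d = real (card {v \<in> S. E w v})" and u: "u \<in> S" "\<And>v. v \<in> S \<Longrightarrow> x u \<le> x v"
  shows "(x u)\<^sup>2 * (\<mu>\<^sup>2 + d * (real (card S) - d)) \<le> d"
proof -
  let ?N = "{v \<in> S. E w v}"
  have x0: "\<And>v. v \<in> S \<Longrightarrow> 0 \<le> x v" and x1: "(\<Sum>v\<in>S. (x v)\<^sup>2) = 1"
    and ev: "nbr_sum E S x w = \<mu> * x w"
    using pp w by (auto simp: principal_pair_def)
  have \<mu>: "0 \<le> \<mu>" by (rule principal_pair_nonneg[OF pp])
  have "(\<mu> * x u)\<^sup>2 \<le> (\<Sum>v\<in>?N. x v)\<^sup>2"
    using u w x0 \<mu> ev by (intro power_mono) (auto simp: nbr_sum_def intro: mult_left_mono)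
  also have "\<dots> \<le> d * (\<Sum>v\<in>?N. (x v)\<^sup>2)"
    using Cauchy_Schwarz_ineq_sum[of "\<lambda>_. 1" x ?N] by (simp add: d)
  also have "(\<Sum>v\<in>?N. (x v)\<^sup>2) \<le> 1 - (real (card S) - d) * (x u)\<^sup>2"
  proof -
    have "real (card (S - ?N)) = real (card S) - d"
      unfolding d using fin by (subst card_Diff_subset) (auto simp: of_nat_diff card_mono)
    moreover have "(\<Sum>v\<in>S - ?N. (x u)\<^sup>2) \<le> (\<Sum>v\<in>S - ?N. (x v)\<^sup>2)"
      using u x0 by (intro sum_mono power_mono) auto
    ultimately have "(real (card S) - d) * (x u)\<^sup>2 \<le> (\<Sum>v\<in>S - ?N. (x v)\<^sup>2)" by simp
    also have "\<dots> = 1 - (\<Sum>v\<in>?N. (x v)\<^sup>2)" using fin x1 by (subst sum_diff) auto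
    finally show ?thesis by simp
  qed
  finally have "(\<mu> * x u)\<^sup>2 \<le> d * (1 - (real (card S) - d) * (x u)\<^sup>2)"
    by (simp add: mult_left_mono d)
  then show ?thesis by (simp add: algebra_simps power_mult_distrib)
qed

text \<open>The test vector is \<open>x\<close> with its entry at \<open>u\<close> set to 0: the
  form loses \<open>2 * \<mu> * (x u) ^ 2\<close> and the squared norm
  \<open>(x u) ^ 2\<close>.\<close>

lemma principal_pair_delete:
  assumes fin: "finite S" and pp: "principal_pair E S \<mu> x" and u: "u \<in> S"
    and pp': "principal_pair E (S - {u}) \<mu>' x'"
  shows "\<mu> * (1 - 2 * (x u)\<^sup>2) \<le> \<mu>' * (1 - (x u)\<^sup>2)"
proof -
  define y where "y v = x v + (if v = u then - x u else 0)" for v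
  have yu: "y u = 0" and yv: "v \<noteq> u \<Longrightarrow> y v = x v" for v by (auto simp: y_def)
  have "quad_form E S y = quad_form E S x + 2 * (- x u) * nbr_sum E S x u"
    unfolding y_def by (rule quad_form_add_indicator[OF fin u])
  also have "\<dots> = \<mu> * (1 - 2 * (x u)\<^sup>2)"
    using pp u by (simp add: principal_pair_quad_form[OF pp] principal_pair_def power2_eq_square algebra_simps)
  finally have "\<mu> * (1 - 2 * (x u)\<^sup>2) = quad_form E S y" by simp
  also have "\<dots> = quad_form E (S - {u}) y"
    using fin u by (simp add: quad_form_eq sum.remove[of S u] yu cong: if_cong)
  also have "\<dots> \<le> \<mu>' * (\<Sum>v\<in>S - {u}. (y v)\<^sup>2)" using pp' by (simp add: principal_pair_def)
  also have "(\<Sum>v\<in>S - {u}. (y v)\<^sup>2) = (\<Sum>v\<in>S - {u}. (x v)\<^sup>2)" by (intro sum.cong) (auto simp: yv)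
  also have "\<dots> = 1 - (x u)\<^sup>2"
    using pp fin u by (subst sum_diff1) (auto simp: principal_pair_def)
  finally show ?thesis .
qed

text \<open>Induction on the number of deletions; the first alternative persists once reached. It
  records \<open>j\<close> so that even one deletion is credited with its gain. \<open>K\<close>
  limits the deletions in advance, keeping the order at least
  \<open>10 / \<epsilon>\<close>.\<close>

lemma vertex_deletion:
  fixes b \<epsilon> \<theta> :: real
  assumes fin: "finite V" and pp: "principal_pair E V \<mu>0 x0" and b: "b = \<mu>0 / real (card V)"
    and \<theta>: "\<theta> - \<epsilon> / 2 \<le> b" "2 / 5 \<le> b" and \<epsilon>: "0 < \<epsilon>" "\<epsilon> \<le> 1 / 10"
    and K: "10 \<le> \<epsilon> * real (card V - K)" and k: "k \<le> K"
  shows "(\<exists>j S \<mu> x. j \<le> k \<and> S \<subseteq> V \<and> card S = card V - j \<and> principal_pair E S \<mu> x \<and>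
        b + real j * (\<epsilon> / (4 * real (card V))) \<le> \<mu> / real (card S) \<and>
        (\<forall>w\<in>S. (\<theta> - \<epsilon>) * real (card S) < real (card {v \<in> S. E w v}))) \<or>
      (\<exists>S \<mu> x. S \<subseteq> V \<and> card S = card V - k \<and> principal_pair E S \<mu> x \<and>
        b + real k * (\<epsilon> / (4 * real (card V))) \<le> \<mu> / real (card S))"
    (is "?stop k \<or> ?cont k")
  using k
proof (induction k)
  case 0
  have "?cont 0" using pp b by auto
  then show ?case by blast
next
  case (Suc k)
  let ?\<eta> = "\<epsilon> / (4 * real (card V))"
  have "?stop k \<or> ?cont k" by (rule Suc.IH) (use Suc.prems in simp)
  then consider "?stop k" | "?cont k" by (elim disjE)
  then show ?case
  proof cases
    case 1
    then have "?stop (Suc k)" by (meson le_SucI)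
    then show ?thesis by blast
  next
    case 2
    then obtain S \<mu> x where S: "S \<subseteq> V" "card S = card V - k" and ppS: "principal_pair E S \<mu> x"
      and \<mu>: "b + real k * ?\<eta> \<le> \<mu> / real (card S)" by blast
    have finS: "finite S" using S(1) fin by (rule finite_subset)
    show ?thesis
    proof (cases "\<forall>w\<in>S. (\<theta> - \<epsilon>) * real (card S) < real (card {v \<in> S. E w v})")
      case True
      then have "?stop (Suc k)" using S ppS \<mu> Suc.prems by (meson le_SucI order_refl)
      then show ?thesis by blast
    next
      case False
      then obtain w where w: "w \<in> S" and dw: "real (card {v \<in> S. E w v}) \<le> (\<theta> - \<epsilon>) * real (card S)"
        by (auto simp: not_less)
      define m where "m = real (card S)"
      have "card V - K \<le> card S" using S Suc.prems by simp
      then have "\<epsilon> * real (card V - K) \<le> \<epsilon> * m" unfolding m_def using \<epsilon> by (intro mult_left_mono) auto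
      then have em: "10 \<le> \<epsilon> * m" using K by (rule order_trans[rotated])
      have "\<epsilon> * m \<le> 1 / 10 * m" using \<epsilon> by (intro mult_right_mono) (auto simp: m_def)
      then have m: "100 \<le> m" using em by linarith
      have bm: "b \<le> \<mu> / m"
        using \<mu> \<epsilon> unfolding m_def by (smt (verit) divide_nonneg_nonneg mult_nonneg_nonneg of_nat_0_le_iff)
      then have \<mu>m: "b * m \<le> \<mu>" using m by (simp add: field_simps)
      obtain u where u: "u \<in> S" "\<And>v. v \<in> S \<Longrightarrow> x u \<le> x v"
      proof -
        have "Min (x ` S) \<in> x ` S" using finS w by (intro Min_in) auto
        then obtain u where "u \<in> S" "x u = Min (x ` S)" by auto
        then show ?thesis using that[of u] finS by simp
      qed
      have card': "real (card (S - {u})) = m - 1"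
        using finS u m by (simp add: m_def of_nat_diff)
      then have "S - {u} \<noteq> {}" using m by (intro notI) simp
      then obtain \<mu>' x' where pp': "principal_pair E (S - {u}) \<mu>' x'"
        using principal_pair_exists[of "S - {u}"] finS by auto
      have "\<mu> / m + \<epsilon> / (4 * m) \<le> \<mu>' / (m - 1)"
      proof (rule deletion_arith[where z = "(x u)\<^sup>2" and d = "real (card {v \<in> S. E w v})"])
        show "(x u)\<^sup>2 * (\<mu>\<^sup>2 + real (card {v \<in> S. E w v}) * (m - real (card {v \<in> S. E w v})))
          \<le> real (card {v \<in> S. E w v})"
          unfolding m_def using minimal_entry_le[OF finS ppS w refl u] by simp
        have "(\<theta> - \<epsilon> / 2) * m \<le> b * m" using \<theta> m by (intro mult_right_mono) auto
        then show "real (card {v \<in> S. E w v}) + \<epsilon> / 2 * m \<le> \<mu>"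
          using dw \<mu>m unfolding m_def[symmetric] by (simp add: algebra_simps)
        show "\<mu> * (1 - 2 * (x u)\<^sup>2) \<le> \<mu>' * (1 - (x u)\<^sup>2)"
          by (rule principal_pair_delete[OF finS ppS u(1) pp'])
        have "2 / 5 * m \<le> b * m" using \<theta> m by (intro mult_right_mono) auto
        then show "2 / 5 * m \<le> \<mu>" using \<mu>m by linarith
      qed (use \<epsilon> em in auto)
      moreover have "?\<eta> \<le> \<epsilon> / (4 * m)"
      proof -
        have "m \<le> real (card V)" unfolding m_def using S(1) fin by (simp add: card_mono)
        then show ?thesis using m \<epsilon> by (intro divide_left_mono) auto
      qed
      ultimately have "b + real (Suc k) * ?\<eta> \<le> \<mu>' / real (card (S - {u}))"
        unfolding card' of_nat_Suc distrib_right mult_1_left using \<mu> unfolding m_def[symmetric] by linarith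
      moreover have "card (S - {u}) = card V - Suc k" using S u finS by simp
      ultimately have "?cont (Suc k)" using pp' S(1) by blast
      then show ?thesis by blast
    qed
  qed
qed

end

section \<open>Many cliques on one edge\<close>

lemma card_Cons_tuples:
  assumes "finite T" "\<And>ys. ys \<in> T \<Longrightarrow> finite (B ys)"
  shows "card {y # ys | y ys. ys \<in> T \<and> y \<in> B ys} = (\<Sum>ys\<in>T. card (B ys))"
proof -
  have "{y # ys | y ys. ys \<in> T \<and> y \<in> B ys} = (\<lambda>(ys, y). y # ys) ` (SIGMA ys:T. B ys)"
    by force
  then show ?thesis using assms by (simp add: card_image inj_on_def case_prod_unfold card_SigmaI)
qed

context adjacency
begin

text \<open>A union bound over \<open>A\<close>. Each vertex counts among its own non-neighbours, so
  \<open>D\<close> includes it.\<close>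

lemma card_non_common_nbrs_le:
  assumes fin: "finite S" and D: "\<And>v. v \<in> S \<Longrightarrow> real (card {w \<in> S. \<not> E v w}) \<le> D"
    and A: "A \<subseteq> S"
  shows "real (card S) - real (card A) * D \<le> real (card {w \<in> S. \<forall>v\<in>A. E w v})"
proof -
  let ?Z = "{w \<in> S. \<forall>v\<in>A. E w v}"
  have "S - ?Z = (\<Union>v\<in>A. {w \<in> S. \<not> E v w})" using sym_iff by auto
  moreover have "finite A" using A fin by (rule finite_subset)
  ultimately have "card (S - ?Z) \<le> (\<Sum>v\<in>A. card {w \<in> S. \<not> E v w})"
    by (simp only: card_UN_le)
  then have "real (card (S - ?Z)) \<le> real (\<Sum>v\<in>A. card {w \<in> S. \<not> E v w})"
    by (simp only: of_nat_le_iff)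
  also have "\<dots> = (\<Sum>v\<in>A. real (card {w \<in> S. \<not> E v w}))" by simp
  also have "\<dots> \<le> (\<Sum>v\<in>A. D)" using A D by (intro sum_mono) auto
  finally have "real (card (S - ?Z)) \<le> real (card A) * D" by simp
  moreover have "real (card (S - ?Z)) = real (card S) - real (card ?Z)"
    using fin by (subst card_Diff_subset) (auto simp: of_nat_diff card_mono)
  ultimately show ?thesis by simp
qed

text \<open>If few vertices were adjacent to all of \<open>A\<close> and to all but one vertex of \<open>Q\<close>, then nearly all
  common neighbours of \<open>A\<close> would miss two vertices of \<open>Q\<close>, more than the degrees permit.\<close>

lemma card_replacing_vertices_ge:
  assumes fin: "finite S" and D: "\<And>v. v \<in> S \<Longrightarrow> real (card {w \<in> S. \<not> E v w}) \<le> D"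
    and A: "A \<subseteq> S" and Q: "Q \<subseteq> S" "Q \<noteq> {}"
  shows "real (card S) - real (card A) * D - real (card Q) * D / 2
    \<le> real (card {y \<in> S. (\<forall>v\<in>A. E y v) \<and> (\<exists>q\<in>Q. \<forall>q'\<in>Q - {q}. E y q')})"
    (is "_ \<le> real (card ?good)")
proof -
  let ?Z = "{w \<in> S. \<forall>v\<in>A. E w v}"
  have finQ: "finite Q" using Q(1) fin by (rule finite_subset)
  have two: "2 \<le> real (card {q \<in> Q. \<not> E q y})" if y: "y \<in> ?Z - ?good" for y
  proof (rule ccontr)
    assume "\<not> ?thesis"
    then have c: "card {q \<in> Q. \<not> E q y} \<le> Suc 0" by simp
    have "\<exists>q\<in>Q. \<forall>q'\<in>Q - {q}. E y q'"
    proof (cases "{q \<in> Q. \<not> E q y} = {}")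
      case True
      then show ?thesis using Q(2) sym by blast
    next
      case False
      then obtain q where q: "q \<in> Q" "\<not> E q y" by blast
      have "q' = q" if "q' \<in> Q" "\<not> E q' y" for q'
        using c q that finQ card_le_Suc0_iff_eq[of "{q \<in> Q. \<not> E q y}"] by auto
      then show ?thesis using q sym by blast
    qed
    then show False using y by blast
  qed
  have "2 * real (card (?Z - ?good)) = (\<Sum>y\<in>?Z - ?good. 2)" by simp
  also have "\<dots> \<le> (\<Sum>y\<in>?Z - ?good. real (card {q \<in> Q. \<not> E q y}))" by (intro sum_mono two)
  also have "\<dots> \<le> (\<Sum>y\<in>S. real (card {q \<in> Q. \<not> E q y}))"
    using fin by (intro sum_mono2) auto
  also have "\<dots> = (\<Sum>y\<in>S. \<Sum>q\<in>Q. if \<not> E q y then 1 else 0)"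
    using finQ by (simp add: sum.inter_filter[symmetric])
  also have "\<dots> = (\<Sum>q\<in>Q. \<Sum>y\<in>S. if \<not> E q y then 1 else 0)" by (rule sum.swap)
  also have "\<dots> = (\<Sum>q\<in>Q. real (card {y \<in> S. \<not> E q y}))"
    using fin by (simp add: sum.inter_filter[symmetric])
  also have "\<dots> \<le> (\<Sum>q\<in>Q. D)" using Q D by (intro sum_mono) auto
  finally have bad: "2 * real (card (?Z - ?good)) \<le> real (card Q) * D" by simp
  have "?good \<subseteq> ?Z" by auto
  then have "real (card (?Z - ?good)) = real (card ?Z) - real (card ?good)"
    using fin by (subst card_Diff_subset) (auto simp: of_nat_diff card_mono)
  then show ?thesis using bad card_non_common_nbrs_le[OF fin D A] by linarith
qed

text \<open>\<open>Q\<close> holds the clique vertices not yet replaced and \<open>T\<close> the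
  tuples of replacements, all joined to the same \<open>Q\<close>. A new vertex may miss one vertex
  of \<open>Q\<close>; by pigeonhole a single \<open>q\<close> can be discarded for at least a
  \<open>1 / card Q\<close> share of the extensions, which explains the product.\<close>

lemma clique_replacement:
  fixes D :: real and r d :: nat
  assumes fin: "finite S" and D: "\<And>v. v \<in> S \<Longrightarrow> real (card {w \<in> S. \<not> E v w}) \<le> D"
    and R: "R \<in> cliques E S (Suc r)" and g: "g = real (card S) - (real r - 1 / 2) * D" "0 \<le> g" and d: "d < r"
  shows "\<exists>Q T. Q \<subseteq> S \<and> card Q = Suc r - d \<and> (\<forall>u\<in>Q. \<forall>v\<in>Q. u \<noteq> v \<longrightarrow> E u v) \<and>
    T \<subseteq> cliques E S d \<and> (\<forall>ys\<in>T. \<forall>y\<in>set ys. \<forall>q\<in>Q. E y q) \<and>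
    (\<Prod>i<d. g / real (Suc r - i)) \<le> real (card T)"
  using d
proof (induction d)
  case 0
  have srt: "sorted_wrt E R" "set R \<subseteq> S" "length R = Suc r" using R by (auto simp: cliques_def)
  have adj: "E u v" if uv: "u \<in> set R" "v \<in> set R" "u \<noteq> v" for u v
  proof -
    obtain i j where ij: "i < Suc r" "j < Suc r" "u = R ! i" "v = R ! j"
      using uv srt(3) by (metis in_set_conv_nth)
    then consider "i < j" | "j < i" using uv(3) by (metis nat_neq_iff)
    then show ?thesis
    proof cases
      case 1
      then show ?thesis using srt ij sorted_wrt_nth_less[of E R i j] by simp
    next
      case 2
      then show ?thesis using srt ij sorted_wrt_nth_less[of E R j i] by (simp add: sym)
    qed
  qed
  have "distinct R"
  proof -
    have "R ! i \<noteq> R ! j" if "i < j" "j < length R" for i j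
      using sorted_wrt_nth_less[OF srt(1) that] irrefl by metis
    then show ?thesis unfolding distinct_conv_nth by (metis nat_neq_iff)
  qed
  then have "card (set R) = Suc r" using srt by (simp add: distinct_card)
  then show ?case using adj srt(2) by (intro exI[of _ "set R"] exI[of _ "{[]}"]) (auto simp: cliques_0)
next
  case (Suc d)
  then obtain Q T where Q: "Q \<subseteq> S" "card Q = Suc r - d" "\<forall>u\<in>Q. \<forall>v\<in>Q. u \<noteq> v \<longrightarrow> E u v"
    and T: "T \<subseteq> cliques E S d" "\<forall>ys\<in>T. \<forall>y\<in>set ys. \<forall>q\<in>Q. E y q"
      "(\<Prod>i<d. g / real (Suc r - i)) \<le> real (card T)" by auto
  have finT: "finite T" using T(1) finite_cliques[OF fin] by (rule finite_subset)
  have finQ: "finite Q" using Q(1) fin by (rule finite_subset)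
  have Qne: "Q \<noteq> {}" using Q(2) Suc.prems by auto
  define B where "B q ys = {y \<in> S. (\<forall>v\<in>set ys. E y v) \<and> (\<forall>q'\<in>Q - {q}. E y q')}" for q ys
  define C where "C q = {y # ys | y ys. ys \<in> T \<and> y \<in> B q ys}" for q
  have finB: "finite (B q ys)" for q ys using fin by (simp add: B_def)
  have cardC: "card (C q) = (\<Sum>ys\<in>T. card (B q ys))" for q
    unfolding C_def by (rule card_Cons_tuples[OF finT finB])
  have "real (card T) * g = (\<Sum>ys\<in>T. g)" by simp
  also have "\<dots> \<le> (\<Sum>ys\<in>T. \<Sum>q\<in>Q. real (card (B q ys)))"
  proof (rule sum_mono)
    fix ys assume ys: "ys \<in> T"
    let ?good = "{y \<in> S. (\<forall>v\<in>set ys. E y v) \<and> (\<exists>q\<in>Q. \<forall>q'\<in>Q - {q}. E y q')}"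
    have sub: "set ys \<subseteq> S" "length ys = d" using ys T by (auto simp: cliques_def)
    obtain q0 where "q0 \<in> Q" using Qne by blast
    then have "0 \<le> D" using D[of q0] Q(1) by (meson of_nat_0_le_iff order_trans subsetD)
    \<comment> \<open>The loss is at most \<open>d + (r + 1 - d) / 2\<close> times \<open>D\<close>;
      it is largest at the last replacement, \<open>d = r - 2\<close>, where it equals
      \<open>(r - 1 / 2) * D\<close>.\<close>
    have "real (card (set ys)) \<le> real d" using sub card_length[of ys] by simp
    then have "real (card (set ys)) + real (card Q) / 2 \<le> real r - 1 / 2"
      using Q(2) Suc.prems by (simp add: of_nat_diff field_simps)
    then have "(real (card (set ys)) + real (card Q) / 2) * D \<le> (real r - 1 / 2) * D"
      using \<open>0 \<le> D\<close> by (rule mult_right_mono)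
    then have "g \<le> real (card S) - real (card (set ys)) * D - real (card Q) * D / 2"
      unfolding g by (simp add: algebra_simps)
    also have "\<dots> \<le> real (card ?good)"
      by (rule card_replacing_vertices_ge[OF fin D sub(1) Q(1) Qne])
    also have "\<dots> \<le> real (\<Sum>q\<in>Q. card (B q ys))"
    proof -
      have "?good = (\<Union>q\<in>Q. B q ys)" by (auto simp: B_def)
      then show ?thesis using card_UN_le[OF finQ, of "\<lambda>q. B q ys"] by (simp only: of_nat_le_iff)
    qed
    finally show "g \<le> (\<Sum>q\<in>Q. real (card (B q ys)))" by simp
  qed
  also have "\<dots> = (\<Sum>q\<in>Q. real (card (C q)))"
    unfolding cardC of_nat_sum by (rule sum.swap)
  finally have tot: "real (card T) * g \<le> (\<Sum>q\<in>Q. real (card (C q)))" .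
  have "\<exists>q\<in>Q. real (card T) * g / real (card Q) \<le> real (card (C q))"
  proof (rule ccontr)
    assume "\<not> ?thesis"
    then have "real (card (C q)) < real (card T) * g / real (card Q)" if "q \<in> Q" for q
      using that by (simp add: not_le)
    then have "(\<Sum>q\<in>Q. real (card (C q))) < (\<Sum>q\<in>Q. real (card T) * g / real (card Q))"
      using finQ Qne by (intro sum_strict_mono) auto
    then show False using tot finQ Qne by simp
  qed
  then obtain q where q: "q \<in> Q" "real (card T) * g / real (card Q) \<le> real (card (C q))" by blast
  have "(\<Prod>i<Suc d. g / real (Suc r - i)) = (\<Prod>i<d. g / real (Suc r - i)) * (g / real (card Q))"
    by (simp add: Q(2))
  also have "\<dots> \<le> real (card T) * (g / real (card Q))" using T(3) g by (intro mult_right_mono) auto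
  also have "\<dots> \<le> real (card (C q))" using q(2) by simp
  finally have "(\<Prod>i<Suc d. g / real (Suc r - i)) \<le> real (card (C q))" .
  moreover have "card (Q - {q}) = Suc r - Suc d" using Q(2) q finQ by simp
  moreover have "C q \<subseteq> cliques E S (Suc d)"
    using T(1) by (auto simp: C_def B_def Cons_in_cliques_iff)
  moreover have "\<forall>ys\<in>C q. \<forall>y\<in>set ys. \<forall>q'\<in>Q - {q}. E y q'"
    using T(2) by (auto simp: C_def B_def)
  ultimately show ?case using Q(1,3) by (intro exI[of _ "Q - {q}"] exI[of _ "C q"]) auto
qed

text \<open>After \<open>r - 1\<close> replacements the two remaining clique vertices form the edge.
  The vertex then prepended must be adjacent only to the replacements, whence the larger factor
  \<open>f\<close> and the \<open>tl\<close>: its part will also contain \<open>u\<close> and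
  \<open>v\<close>. The denominators multiply to \<open>(r + 1) * r * ... * 3\<close>, half of the
  factorial.\<close>

theorem many_cliques_on_an_edge:
  fixes D :: real
  assumes fin: "finite S" and D: "\<And>v. v \<in> S \<Longrightarrow> real (card {w \<in> S. \<not> E v w}) \<le> D"
    and ne: "cliques E S (Suc r) \<noteq> {}" and r: "2 \<le> r"
    and g: "g = real (card S) - (real r - 1 / 2) * D" "0 \<le> g"
    and f: "f = real (card S) - (real r - 1) * D"
  shows "\<exists>u v M. u \<in> S \<and> v \<in> S \<and> E u v \<and> M \<subseteq> cliques E S r \<and>
    (\<forall>ys\<in>M. \<forall>y\<in>set (tl ys). E u y \<and> E v y) \<and>
    f * (g ^ (r - 1) * 2 / fact (Suc r)) \<le> real (card M)"
proof -
  obtain R where R: "R \<in> cliques E S (Suc r)" using ne by blast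
  obtain Q T where Q: "Q \<subseteq> S" "card Q = Suc r - (r - 1)" "\<forall>u\<in>Q. \<forall>v\<in>Q. u \<noteq> v \<longrightarrow> E u v"
    and T: "T \<subseteq> cliques E S (r - 1)" "\<forall>ys\<in>T. \<forall>y\<in>set ys. \<forall>q\<in>Q. E y q"
      "(\<Prod>i<r - 1. g / real (Suc r - i)) \<le> real (card T)"
    using clique_replacement[OF fin D R g, of "r - 1"] r by auto
  have "card Q = 2" using Q(2) r by simp
  then obtain u v where uv: "Q = {u, v}" "u \<noteq> v" by (meson card_2_iff)
  have prod: "(\<Prod>i<r - 1. g / real (Suc r - i)) = g ^ (r - 1) * 2 / fact (Suc r)"
  proof -
    have "fact (Suc r) = (\<Prod>i<Suc r. Suc r - i)"
      by (simp only: fact_prod_rev lessThan_atLeast0) simp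
    also have "{..<Suc r} = insert r (insert (r - 1) {..<r - 1})" using r by auto
    also have "(\<Prod>i\<in>insert r (insert (r - 1) {..<r - 1}). Suc r - i) = 2 * (\<Prod>i<r - 1. Suc r - i)"
    proof -
      have "(\<Prod>i\<in>insert r (insert (r - 1) {..<r - 1}). Suc r - i) =
          (Suc r - r) * ((Suc r - (r - 1)) * (\<Prod>i<r - 1. Suc r - i))"
        using r by (subst prod.insert; (subst prod.insert)?) auto
      also have "\<dots> = 2 * (\<Prod>i<r - 1. Suc r - i)" using r by simp
      finally show ?thesis .
    qed
    finally have "(fact (Suc r) :: nat) = 2 * (\<Prod>i<r - 1. Suc r - i)" by simp
    then have "real (fact (Suc r)) = 2 * (\<Prod>i<r - 1. real (Suc r - i))" by (simp only: of_nat_mult of_nat_prod)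
    then show ?thesis by (simp add: prod_dividef del: fact_Suc)
  qed
  have finT: "finite T" using T(1) finite_cliques[OF fin] by (rule finite_subset)
  define B where "B ys = {y \<in> S. \<forall>v\<in>set ys. E y v}" for ys
  define M where "M = {y # ys | y ys. ys \<in> T \<and> y \<in> B ys}"
  have D0: "0 \<le> D" using D[of u] uv Q(1) by (meson insertI1 of_nat_0_le_iff order_trans subsetD)
  have "f \<le> real (card (B ys))" if ys: "ys \<in> T" for ys
  proof -
    have sub: "set ys \<subseteq> S" "length ys = r - 1" using ys T by (auto simp: cliques_def)
    have "real (card (set ys)) \<le> real r - 1" using sub card_length[of ys] r by (simp add: of_nat_diff)
    then have "real (card (set ys)) * D \<le> (real r - 1) * D" using D0 by (rule mult_right_mono)
    then show ?thesis unfolding f B_def using card_non_common_nbrs_le[OF fin D sub(1)] by linarith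
  qed
  then have "(\<Sum>ys\<in>T. f) \<le> (\<Sum>ys\<in>T. real (card (B ys)))" by (rule sum_mono)
  also have "\<dots> = real (card M)"
    unfolding M_def using finT fin by (subst card_Cons_tuples) (auto simp: B_def)
  finally have "real (card T) * f \<le> real (card M)" by simp
  moreover have "f * (g ^ (r - 1) * 2 / fact (Suc r)) \<le> f * real (card T)"
  proof (rule mult_left_mono)
    have "g \<le> f" unfolding f g using D0 by (simp add: mult_right_mono)
    then show "0 \<le> f" using g by simp
  qed (use T(3) prod in simp)
  ultimately have "f * (g ^ (r - 1) * 2 / fact (Suc r)) \<le> real (card M)" by (simp add: mult.commute)
  moreover have "M \<subseteq> cliques E S r"
  proof
    fix zs assume "zs \<in> M"
    then obtain y ys where zs: "zs = y # ys" "ys \<in> T" "y \<in> B ys" by (auto simp: M_def)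
    then have "zs \<in> cliques E S (Suc (r - 1))" using T(1) by (auto simp: Cons_in_cliques_iff B_def)
    then show "zs \<in> cliques E S r" using r by simp
  qed
  moreover have "\<forall>ys\<in>M. \<forall>y\<in>set (tl ys). E u y \<and> E v y"
    using T(2) uv sym by (auto simp: M_def)
  moreover have "u \<in> S" "v \<in> S" "E u v" using uv Q(1,3) by auto
  ultimately show ?thesis by blast
qed

end

section \<open>Complete multipartite subgraphs from many cliques\<close>

text \<open>The \<open>a\<close>-th entries form the \<open>a\<close>-th part of a complete
  multipartite graph; injectivity makes each part as large as \<open>F\<close>.\<close>

definition cross_adjacent :: "('a \<Rightarrow> 'a \<Rightarrow> bool) \<Rightarrow> nat \<Rightarrow> 'a list set \<Rightarrow> bool" where
  "cross_adjacent E j F \<longleftrightarrow> (\<forall>R\<in>F. length R = j) \<and>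
    (\<forall>R\<in>F. \<forall>R'\<in>F. \<forall>a<j. \<forall>b<j. a \<noteq> b \<longrightarrow> E (R ! a) (R' ! b)) \<and>
    (\<forall>a<j. inj_on (\<lambda>R. R ! a) F)"

text \<open>On average a vertex is related to \<open>2 * s\<close> of the \<open>h * s\<close>
  elements of \<open>F\<close>, so at least a \<open>1 / h\<close> share of \<open>V\<close> is
  related to \<open>s\<close> of them or more. Each such vertex selects \<open>s\<close> elements,
  and one of the at most \<open>2 ^ (h * s)\<close> selections is shared by many.\<close>

lemma complete_bipartite_of_dense:
  fixes P :: "'b \<Rightarrow> 'a \<Rightarrow> bool"
  assumes fin: "finite F" "finite V" and F: "card F = h * s" and pos: "0 < h" "0 < s"
    and dense: "\<And>R. R \<in> F \<Longrightarrow> 2 * card V \<le> h * card {y \<in> V. P R y}"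
  shows "\<exists>G Y. G \<subseteq> F \<and> Y \<subseteq> V \<and> card G = s \<and> (\<forall>R\<in>G. \<forall>y\<in>Y. P R y) \<and>
    card V \<le> card Y * (h * 2 ^ (h * s))"
proof -
  define deg where "deg y = card {R \<in> F. P R y}" for y
  define good where "good = {y \<in> V. s \<le> deg y}"
  have fing: "finite good" using fin by (simp add: good_def)
  have "h * (2 * s * card V) = (\<Sum>R\<in>F. 2 * card V)" by (simp add: F)
  also have "\<dots> \<le> (\<Sum>R\<in>F. h * card {y \<in> V. P R y})" by (intro sum_mono dense)
  also have "\<dots> = h * (\<Sum>R\<in>F. \<Sum>y\<in>V. if P R y then 1 else 0)"
    using fin by (simp add: sum_distrib_left sum.inter_filter[symmetric])
  also have "(\<Sum>R\<in>F. \<Sum>y\<in>V. if P R y then 1 else 0) = (\<Sum>y\<in>V. \<Sum>R\<in>F. if P R y then 1 else (0::nat))"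
    by (rule sum.swap)
  also have "\<dots> = (\<Sum>y\<in>V. deg y)"
    unfolding deg_def using fin by (simp add: sum.inter_filter[symmetric])
  finally have "2 * s * card V \<le> (\<Sum>y\<in>V. deg y)" using pos by simp
  also have "\<dots> \<le> (\<Sum>y\<in>V. (if y \<in> good then h * s else 0) + s)"
  proof (rule sum_mono)
    fix y assume "y \<in> V"
    moreover have "deg y \<le> h * s" unfolding deg_def F[symmetric] using fin by (intro card_mono) auto
    ultimately show "deg y \<le> (if y \<in> good then h * s else 0) + s" by (auto simp: good_def)
  qed
  also have "\<dots> = card good * (h * s) + card V * s"
  proof -
    have "(\<Sum>y\<in>V. if y \<in> good then h * s else 0) = (\<Sum>y\<in>{y\<in>V. y \<in> good}. h * s)"
      by (rule sum.inter_filter[symmetric, OF fin(2)])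
    moreover have "{y\<in>V. y \<in> good} = good" by (auto simp: good_def)
    ultimately show ?thesis by (simp add: sum.distrib)
  qed
  finally have "s * card V \<le> s * (card good * h)" by (simp add: algebra_simps)
  then have gh: "card V \<le> card good * h" using pos by simp
  have "\<exists>G. G \<subseteq> F \<and> card G = s \<and> (\<forall>R\<in>G. P R y)" if "y \<in> good" for y
  proof -
    have "s \<le> card {R \<in> F. P R y}" using that by (simp add: good_def deg_def)
    then obtain G where "G \<subseteq> {R \<in> F. P R y}" "card G = s" by (rule obtain_subset_with_card_n)
    then show ?thesis by blast
  qed
  then obtain f where f: "\<And>y. y \<in> good \<Longrightarrow> f y \<subseteq> F \<and> card (f y) = s \<and> (\<forall>R\<in>f y. P R y)" by metis
  define Y where "Y G = {y \<in> good. f y = G}" for G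
  have tot: "card good = (\<Sum>G\<in>Pow F. card (Y G))"
    unfolding Y_def card_eq_sum using fin f by (intro sum.group[symmetric, OF fing]) auto
  have "\<exists>G\<in>Pow F. card good \<le> card (Y G) * 2 ^ (h * s)"
  proof (rule ccontr)
    assume "\<not> ?thesis"
    then have "(\<Sum>G\<in>Pow F. card (Y G) * 2 ^ (h * s)) < (\<Sum>G\<in>Pow F. card good)"
      using fin by (intro sum_strict_mono) (auto simp: not_le)
    also have "\<dots> = card good * 2 ^ (h * s)" using fin F by (simp add: card_Pow)
    finally show False unfolding tot by (simp add: sum_distrib_right)
  qed
  then obtain G where G: "G \<subseteq> F" "card good \<le> card (Y G) * 2 ^ (h * s)" by blast
  have le: "card V \<le> card (Y G) * (h * 2 ^ (h * s))"
    using order_trans[OF gh mult_right_mono[OF G(2), of h]] by (simp add: mult_ac)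
  show ?thesis
  proof (cases "Y G = {}")
    case False
    then obtain y where "y \<in> good" "f y = G" by (auto simp: Y_def)
    then have "card G = s" using f by blast
    moreover have "\<forall>R\<in>G. \<forall>y\<in>Y G. P R y" using f by (auto simp: Y_def)
    moreover have "Y G \<subseteq> V" by (auto simp: Y_def good_def)
    ultimately show ?thesis using G(1) le by blast
  next
    case True
    then have "card V = 0" using le by simp
    moreover obtain G' where "G' \<subseteq> F" "card G' = s"
    proof -
      have "s \<le> card F" using F pos by simp
      then show ?thesis by (rule obtain_subset_with_card_n) (rule that)
    qed
    ultimately show ?thesis by (intro exI[of _ G'] exI[of _ "{}"]) auto
  qed
qed

context adjacency
begin

lemma card_cliques_le: "finite V \<Longrightarrow> card (cliques E V j) \<le> card V ^ j"
  using card_mono[OF finite_lists_length_eq[of V j], of "cliques E V j"]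
  by (auto simp: cliques_def card_lists_length_eq)

text \<open>Dropping the \<open>j\<close>-cliques with fewer than \<open>2 * card V / h\<close>
  extensions costs \<open>2 * card V ^ (j + 1)\<close>; the factor \<open>Suc j\<close> in
  \<open>dense\<close> budgets this loss once per coordinate. Taking the recursive result as the
  hypothesis \<open>IH\<close> lets one argument serve both the inductive construction and the final
  coordinate.\<close>

lemma blowup_step:
  assumes fin: "finite V" and M: "M \<subseteq> cliques E V (Suc j)"
    and dense: "2 * Suc j * card V ^ Suc j \<le> h * card M" and pos: "0 < h" "0 < s" "0 < card V"
    and IH: "\<And>M'. M' \<subseteq> cliques E V j \<Longrightarrow> 2 * j * card V ^ j \<le> h * card M' \<Longrightarrow>
      \<exists>F\<subseteq>M'. card F = h * s \<and> cross_adjacent E j F"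
  shows "\<exists>G Y. G \<subseteq> cliques E V j \<and> card G = s \<and> cross_adjacent E j G \<and> Y \<subseteq> V \<and>
    (\<forall>R\<in>G. \<forall>y\<in>Y. R @ [y] \<in> M) \<and> card V \<le> card Y * (h * 2 ^ (h * s))"
proof -
  let ?n = "card V"
  define N where "N R = {y \<in> V. R @ [y] \<in> M}" for R
  define M' where "M' = {R \<in> cliques E V j. 2 * ?n \<le> h * card (N R)}"
  have finM': "finite M'" unfolding M'_def using finite_cliques[OF fin] by simp
  have "M = (\<lambda>(R, y). R @ [y]) ` (SIGMA R:cliques E V j. N R)"
  proof (intro equalityI subsetI)
    fix zs assume zs: "zs \<in> M"
    then have z: "zs \<in> cliques E V (Suc j)" using M by blast
    then have "zs \<noteq> []" by (auto simp: cliques_def)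
    then have eq: "zs = butlast zs @ [last zs]" by simp
    then have "butlast zs @ [last zs] \<in> cliques E V (Suc j)" using z by simp
    then have "butlast zs \<in> cliques E V j" "last zs \<in> V"
      by (auto simp: cliques_def sorted_wrt_append)
    then show "zs \<in> (\<lambda>(R, y). R @ [y]) ` (SIGMA R:cliques E V j. N R)"
      using zs eq by (intro image_eqI[of _ _ "(butlast zs, last zs)"]) (auto simp: N_def)
  qed (auto simp: N_def)
  then have "card M = card ((\<lambda>(R, y). R @ [y]) ` (SIGMA R:cliques E V j. N R))"
    by (rule arg_cong)
  also have "\<dots> = card (SIGMA R:cliques E V j. N R)" by (rule card_image) (auto simp: inj_on_def)
  also have "\<dots> = (\<Sum>R\<in>cliques E V j. card (N R))"
    using fin by (simp add: N_def finite_cliques)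
  finally have "card M = (\<Sum>R\<in>cliques E V j. card (N R))" .
  then have "h * card M = (\<Sum>R\<in>cliques E V j. h * card (N R))" by (simp add: sum_distrib_left)
  also have "\<dots> \<le> (\<Sum>R\<in>cliques E V j. (if R \<in> M' then h * ?n else 0) + 2 * ?n)"
  proof (rule sum_mono)
    fix R assume R: "R \<in> cliques E V j"
    have le: "h * card (N R) \<le> h * ?n" unfolding N_def using fin by (intro mult_left_mono card_mono) auto
    show "h * card (N R) \<le> (if R \<in> M' then h * ?n else 0) + 2 * ?n"
    proof (cases "R \<in> M'")
      case True
      then show ?thesis using le by (simp only: if_True trans_le_add1)
    next
      case False
      then show ?thesis using R by (simp add: M'_def)
    qed
  qed
  also have "\<dots> = card M' * (h * ?n) + card (cliques E V j) * (2 * ?n)"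
  proof -
    have "(\<Sum>R\<in>cliques E V j. if R \<in> M' then h * ?n else 0) = (\<Sum>R\<in>{R\<in>cliques E V j. R \<in> M'}. h * ?n)"
      by (rule sum.inter_filter[symmetric, OF finite_cliques[OF fin]])
    moreover have "{R\<in>cliques E V j. R \<in> M'} = M'" by (auto simp: M'_def)
    ultimately show ?thesis by (simp add: sum.distrib)
  qed
  also have "\<dots> \<le> card M' * (h * ?n) + ?n ^ j * (2 * ?n)"
    using card_cliques_le[OF fin, of j] by (intro add_left_mono mult_right_mono) auto
  finally have "h * card M \<le> ?n * (h * card M') + ?n * (2 * ?n ^ j)" by (simp add: mult_ac)
  moreover have "2 * Suc j * ?n ^ Suc j = ?n * (2 * j * ?n ^ j) + ?n * (2 * ?n ^ j)"
    by (simp add: algebra_simps)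
  ultimately have "?n * (2 * j * ?n ^ j) \<le> ?n * (h * card M')" using dense by linarith
  then have "2 * j * ?n ^ j \<le> h * card M'" using pos by simp
  moreover have "M' \<subseteq> cliques E V j" by (auto simp: M'_def)
  ultimately obtain F where F: "F \<subseteq> M'" "card F = h * s" "cross_adjacent E j F" using IH by blast
  have "finite F" using F(1) finM' by (rule finite_subset)
  moreover have "\<And>R. R \<in> F \<Longrightarrow> 2 * ?n \<le> h * card {y \<in> V. R @ [y] \<in> M}"
    using F(1) by (auto simp: M'_def N_def)
  ultimately obtain G Y where GY: "G \<subseteq> F" "Y \<subseteq> V" "card G = s" "\<forall>R\<in>G. \<forall>y\<in>Y. R @ [y] \<in> M"
    "?n \<le> card Y * (h * 2 ^ (h * s))"
    using complete_bipartite_of_dense[of F V h s "\<lambda>R y. R @ [y] \<in> M"] fin F(2) pos by blast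
  have "cross_adjacent E j G"
    using F(3) GY(1) unfolding cross_adjacent_def by (meson inj_on_subset subsetD)
  moreover have "G \<subseteq> cliques E V j" using GY(1) F(1) by (auto simp: M'_def)
  ultimately show ?thesis using GY by blast
qed

lemma clique_append_adjacent:
  assumes "R @ [y] \<in> cliques E V (Suc j)" "a < j"
  shows "E (R ! a) y"
proof -
  have "length R = j" "sorted_wrt E (R @ [y])" using assms by (auto simp: cliques_def)
  then show ?thesis using assms(2) by (auto simp: sorted_wrt_append)
qed

text \<open>Arbitrary dense families of tuples have no blowup of logarithmic size. For cliques it suffices
  to keep the tuples disjoint: cross adjacency is inherited by subfamilies, so each new coordinate costs
  only a factor \<open>h\<close>.\<close>

lemma blowup_matching:
  assumes fin: "finite V" and j: "1 \<le> j" and M: "M \<subseteq> cliques E V j"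
    and dense: "2 * j * card V ^ j \<le> h * card M" and pos: "0 < h" "0 < s"
    and big: "h * 2 ^ (h ^ (j - 1) * s) * (h ^ (j - 1) * s) \<le> card V"
  shows "\<exists>F\<subseteq>M. card F = s \<and> cross_adjacent E j F"
  using j M dense pos(2) big
proof (induction j arbitrary: s M rule: nat_induct_at_least)
  case base
  have finM: "finite M" using base(1) finite_cliques[OF fin] by (rule finite_subset)
  have "h * s \<le> h * 2 ^ s * s" by simp
  also have "\<dots> \<le> card V" using base by simp
  also have "\<dots> \<le> h * card M" using base by simp
  finally have "s \<le> card M" using pos by simp
  then obtain F where F: "F \<subseteq> M" "card F = s" by (rule obtain_subset_with_card_n)
  have "length R = 1" if "R \<in> F" for R using that F(1) base(1) by (auto simp: cliques_def)
  then have "cross_adjacent E 1 F"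
    unfolding cross_adjacent_def by (auto simp: inj_on_def intro!: nth_equalityI)
  then show ?case using F by auto
next
  case (Suc j)
  define m where "m = h ^ j * s"
  \<comment> \<open>The size condition is invariant: one coordinate less is traded for
    \<open>h\<close> times as many tuples.\<close>
  have mm: "h ^ (j - 1) * (h * s) = m"
    using Suc.hyps by (cases j) (auto simp: m_def)
  have m: "h * s \<le> m" unfolding mm[symmetric] using pos by simp
  have big: "h * 2 ^ m * m \<le> card V" using Suc.prems by (simp add: m_def)
  have "s \<le> h * s" using pos by simp
  then have "s \<le> m" using m by (rule le_trans)
  then have mpos: "0 < m" using Suc.prems by simp
  then have "0 < h * 2 ^ m * m" using pos by simp
  then have nV: "0 < card V" using big by (rule less_le_trans)
  have "\<exists>G Y. G \<subseteq> cliques E V j \<and> card G = s \<and> cross_adjacent E j G \<and> Y \<subseteq> V \<and>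
    (\<forall>R\<in>G. \<forall>y\<in>Y. R @ [y] \<in> M) \<and> card V \<le> card Y * (h * 2 ^ (h * s))"
  proof (rule blowup_step[OF fin Suc.prems(1,2) pos(1) Suc.prems(3) nV])
    fix M' assume "M' \<subseteq> cliques E V j" "2 * j * card V ^ j \<le> h * card M'"
    then show "\<exists>F\<subseteq>M'. card F = h * s \<and> cross_adjacent E j F"
      using Suc.IH[of M' "h * s"] big pos Suc.prems(3) unfolding mm by simp
  qed
  then obtain G Y where G: "G \<subseteq> cliques E V j" "card G = s" "cross_adjacent E j G" and Y: "Y \<subseteq> V"
    and GY: "\<And>R y. R \<in> G \<Longrightarrow> y \<in> Y \<Longrightarrow> R @ [y] \<in> M" and card: "card V \<le> card Y * (h * 2 ^ (h * s))"
    by blast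
  have finG: "finite G" using G(2) Suc.prems(3) by (metis card.infinite less_irrefl)
  have finY: "finite Y" using Y fin by (rule finite_subset)
  \<comment> \<open>Only \<open>s\<close> of the many vertices of \<open>Y\<close> are used: an
    injection attaches a different one to each tuple, which keeps the tuples disjoint.\<close>
  have "(h * 2 ^ m) * m \<le> card Y * (h * 2 ^ (h * s))" using big card by (rule le_trans)
  also have "\<dots> \<le> card Y * (h * 2 ^ m)" using m by (intro mult_left_mono power_increasing) auto
  finally have "m \<le> card Y" using pos by (simp add: mult.commute)
  then have "card G \<le> card Y" using G(2) \<open>s \<le> m\<close> by simp
  then obtain f where f: "f ` G \<subseteq> Y" "inj_on f G"
    using card_le_inj[OF finG finY] by blast
  define F where "F = (\<lambda>R. R @ [f R]) ` G"
  have FM: "F \<subseteq> M" using GY f(1) by (auto simp: F_def)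
  have cardF: "card F = s" unfolding F_def using G(2) by (simp add: card_image inj_on_def)
  have len: "length R = j" if "R \<in> G" for R using that G(3) by (simp add: cross_adjacent_def)
  have adj: "E (R ! a) (f R')" if "R \<in> G" "R' \<in> G" "a < j" for R R' a
    using clique_append_adjacent[of R "f R'" V j a] GY[of R "f R'"] that f(1) Suc.prems(1) by blast
  have cross: "E ((R @ [f R]) ! a) ((R' @ [f R']) ! b)"
    if that: "R \<in> G" "R' \<in> G" and ab: "a < Suc j" "b < Suc j" "a \<noteq> b" for R R' a b
  proof -
    consider "a < j" "b < j" | "a < j" "b = j" | "a = j" "b < j" using ab by linarith
    then show ?thesis
    proof cases
      case 1
      then show ?thesis using G(3) that ab len by (auto simp: cross_adjacent_def nth_append)
    next
      case 2
      then show ?thesis using adj that len by (auto simp: nth_append)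
    next
      case 3
      then show ?thesis using adj[of R' R b] that len by (auto simp: nth_append intro: sym)
    qed
  qed
  have inj: "R @ [f R] = R' @ [f R']"
    if "R \<in> G" "R' \<in> G" "a < Suc j" "(R @ [f R]) ! a = (R' @ [f R']) ! a" for R R' a
  proof (cases "a < j")
    case True
    then have "R ! a = R' ! a" using that len by (simp add: nth_append)
    moreover have "inj_on (\<lambda>R. R ! a) G" using G(3) True by (simp add: cross_adjacent_def)
    ultimately have "R = R'" using that by (meson inj_onD)
    then show ?thesis by simp
  next
    case False
    then have "f R = f R'" using that len by (simp add: nth_append split: if_splits)
    then have "R = R'" using that f(2) by (meson inj_onD)
    then show ?thesis by simp
  qed
  have "cross_adjacent E (Suc j) F"
    unfolding cross_adjacent_def inj_on_def
  proof (intro conjI ballI allI impI)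
    fix R assume "R \<in> F"
    then show "length R = Suc j" using len by (auto simp: F_def)
  next
    fix R R' a b assume "R \<in> F" "R' \<in> F" "a < Suc j" "b < Suc j" "a \<noteq> b"
    then show "E (R ! a) (R' ! b)" using cross by (auto simp: F_def)
  next
    fix R R' a assume "a < Suc j" "R \<in> F" "R' \<in> F" "R ! a = R' ! a"
    then show "R = R'" using inj unfolding F_def by blast
  qed
  then show ?case using FM cardF by blast
qed

text \<open>In the last coordinate the whole common extension set \<open>Y\<close> is kept. This
  asymmetry produces the one large part, while the other parts have size \<open>s\<close>.\<close>

theorem complete_multipartite_blowup:
  assumes fin: "finite V" and j: "1 \<le> j" and M: "M \<subseteq> cliques E V (Suc j)"
    and dense: "2 * Suc j * card V ^ Suc j \<le> h * card M" and pos: "0 < h" "0 < s"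
    and big: "h * 2 ^ (h ^ j * s) * (h ^ j * s) \<le> card V"
  shows "\<exists>G Y. G \<subseteq> cliques E V j \<and> card G = s \<and> cross_adjacent E j G \<and> Y \<subseteq> V \<and>
    (\<forall>R\<in>G. \<forall>y\<in>Y. R @ [y] \<in> M) \<and> card V \<le> card Y * (h * 2 ^ (h * s))"
proof (rule blowup_step[OF fin M dense pos])
  have "0 < h * 2 ^ (h ^ j * s) * (h ^ j * s)" using pos by simp
  then show "0 < card V" using big by (rule less_le_trans)
  fix M' assume M': "M' \<subseteq> cliques E V j" "2 * j * card V ^ j \<le> h * card M'"
  have eq: "h ^ (j - 1) * (h * s) = h ^ j * s" using j by (cases j) auto
  show "\<exists>F\<subseteq>M'. card F = h * s \<and> cross_adjacent E j F"
    using blowup_matching[OF fin j M', of "h * s", unfolded eq] big pos by simp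
qed

end

section \<open>Embedding\<close>

text \<open>Initial segments of listings of the \<open>P i\<close> serve as parts; \<open>u\<close>
  and \<open>v\<close> head the first listing because the additional edge joins
  \<open>(0, 0)\<close> and \<open>(0, 1)\<close>. Arcs of \<open>G\<close> are abstract, so an arc
  map \<open>\<psi>\<close> has to be chosen, and the subgraph is the image of the resulting
  isomorphism.\<close>

lemma embed_complete_multipartite_plus:
  fixes P :: "nat \<Rightarrow> 'a set"
  assumes "graph G" and ss: "0 < length ss" "2 \<le> ss ! 0"
    and P: "\<And>i. i < length ss \<Longrightarrow> P i \<subseteq> verts G" "\<And>i. i < length ss \<Longrightarrow> ss ! i \<le> card (P i)"
    and cross: "\<And>i j a b. i < length ss \<Longrightarrow> j < length ss \<Longrightarrow> i \<noteq> j \<Longrightarrow> a \<in> P i \<Longrightarrow> b \<in> P j \<Longrightarrow> a \<rightarrow>\<^bsub>G\<^esub> b"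
    and uv: "u \<in> P 0" "v \<in> P 0" "u \<rightarrow>\<^bsub>G\<^esub> v"
  shows "\<exists>H. subgraph H G \<and> digraph_iso (with_proj (complete_multipartite_plus ss)) H"
proof -
  interpret graph G by fact
  interpret A: adjacency "\<lambda>u v. u \<rightarrow>\<^bsub>G\<^esub> v" by (rule adjacency_graph) fact
  let ?K = "complete_multipartite_plus ss"
  interpret K: pair_graph ?K
    using ss by (intro pair_graph_complete_multipartite_plus) auto
  have finP: "finite (P i)" if "i < length ss" for i
    using P(1)[OF that] finite_verts by (rule finite_subset)
  have "\<exists>L. distinct L \<and> set L = P i \<and> (i = 0 \<longrightarrow> L ! 0 = u \<and> L ! 1 = v)" if i: "i < length ss" for i
  proof (cases "i = 0")
    case True
    have "finite (P 0 - {u, v})" using finP i True by simp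
    from finite_distinct_list[OF this] obtain L where L: "set L = P 0 - {u, v}" "distinct L" by blast
    have "u \<noteq> v" using uv(3) A.irrefl by blast
    then show ?thesis using L uv True by (intro exI[of _ "u # v # L"]) auto
  next
    case False
    then show ?thesis using finite_distinct_list[OF finP[OF i]] by auto
  qed
  then obtain L where L: "\<And>i. i < length ss \<Longrightarrow> distinct (L i) \<and> set (L i) = P i"
    and L0: "L 0 ! 0 = u" "L 0 ! 1 = v" using ss(1) by metis
  have len: "ss ! i \<le> length (L i)" if "i < length ss" for i
    using L[OF that] P(2)[OF that] distinct_card[of "L i"] by simp
  define \<phi> where "\<phi> p = L (fst p) ! snd p" for p
  have pv: "p \<in> pverts ?K \<longleftrightarrow> fst p < length ss \<and> snd p < ss ! fst p" for p
    by (auto simp: complete_multipartite_plus_def complete_multipartite_def Let_def)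
  have \<phi>P: "\<phi> p \<in> P (fst p)" if "p \<in> pverts ?K" for p
    using that L[of "fst p"] len[of "fst p"] unfolding pv \<phi>_def by (metis less_le_trans nth_mem)
  have adj: "\<phi> p \<rightarrow>\<^bsub>G\<^esub> \<phi> q" if pq: "(p, q) \<in> parcs ?K" for p q
  proof (cases "fst p = fst q")
    case False
    have "p \<in> pverts ?K" "q \<in> pverts ?K" 
      using K.arc_fst_in_verts[OF pq] K.arc_snd_in_verts[OF pq] by simp_all
    then show ?thesis using cross[of "fst p" "fst q"] \<phi>P False pv by blast
  next
    case True
    then have "(p, q) \<in> {((0, 0), (0, 1)), ((0, 1), (0, 0))}"
      using pq by (auto simp: complete_multipartite_plus_def complete_multipartite_def Let_def)
    then show ?thesis using uv(3) A.sym L0 by (auto simp: \<phi>_def)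
  qed
  have inj: "inj_on \<phi> (pverts ?K)"
  proof (rule inj_onI)
    fix p q assume p: "p \<in> pverts ?K" and q: "q \<in> pverts ?K" and eq: "\<phi> p = \<phi> q"
    have "fst p = fst q"
    proof (rule ccontr)
      assume "fst p \<noteq> fst q"
      then have "\<phi> p \<rightarrow>\<^bsub>G\<^esub> \<phi> q" using cross[of "fst p" "fst q"] \<phi>P p q pv by blast
      then show False using A.irrefl eq by simp
    qed
    moreover have "snd p = snd q"
    proof -
      have "distinct (L (fst p))" "snd p < length (L (fst p))" "snd q < length (L (fst p))"
        using L[of "fst p"] len[of "fst p"] p q \<open>fst p = fst q\<close> unfolding pv by auto
      then show ?thesis using eq \<open>fst p = fst q\<close> by (simp add: \<phi>_def nth_eq_iff_index_eq)
    qed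
    ultimately show "p = q" by (simp add: prod_eq_iff)
  qed
  have "\<exists>e. e \<in> arcs G \<and> tail G e = \<phi> (fst a) \<and> head G e = \<phi> (snd a)" if "a \<in> parcs ?K" for a
    using adj[of "fst a" "snd a"] that by (auto simp: arcs_ends_conv)
  then obtain \<psi> where \<psi>: "\<And>a. a \<in> parcs ?K \<Longrightarrow>
      \<psi> a \<in> arcs G \<and> tail G (\<psi> a) = \<phi> (fst a) \<and> head G (\<psi> a) = \<phi> (snd a)" by metis
  define hom where "hom = \<lparr> iso_verts = \<phi>, iso_arcs = \<psi>, iso_head = head G, iso_tail = tail G \<rparr>"
  have inj\<psi>: "inj_on \<psi> (parcs ?K)"
  proof (rule inj_onI)
    fix a b assume a: "a \<in> parcs ?K" and b: "b \<in> parcs ?K" and eq: "\<psi> a = \<psi> b"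
    have "\<phi> (fst a) = \<phi> (fst b)" "\<phi> (snd a) = \<phi> (snd b)" using \<psi>[OF a] \<psi>[OF b] eq by auto
    moreover have "fst a \<in> pverts ?K" "fst b \<in> pverts ?K" "snd a \<in> pverts ?K" "snd b \<in> pverts ?K"
      using a b by (auto intro: K.arc_fst_in_verts K.arc_snd_in_verts)
    ultimately show "a = b" using inj by (metis inj_onD prod_eq_iff)
  qed
  have iso: "K.digraph_isomorphism hom"
    unfolding K.digraph_isomorphism_def hom_def
    using inj inj\<psi> \<psi> K.wf_digraph_axioms by simp
  let ?H = "app_iso hom (with_proj ?K)"
  have "wf_digraph ?H" using iso by (rule K.wf_digraphI_app_iso)
  moreover have "verts ?H \<subseteq> verts G" using \<phi>P P(1) pv by (auto simp: hom_def) blast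
  moreover have "arcs ?H \<subseteq> arcs G" using \<psi> by (auto simp: hom_def)
  moreover have "compatible G ?H" by (simp add: compatible_def hom_def)
  ultimately have "subgraph ?H G" unfolding subgraph_def using wf_digraph_axioms by blast
  then show ?thesis using iso unfolding digraph_iso_def by blast
qed

text \<open>The coordinates from \<open>k\<close> on become the small parts and \<open>Y\<close> the
  large one. \<open>U\<close> joins the first part, so it has to be adjacent only to later
  coordinates and to \<open>Y\<close>. The two uses are \<open>k = 0\<close> with
  \<open>U = {u, v}\<close>, and \<open>k = 1\<close> with \<open>U\<close> a single vertex of the
  spare coordinate 0.\<close>

lemma embed_cross_family:
  fixes G :: "('a, 'b) pre_digraph"
  assumes G: "graph G" and r: "2 \<le> r" and st: "2 \<le> s" "t \<le> card Y"
    and F: "cross_adjacent (\<lambda>u v. u \<rightarrow>\<^bsub>G\<^esub> v) (k + (r - 1)) F" "card F = s"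
    and V: "\<And>R. R \<in> F \<Longrightarrow> set R \<subseteq> verts G" "Y \<subseteq> verts G" "U \<subseteq> verts G"
    and FY: "\<And>R y i. R \<in> F \<Longrightarrow> y \<in> Y \<Longrightarrow> i < k + (r - 1) \<Longrightarrow> R ! i \<rightarrow>\<^bsub>G\<^esub> y"
    and UF: "\<And>w R i. w \<in> U \<Longrightarrow> R \<in> F \<Longrightarrow> k < i \<Longrightarrow> i < k + (r - 1) \<Longrightarrow> w \<rightarrow>\<^bsub>G\<^esub> R ! i"
    and UY: "\<And>w y. w \<in> U \<Longrightarrow> y \<in> Y \<Longrightarrow> w \<rightarrow>\<^bsub>G\<^esub> y"
    and uv: "u \<in> U \<union> (\<lambda>R. R ! k) ` F" "v \<in> U \<union> (\<lambda>R. R ! k) ` F" "u \<rightarrow>\<^bsub>G\<^esub> v"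
  shows "\<exists>H. subgraph H G \<and>
    digraph_iso (with_proj (complete_multipartite_plus (replicate (r - 1) s @ [t]))) H"
proof -
  interpret graph G by fact
  interpret A: adjacency "\<lambda>u v. u \<rightarrow>\<^bsub>G\<^esub> v" by (rule adjacency_graph) fact
  let ?ss = "replicate (r - 1) s @ [t]"
  define P where "P i = (if i < r - 1 then (if i = 0 then U else {}) \<union> (\<lambda>R. R ! (k + i)) ` F else Y)" for i
  have finF: "finite F" using F(2) st by (metis card.infinite not_numeral_le_zero)
  have finU: "finite U" using V(3) finite_verts by (rule finite_subset)
  have len: "length ?ss = r" using r by simp
  have FF: "R ! i \<rightarrow>\<^bsub>G\<^esub> R' ! j" if "R \<in> F" "R' \<in> F" "i < k + (r - 1)" "j < k + (r - 1)" "i \<noteq> j" for R R' i j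
    using F(1) that unfolding cross_adjacent_def by blast
  have lt: "a \<rightarrow>\<^bsub>G\<^esub> b" if ij: "i < j" "j < r" and a: "a \<in> P i" and b: "b \<in> P j" for i j a b
  proof -
    have i: "i < r - 1" using ij by simp
    consider "a \<in> U" "i = 0" | R where "R \<in> F" "a = R ! (k + i)"
      using a i by (auto simp: P_def split: if_splits)
    then show ?thesis
    proof cases
      case 1
      show ?thesis
      proof (cases "j < r - 1")
        case True
        then obtain R' where "R' \<in> F" "b = R' ! (k + j)" using b ij by (auto simp: P_def)
        then show ?thesis using UF[of a R' "k + j"] 1 True ij by simp
      next
        case False
        then show ?thesis using UY[of a b] b 1 by (simp add: P_def)
      qed
    next
      case 2
      show ?thesis
      proof (cases "j < r - 1")
        case True
        then obtain R' where "R' \<in> F" "b = R' ! (k + j)" using b ij by (auto simp: P_def)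
        then show ?thesis using FF[of R R' "k + i" "k + j"] 2 True i ij by simp
      next
        case False
        then show ?thesis using FY[of R b "k + i"] b 2 i by (simp add: P_def)
      qed
    qed
  qed
  show ?thesis
  proof (rule embed_complete_multipartite_plus[OF G, where P = P and u = u and v = v])
    show "0 < length ?ss" using r by simp
    show "2 \<le> ?ss ! 0" using r st by (simp add: nth_append)
    show "P i \<subseteq> verts G" if "i < length ?ss" for i
    proof -
      have "R ! (k + i) \<in> verts G" if "i < r - 1" "R \<in> F" for R
      proof -
        have "length R = k + (r - 1)" using F(1) that by (simp add: cross_adjacent_def)
        then have "R ! (k + i) \<in> set R" using that by simp
        then show ?thesis using V(1) that by blast
      qed
      then show ?thesis using V(2,3) by (auto simp: P_def)
    qed
    show "?ss ! i \<le> card (P i)" if "i < length ?ss" for i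
    proof (cases "i < r - 1")
      case True
      have "inj_on (\<lambda>R. R ! (k + i)) F" using F(1) True by (simp add: cross_adjacent_def)
      then have "card ((\<lambda>R. R ! (k + i)) ` F) = s" using F(2) by (simp add: card_image)
      moreover have "card ((\<lambda>R. R ! (k + i)) ` F) \<le> card (P i)"
        using True finF finU by (intro card_mono) (auto simp: P_def)
      ultimately show ?thesis using True by (simp add: nth_append)
    next
      case False
      then have "i = r - 1" using that r by simp
      then show ?thesis using st by (simp add: nth_append P_def)
    qed
    show "a \<rightarrow>\<^bsub>G\<^esub> b" if "i < length ?ss" "j < length ?ss" "i \<noteq> j" "a \<in> P i" "b \<in> P j" for i j a b
    proof (cases "i < j")
      case True
      then show ?thesis using lt that len by metis
    next
      case False
      then have "j < i" using that by simp
      then have "b \<rightarrow>\<^bsub>G\<^esub> a" using lt that len by metis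
      then show ?thesis by (rule A.sym)
    qed
    show "u \<in> P 0" "v \<in> P 0" using uv r by (auto simp: P_def)
  qed (rule uv(3))
qed

lemma embed_from_edge:
  fixes G :: "('a, 'b) pre_digraph"
  defines "E \<equiv> \<lambda>u v. u \<rightarrow>\<^bsub>G\<^esub> v" and "V \<equiv> verts G"
  assumes G: "graph G" and r: "2 \<le> r" and s: "2 \<le> s" and h: "0 < h"
    and uv: "u \<in> V" "v \<in> V" "E u v"
    and M: "M \<subseteq> cliques E V r" "\<And>ys y. ys \<in> M \<Longrightarrow> y \<in> set (tl ys) \<Longrightarrow> E u y \<and> E v y"
    and dense: "2 * r * card V ^ r \<le> h * card M"
    and big: "h * 2 ^ (h ^ (r - 1) * s) * (h ^ (r - 1) * s) \<le> card V"
    and t: "\<And>y. card V \<le> y * (h * 2 ^ (h * s)) \<Longrightarrow> t \<le> y"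
  shows "\<exists>H. subgraph H G \<and>
    digraph_iso (with_proj (complete_multipartite_plus (replicate (r - 1) s @ [t]))) H"
proof -
  interpret graph G by fact
  interpret A: adjacency E unfolding E_def by (rule adjacency_graph) fact
  have fin: "finite V" by (simp add: V_def)
  have sr: "Suc (r - 1) = r" using r by simp
  have r1: "1 \<le> r - 1" using r by simp
  obtain F Y where F: "F \<subseteq> cliques E V (r - 1)" "card F = s" "cross_adjacent E (r - 1) F" and Y: "Y \<subseteq> V"
    and FY: "\<And>R y. R \<in> F \<Longrightarrow> y \<in> Y \<Longrightarrow> R @ [y] \<in> M" and cY: "card V \<le> card Y * (h * 2 ^ (h * s))"
    using A.complete_multipartite_blowup[OF fin r1, of M h s] s h M(1) dense big unfolding sr by auto
  \<comment> \<open>Adjacency to \<open>u\<close> and \<open>v\<close> is known only for complete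
    tuples in \<open>M\<close>, so statements about \<open>F\<close> need some \<open>y0\<close> in
    \<open>Y\<close>, and conversely.\<close>
  have "card V > 0" using uv fin by (auto simp: card_gt_0_iff)
  then have "Y \<noteq> {}" using cY by auto
  then obtain y0 where y0: "y0 \<in> Y" by blast
  have "F \<noteq> {}" using F(2) s by auto
  then obtain R0 where R0: "R0 \<in> F" by blast
  have len: "length R = r - 1" if "R \<in> F" for R using that F(1) by (auto simp: cliques_def)
  have tl: "tl (R @ [y]) = tl R @ [y]" if "R \<in> F" for R y
    using len[OF that] r by (cases R) auto
  have uvF: "E u (R ! i) \<and> E v (R ! i)" if "R \<in> F" "0 < i" "i < r - 1" for R i
  proof -
    have "R ! i = tl R ! (i - 1)" using that len by (simp add: nth_tl)
    then have "R ! i \<in> set (tl R)" using that len by (simp add: nth_mem)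
    then show ?thesis using M(2)[OF FY[OF that(1) y0]] tl that by simp
  qed
  have uvY: "E u y \<and> E v y" if "y \<in> Y" for y
    using M(2)[OF FY[OF R0 that]] tl[OF R0] by simp
  have FYadj: "E (R ! i) y" if "R \<in> F" "y \<in> Y" "i < r - 1" for R y i
    using A.clique_append_adjacent[of R y V "r - 1" i] FY[OF that(1,2)] M(1) that(3) unfolding sr by blast
  show ?thesis
  proof (rule embed_cross_family[OF G r s, where k = 0 and F = F and Y = Y and U = "{u, v}" and u = u and v = v])
    show "t \<le> card Y" using t cY by blast
    show "set R \<subseteq> verts G" if "R \<in> F" for R using F(1) that by (auto simp: cliques_def V_def)
    show "w \<rightarrow>\<^bsub>G\<^esub> R ! i" if "w \<in> {u, v}" "R \<in> F" "0 < i" "i < 0 + (r - 1)" for w R i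
      using uvF[of R i] that by (auto simp: E_def)
    show "w \<rightarrow>\<^bsub>G\<^esub> y" if "w \<in> {u, v}" "y \<in> Y" for w y using uvY[of y] that by (auto simp: E_def)
    show "R ! i \<rightarrow>\<^bsub>G\<^esub> y" if "R \<in> F" "y \<in> Y" "i < 0 + (r - 1)" for R y i
      using FYadj that by (auto simp: E_def)
  qed (use F Y uv in \<open>auto simp: E_def V_def\<close>)
qed

text \<open>One vertex of the spare part is moved into the next part, where its edge to the
  following vertex of the same clique becomes the additional edge.\<close>

lemma embed_from_larger_cliques:
  fixes G :: "('a, 'b) pre_digraph"
  defines "E \<equiv> \<lambda>u v. u \<rightarrow>\<^bsub>G\<^esub> v" and "V \<equiv> verts G"
  assumes G: "graph G" and r: "2 \<le> r" and s: "2 \<le> s" and h: "0 < h"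
    and dense: "2 * Suc r * card V ^ Suc r \<le> h * card (cliques E V (Suc r))"
    and big: "h * 2 ^ (h ^ r * s) * (h ^ r * s) \<le> card V"
    and t: "\<And>y. card V \<le> y * (h * 2 ^ (h * s)) \<Longrightarrow> t \<le> y"
  shows "\<exists>H. subgraph H G \<and>
    digraph_iso (with_proj (complete_multipartite_plus (replicate (r - 1) s @ [t]))) H"
proof -
  interpret graph G by fact
  interpret A: adjacency E unfolding E_def by (rule adjacency_graph) fact
  have fin: "finite V" by (simp add: V_def)
  obtain F Y where F: "F \<subseteq> cliques E V r" "card F = s" "cross_adjacent E r F" and Y: "Y \<subseteq> V"
    and FY: "\<And>R y. R \<in> F \<Longrightarrow> y \<in> Y \<Longrightarrow> R @ [y] \<in> cliques E V (Suc r)"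
    and cY: "card V \<le> card Y * (h * 2 ^ (h * s))"
    using A.complete_multipartite_blowup[OF fin _ order_refl dense h _ big] r s by auto
  have "F \<noteq> {}" using F(2) s by auto
  then obtain R0 where R0: "R0 \<in> F" by blast
  have len: "length R0 = r" using R0 F(1) by (auto simp: cliques_def)
  have adj: "E (R ! i) (R' ! j)" if "R \<in> F" "R' \<in> F" "i < r" "j < r" "i \<noteq> j" for R R' i j
    using F(3) that unfolding cross_adjacent_def by blast
  have FYadj: "E (R ! i) y" if "R \<in> F" "y \<in> Y" "i < r" for R y i
    using A.clique_append_adjacent[OF FY[OF that(1,2)] that(3)] .
  have sr: "1 + (r - 1) = r" using r by simp
  show ?thesis
  proof (rule embed_cross_family[OF G r s, where k = 1 and F = F and Y = Y and U = "{R0 ! 0}"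
        and u = "R0 ! 0" and v = "R0 ! 1"], unfold sr)
    show "t \<le> card Y" using t cY by blast
    show "set R \<subseteq> verts G" if "R \<in> F" for R using F(1) that by (auto simp: cliques_def V_def)
    have "R0 ! 0 \<in> set R0" using len r by simp
    moreover have "set R0 \<subseteq> V" using F(1) R0 by (auto simp: cliques_def)
    ultimately show "{R0 ! 0} \<subseteq> verts G" by (auto simp: V_def)
    show "w \<rightarrow>\<^bsub>G\<^esub> R ! i" if "w \<in> {R0 ! 0}" "R \<in> F" "1 < i" "i < r" for w R i
      using adj[of R0 R 0 i] R0 that by (auto simp: E_def)
    show "w \<rightarrow>\<^bsub>G\<^esub> y" if "w \<in> {R0 ! 0}" "y \<in> Y" for w y
      using FYadj[of R0 y 0] R0 that r by (auto simp: E_def)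
    show "R ! i \<rightarrow>\<^bsub>G\<^esub> y" if "R \<in> F" "y \<in> Y" "i < r" for R y i
      using FYadj that by (auto simp: E_def)
    show "R0 ! 0 \<rightarrow>\<^bsub>G\<^esub> R0 ! 1" using adj[of R0 R0 0 1] R0 r by (simp add: E_def)
  qed (use F Y R0 in \<open>auto simp: E_def V_def\<close>)
qed

section \<open>The quantitative estimates\<close>

text \<open>The hypothesis on \<open>h\<close> gives \<open>h ^ e * s \<le> L / 4\<close>, so the
  three factors of the size condition are each at most \<open>exp (L / 4)\<close>. It also gives
  \<open>h \<le> 1 / (2 * sqrt c)\<close>, so that \<open>h\<close> and \<open>2 ^ (h * s)\<close>
  are each at most \<open>exp (sqrt c / 2 * L)\<close> and cost together \<open>n\<close> to the
  power \<open>sqrt c\<close>.\<close>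

lemma blowup_size_bounds:
  fixes c L :: real and n r h s :: nat
  assumes c: "0 < c" and n: "0 < n" and L: "L = ln (real n)" "2 / c \<le> L"
    and h: "1 \<le> h" "4 * c * real h ^ r \<le> 1" and r: "2 \<le> r"
    and s: "s = nat \<lfloor>c * L\<rfloor>"
  shows "2 \<le> s"
    and "e \<le> r \<Longrightarrow> h * 2 ^ (h ^ e * s) * (h ^ e * s) \<le> n"
    and "n \<le> y * (h * 2 ^ (h * s)) \<Longrightarrow> nat \<lceil>real n powr (1 - sqrt c)\<rceil> \<le> y"
proof -
  have cL: "2 \<le> c * L" using L(2) c by (simp add: field_simps)
  then have Lpos: "0 < L" using c by (smt (verit) mult_nonneg_nonpos)
  have nL: "real n = exp L" using n L by simp
  have "2 \<le> \<lfloor>c * L\<rfloor>" using cL by (simp add: le_floor_iff)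
  then show "2 \<le> s" unfolding s by linarith
  have sL: "real s \<le> c * L" unfolding s using cL by simp
  have two: "(2 :: real) ^ k \<le> exp (real k)" for k
  proof -
    have "(2 :: real) ^ k \<le> exp 1 ^ k" using exp_ge_add_one_self[of 1] by (intro power_mono) auto
    then show ?thesis by (simp add: exp_of_nat_mult[symmetric])
  qed
  have h2: "4 * c * (real h)\<^sup>2 \<le> 1"
  proof -
    have "(real h)\<^sup>2 \<le> real h ^ r" using h r by (intro power_increasing) auto
    then have "4 * c * (real h)\<^sup>2 \<le> 4 * c * real h ^ r" using c by (intro mult_left_mono) auto
    then show ?thesis using h by simp
  qed
  show "h * 2 ^ (h ^ e * s) * (h ^ e * s) \<le> n" if e: "e \<le> r"
  proof -
    define m where "m = h ^ e * s"
    have "real m = real h ^ e * real s" by (simp add: m_def)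
    also have "\<dots> \<le> real h ^ r * (c * L)"
      using sL h e by (intro mult_mono power_increasing) auto
    also have "\<dots> = (4 * c * real h ^ r) * (L / 4)" by simp
    also have "\<dots> \<le> 1 * (L / 4)" using h Lpos by (intro mult_right_mono) auto
    finally have m: "real m \<le> L / 4" by simp
    have x: "x \<le> exp x" for x :: real using exp_ge_add_one_self[of x] by linarith
    have "real h \<le> real h ^ r" using h r by (simp add: self_le_power)
    also have "\<dots> \<le> 1 / (4 * c)" using h c by (simp add: field_simps)
    also have "\<dots> \<le> L / 4" using L c Lpos by (simp add: field_simps)
    finally have hL: "real h \<le> exp (L / 4)" using x[of "L / 4"] by linarith
    have mL: "real m \<le> exp (L / 4)" using m x[of "L / 4"] by linarith
    have m2: "2 ^ m \<le> exp (L / 4)" using two[of m] m by (smt (verit) exp_le_cancel_iff)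
    have "real (h * 2 ^ m * m) = real h * 2 ^ m * real m" by simp
    also have "\<dots> \<le> exp (L / 4) * exp (L / 4) * exp (L / 4)"
      using hL mL m2 by (intro mult_mono) auto
    also have "\<dots> = exp (L / 4 + L / 4 + L / 4)" by (simp only: exp_add)
    also have "\<dots> \<le> real n" unfolding nL using Lpos by simp
    finally show ?thesis unfolding m_def by (simp only: of_nat_le_iff)
  qed
  show "nat \<lceil>real n powr (1 - sqrt c)\<rceil> \<le> y" if y: "n \<le> y * (h * 2 ^ (h * s))"
  proof -
    have hc: "2 * sqrt c * real h \<le> 1"
    proof -
      have "(2 * sqrt c * real h)\<^sup>2 \<le> 1\<^sup>2" using h2 c by (simp add: power_mult_distrib)
      then show ?thesis by (rule power2_le_imp_le) simp
    qed
    have "real h * c = sqrt c * (sqrt c * real h)" using c by simp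
    also have "\<dots> \<le> sqrt c * (1 / 2)" using hc c by (intro mult_left_mono) auto
    finally have "real h * c * L \<le> sqrt c / 2 * L" using Lpos by (intro mult_right_mono) auto
    moreover have "real (h * s) \<le> real h * c * L"
      using sL by (simp add: mult.assoc mult_left_mono)
    ultimately have e1: "real (h * s) \<le> sqrt c / 2 * L" by linarith
    have "real h \<le> 1 / (2 * sqrt c)" using hc c by (simp add: field_simps)
    also have "\<dots> \<le> sqrt c / 2 * (2 / c)"
    proof -
      have "1 / (2 * x) \<le> x / 2 * (2 / (x * x))" if "0 < x" for x :: real
        using that by (simp add: field_simps)
      from this[of "sqrt c"] show ?thesis using c by simp
    qed
    also have "\<dots> \<le> sqrt c / 2 * L" using L c by (intro mult_left_mono) auto
    finally have "real h \<le> sqrt c / 2 * L" .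
    then have e2: "real h \<le> exp (sqrt c / 2 * L)" using exp_ge_add_one_self[of "sqrt c / 2 * L"] by linarith
    have e3: "2 ^ (h * s) \<le> exp (sqrt c / 2 * L)" using two[of "h * s"] e1 by (smt (verit) exp_le_cancel_iff)
    have pw: "real n powr (1 - sqrt c) = exp ((1 - sqrt c) * L)" using n L by (simp add: powr_def)
    have "real n powr (1 - sqrt c) * (real h * 2 ^ (h * s))
        \<le> exp ((1 - sqrt c) * L) * (exp (sqrt c / 2 * L) * exp (sqrt c / 2 * L))"
      unfolding pw using e2 e3 by (intro mult_mono) auto
    also have "\<dots> = exp ((1 - sqrt c) * L + (sqrt c / 2 * L + sqrt c / 2 * L))" by (simp only: exp_add)
    also have "(1 - sqrt c) * L + (sqrt c / 2 * L + sqrt c / 2 * L) = L" by (simp add: algebra_simps)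
    also have "exp L \<le> real y * (real h * 2 ^ (h * s))"
    proof -
      have "real n \<le> real (y * (h * 2 ^ (h * s)))" using y by (simp only: of_nat_le_iff)
      then show ?thesis using nL by simp
    qed
    finally have "real n powr (1 - sqrt c) \<le> real y"
      by (rule mult_right_le_imp_le) (use h in simp)
    then show ?thesis by (simp add: ceiling_le_iff nat_le_iff)
  qed
qed

text \<open>The exponent \<open>2 * r + 11\<close> is what the bound on \<open>c\<close> in \<open>blowup_base_le\<close> permits. For \<open>r = 2\<close> it would
  violate \<open>blowup_base_ge_cliques\<close>, but there the bound on \<open>c\<close> leaves room for a larger base.\<close>

definition blowup_base :: "nat \<Rightarrow> nat" where
  "blowup_base r = (if r = 2 then 2 ^ 18 else r ^ (2 * r + 11))"

lemma blowup_base_pos: "2 \<le> r \<Longrightarrow> 1 \<le> blowup_base r"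
  by (simp add: blowup_base_def)

text \<open>For \<open>r \<ge> 3\<close> the exponents differ by 9, and \<open>r ^ 9\<close> covers
  the factor 4. For \<open>r = 2\<close> the comparison is
  \<open>2 ^ 38 \<le> 2 ^ 39\<close>.\<close>

lemma blowup_base_le:
  assumes r: "2 \<le> r" and c: "0 < c" "c \<le> 1 / real r ^ ((2 * r + 9) * (r + 1))"
  shows "4 * c * real (blowup_base r) ^ r \<le> 1"
proof -
  have "4 * blowup_base r ^ r \<le> r ^ ((2 * r + 9) * (r + 1))"
  proof (cases "r = 2")
    case True
    then show ?thesis by (simp add: blowup_base_def)
  next
    case False
    then have r3: "3 \<le> r" using r by simp
    have "4 \<le> (3::nat) ^ 9" by simp
    also have "\<dots> \<le> r ^ 9" using r3 by (rule power_mono) simp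
    finally have "4 * r ^ ((2 * r + 11) * r) \<le> r ^ 9 * r ^ ((2 * r + 11) * r)" by (rule mult_right_mono) simp
    also have "\<dots> = r ^ ((2 * r + 9) * (r + 1))"
      unfolding power_add[symmetric] by (rule arg_cong[where f = "\<lambda>k. r ^ k"]) (simp add: algebra_simps)
    finally show ?thesis using False by (simp add: blowup_base_def power_mult[symmetric])
  qed
  then have "real (4 * blowup_base r ^ r) \<le> real (r ^ ((2 * r + 9) * (r + 1)))"
    by (simp only: of_nat_le_iff)
  then have le: "4 * real (blowup_base r) ^ r \<le> real r ^ ((2 * r + 9) * (r + 1))" by simp
  have "4 * c * real (blowup_base r) ^ r = c * (4 * real (blowup_base r) ^ r)" by simp
  also have "\<dots> \<le> c * real r ^ ((2 * r + 9) * (r + 1))" using le c by (intro mult_left_mono) auto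
  also have "\<dots> \<le> 1" using c r by (simp add: field_simps)
  finally show ?thesis .
qed

text \<open>The induction step is \<open>(1 + 1 / r) ^ r \<ge> 2\<close>. It absorbs the factorial
  of \<open>blowup_base_ge_edge\<close> into a power of \<open>r\<close>.\<close>

lemma two_power_fact_le: "1 \<le> r \<Longrightarrow> 2 ^ r * fact r \<le> 2 * real r ^ r"
proof (induction r rule: nat_induct_at_least)
  case base
  then show ?case by simp
next
  case (Suc r)
  have "2 * real r ^ r \<le> real (Suc r) ^ r"
  proof -
    have "2 \<le> 1 + real r * (1 / real r)" using Suc by simp
    also have "\<dots> \<le> (1 + 1 / real r) ^ r"
      by (rule Bernoulli_inequality) (rule order_trans[of _ 0], auto)
    finally have "2 * real r ^ r \<le> (1 + 1 / real r) ^ r * real r ^ r" by (intro mult_right_mono) auto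
    also have "\<dots> = real (Suc r) ^ r" using Suc by (simp add: power_mult_distrib[symmetric] field_simps)
    finally show ?thesis .
  qed
  then have "2 * (2 * real r ^ r) * real (Suc r) \<le> 2 * real (Suc r) ^ r * real (Suc r)"
    by (intro mult_right_mono) auto
  moreover have "2 ^ Suc r * fact (Suc r) = 2 * (2 ^ r * fact r) * real (Suc r)" by (simp add: algebra_simps)
  moreover have "\<dots> \<le> 2 * (2 * real r ^ r) * real (Suc r)"
    using Suc by (intro mult_right_mono mult_left_mono) auto
  moreover have "2 * real (Suc r) ^ r * real (Suc r) = 2 * real (Suc r) ^ Suc r" by simp
  ultimately show ?case by linarith
qed

text \<open>The base demanded by \<open>edge_density\<close>; it is at most
  \<open>16 * r ^ (2 * r + 2)\<close>.\<close>

lemma blowup_base_ge_edge: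
  assumes r: "2 \<le> r"
  shows "4 * real r * ((2 * real r) ^ r * fact (Suc r)) \<le> real (blowup_base r)"
proof -
  have "(2 * real r) ^ r * fact (Suc r) = real r ^ r * (real r + 1) * (2 ^ r * fact r)"
    by (simp add: power_mult_distrib algebra_simps)
  also have "\<dots> \<le> real r ^ r * (2 * real r) * (2 * real r ^ r)"
    by (rule mult_mono[OF mult_left_mono two_power_fact_le]) (use r in auto)
  finally have "4 * real r * ((2 * real r) ^ r * fact (Suc r)) \<le>
      4 * real r * (real r ^ r * (2 * real r) * (2 * real r ^ r))" by (rule mult_left_mono) simp
  also have "\<dots> = 16 * real r ^ (2 * r + 2)"
  proof -
    have "real r ^ (2 * r + 2) = (real r ^ r * real r ^ r) * (real r * real r)"
      by (simp only: power_add power_even_eq power2_eq_square)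
    then show ?thesis by (simp only:) (simp add: algebra_simps)
  qed
  also have "\<dots> \<le> real (blowup_base r)"
  proof (cases "r = 2")
    case False
    then have r3: "3 \<le> real r" using r by simp
    have "16 \<le> (3::real) ^ 9" by simp
    also have "\<dots> \<le> real r ^ 9" using r3 by (rule power_mono) simp
    finally have "16 * real r ^ (2 * r + 2) \<le> real r ^ 9 * real r ^ (2 * r + 2)" by (rule mult_right_mono) simp
    also have "\<dots> = real r ^ (9 + (2 * r + 2))" by (simp only: power_add)
    also have "9 + (2 * r + 2) = 2 * r + 11" by simp
    finally show ?thesis using False by (simp add: blowup_base_def)
  qed (simp add: blowup_base_def)
  finally show ?thesis .
qed

text \<open>The base demanded by \<open>clique_density\<close>: 24576 is
  \<open>2 * 96 * 128\<close>, with \<open>5 / 96\<close> from the power of \<open>\<mu>\<close> and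
  128 from the excess of the ratio.\<close>

lemma blowup_base_ge_cliques:
  assumes r: "2 \<le> r"
  shows "24576 * (real r + 1) * real r ^ (r + 3) \<le> real (blowup_base r) * (5 * fact r)"
proof (cases "r = 2")
  case True
  then show ?thesis by (simp add: blowup_base_def)
next
  case False
  then have r3: "3 \<le> r" using r by simp
  have "(fact 3 :: real) \<le> fact r" by (rule fact_mono[OF r3])
  then have f: "6 \<le> (fact r :: real)" by (simp add: fact_numeral)
  have "24576 \<le> (3::real) ^ 7 * 30" by simp
  also have "\<dots> \<le> real r ^ 7 * (5 * fact r)" using r3 f by (intro mult_mono power_mono) auto
  finally have 1: "24576 \<le> real r ^ 7 * (5 * fact r)" .
  have 2: "real r + 1 \<le> real r ^ 2"
  proof -
    have "real r + 1 \<le> 3 * real r" using r3 by simp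
    also have "\<dots> \<le> real r * real r" using r3 by (intro mult_right_mono) auto
    finally show ?thesis by (simp add: power2_eq_square)
  qed
  have "24576 * (real r + 1) * real r ^ (r + 3) \<le> (real r ^ 7 * (5 * fact r)) * real r ^ 2 * real r ^ (r + 3)"
    using 1 2 by (intro mult_right_mono mult_mono) auto
  also have "\<dots> = real r ^ (r + 12) * (5 * fact r)" by (simp add: power_add mult_ac eval_nat_numeral)
  also have "\<dots> \<le> real r ^ (2 * r + 11) * (5 * fact r)"
    using r3 by (intro mult_right_mono power_increasing) auto
  finally show ?thesis using False by (simp add: blowup_base_def)
qed

text \<open>The degree slack lowers \<open>g\<close> from \<open>card S / (2 * r)\<close> by a
  relative amount of at most \<open>1 / (2 * r)\<close>. Its \<open>(r - 1)\<close>-st power thus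
  loses at most a factor 2, which cancels the 2 in \<open>many_cliques_on_an_edge\<close>; the lower
  bound on \<open>card S\<close> loses at most another factor 2.\<close>

lemma (in adjacency) edge_density:
  fixes n r :: nat
  assumes fin: "finite S" and r: "2 \<le> r" and m: "(1 - 1 / (4 * real r)) * real n \<le> real (card S)"
    and deg: "\<And>w. w \<in> S \<Longrightarrow> (1 - 1 / real r - 1 / (4 * real r ^ 3)) * real (card S) < real (card {v \<in> S. E w v})"
    and ne: "cliques E S (Suc r) \<noteq> {}"
  shows "\<exists>u v M. u \<in> S \<and> v \<in> S \<and> E u v \<and> M \<subseteq> cliques E S r \<and>
    (\<forall>ys\<in>M. \<forall>y\<in>set (tl ys). E u y \<and> E v y) \<and> 2 * r * n ^ r \<le> blowup_base r * card M"
proof -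
  define \<epsilon> where "\<epsilon> = 1 / (4 * real r ^ 3)"
  define k where "k = real (card S)"
  define D where "D = (1 / real r + \<epsilon>) * k"
  define g where "g = k - (real r - 1 / 2) * D"
  define f where "f = k - (real r - 1) * D"
  have k0: "0 \<le> k" by (simp add: k_def)
  have r0: "real r > 0" using r by simp
  have rr: "real r * \<epsilon> = 1 / (4 * real r ^ 2)" unfolding \<epsilon>_def using r0 by (simp add: field_simps power3_eq_cube power2_eq_square)
  have \<epsilon>0: "0 < \<epsilon>" unfolding \<epsilon>_def using r0 by simp
  have D: "real (card {w \<in> S. \<not> E v w}) \<le> D" if v: "v \<in> S" for v
  proof -
    have "{w \<in> S. \<not> E v w} = S - {w \<in> S. E v w}" by auto
    then have "real (card {w \<in> S. \<not> E v w}) = k - real (card {w \<in> S. E v w})"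
      unfolding k_def using fin by (simp add: card_Diff_subset of_nat_diff card_mono)
    also have "\<dots> \<le> D" using deg[OF v] unfolding D_def k_def[symmetric] \<epsilon>_def[symmetric] by (simp add: algebra_simps)
    finally show ?thesis .
  qed
  have gk: "(1 / (2 * real r)) * (1 - 1 / (2 * real r)) * k \<le> g"
  proof -
    have "g = (1 / (2 * real r) - (real r - 1 / 2) * \<epsilon>) * k"
      unfolding g_def D_def using r0 by (simp add: field_simps)
    moreover have "(1 / (2 * real r)) * (1 - 1 / (2 * real r)) \<le> 1 / (2 * real r) - (real r - 1 / 2) * \<epsilon>"
    proof -
      have "(real r - 1 / 2) * \<epsilon> \<le> real r * \<epsilon>" using \<epsilon>0 by (intro mult_right_mono) auto
      also have "\<dots> = (1 / (2 * real r)) * (1 / (2 * real r))" unfolding rr by (simp add: power2_eq_square)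
      finally show ?thesis by (simp add: right_diff_distrib)
    qed
    ultimately show ?thesis using k0 by (simp only: mult_right_mono)
  qed
  have h1: "1 / 2 \<le> 1 - 1 / (2 * real r)" using r by (simp add: field_simps)
  have g0: "0 \<le> g"
  proof -
    have "0 \<le> (1 / (2 * real r)) * (1 - 1 / (2 * real r)) * k" using h1 k0 r0 by (intro mult_nonneg_nonneg) auto
    then show ?thesis using gk by linarith
  qed
  have fk: "1 / (2 * real r) * k \<le> f"
  proof -
    have "f = (1 / real r - (real r - 1) * \<epsilon>) * k"
      unfolding f_def D_def using r0 by (simp add: field_simps)
    moreover have "1 / (2 * real r) \<le> 1 / real r - (real r - 1) * \<epsilon>"
    proof -
      have "(real r - 1) * \<epsilon> \<le> real r * \<epsilon>" using \<epsilon>0 by (intro mult_right_mono) auto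
      also have "\<dots> \<le> 1 / (2 * real r)" unfolding rr using r by (simp add: field_simps power2_eq_square)
      finally show ?thesis using r0 by (simp add: field_simps)
    qed
    ultimately show ?thesis using k0 by (simp only: mult_right_mono)
  qed
  obtain u v M where uvM: "u \<in> S" "v \<in> S" "E u v" "M \<subseteq> cliques E S r"
    "\<forall>ys\<in>M. \<forall>y\<in>set (tl ys). E u y \<and> E v y"
    and cM: "f * (g ^ (r - 1) * 2 / fact (Suc r)) \<le> real (card M)"
    using many_cliques_on_an_edge[OF fin D ne r, of g f] g0 unfolding g_def f_def k_def by auto
  have pw: "1 / 2 \<le> (1 - 1 / (2 * real r)) ^ (r - 1)"
  proof -
    have "1 / 2 \<le> 1 + real (r - 1) * (- (1 / (2 * real r)))" using r by (simp add: field_simps of_nat_diff)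
    also have "\<dots> \<le> (1 + - (1 / (2 * real r))) ^ (r - 1)" using r by (intro Bernoulli_inequality) (simp add: field_simps)
    finally show ?thesis by simp
  qed
  have pm: "1 / 2 * real n ^ r \<le> k ^ r"
  proof -
    have "1 / 2 \<le> 1 + real r * (- (1 / (4 * real r)))" using r by (simp add: field_simps)
    also have "\<dots> \<le> (1 + - (1 / (4 * real r))) ^ r" using r by (intro Bernoulli_inequality) (simp add: field_simps)
    finally have "1 / 2 * real n ^ r \<le> (1 - 1 / (4 * real r)) ^ r * real n ^ r" by (intro mult_right_mono) auto
    also have "\<dots> = ((1 - 1 / (4 * real r)) * real n) ^ r" by (simp only: power_mult_distrib)
    also have "\<dots> \<le> k ^ r"
      unfolding k_def using r by (intro power_mono[OF m] mult_nonneg_nonneg) (auto simp: field_simps)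
    finally show ?thesis .
  qed
  define q where "q = 1 / (2 * real r) * k"
  have q0: "0 \<le> q" unfolding q_def using k0 by simp
  then have f0: "0 \<le> f" using fk unfolding q_def by linarith
  have "q ^ r * (1 / fact (Suc r)) = q * (q ^ (r - 1) * (1 / 2) * 2 / fact (Suc r))"
    using r by (cases r) auto
  also have "\<dots> \<le> q * (q ^ (r - 1) * (1 - 1 / (2 * real r)) ^ (r - 1) * 2 / fact (Suc r))"
    using pw q0 by (intro mult_left_mono divide_right_mono mult_right_mono) auto
  also have "\<dots> = q * ((1 / (2 * real r) * (1 - 1 / (2 * real r)) * k) ^ (r - 1) * 2 / fact (Suc r))"
    unfolding q_def by (simp only: power_mult_distrib[symmetric]) (simp only: mult_ac)
  also have "\<dots> \<le> f * (g ^ (r - 1) * 2 / fact (Suc r))"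
    using fk gk q0 f0 g0 h1 k0 unfolding q_def
    by (intro mult_mono divide_right_mono mult_right_mono power_mono) auto
  finally have "q ^ r * (1 / fact (Suc r)) \<le> real (card M)" using cM by (rule order_trans)
  moreover have "q ^ r = k ^ r / (2 * real r) ^ r" unfolding q_def by (simp add: power_divide)
  ultimately have kM: "k ^ r \<le> (2 * real r) ^ r * fact (Suc r) * real (card M)"
    using r0 by (simp add: divide_simps mult_ac del: fact_Suc)
  have "2 * real r * real n ^ r = 4 * real r * (1 / 2 * real n ^ r)" by simp
  also have "\<dots> \<le> 4 * real r * ((2 * real r) ^ r * fact (Suc r) * real (card M))"
    using pm kM by (intro mult_left_mono) auto
  also have "\<dots> = 4 * real r * ((2 * real r) ^ r * fact (Suc r)) * real (card M)" by (simp only: mult_ac)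
  also have "\<dots> \<le> real (blowup_base r) * real (card M)"
    using blowup_base_ge_edge[OF r] by (intro mult_right_mono) auto
  finally have "real (2 * r * n ^ r) \<le> real (blowup_base r * card M)" by simp
  then have "2 * r * n ^ r \<le> blowup_base r * card M" by (simp only: of_nat_le_iff)
  then show ?thesis using uvM by blast
qed

text \<open>The first \<open>r - 1\<close> factors are the inverse of
  \<open>(1 + 1 / (r - 1)) ^ (r - 1)\<close>, which is at most \<open>exp 1\<close>; the other two
  are at least \<open>1 / 2\<close>.\<close>

lemma one_minus_inverse_power_ge:
  assumes r: "2 \<le> r"
  shows "1 / 12 \<le> (1 - 1 / real r) ^ Suc r"
proof -
  define k where "k = r - 1"
  have k: "r = Suc k" "0 < real k" using r by (auto simp: k_def)
  have "(1 + 1 / real k) ^ k \<le> exp (1 / real k) ^ k"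
    using exp_ge_add_one_self[of "1 / real k"] k by (intro power_mono) auto
  also have "\<dots> = exp 1" using k by (simp add: exp_of_nat_mult[symmetric])
  also have "\<dots> \<le> 3" by (rule exp_le)
  finally have le: "(1 + 1 / real k) ^ k \<le> 3" .
  have inv: "1 - 1 / real r = 1 / (1 + 1 / real k)" using k by (simp add: field_simps)
  have "0 < (1 + 1 / real k) ^ k" using k by (intro zero_less_power add_pos_nonneg) auto
  then have "1 / 3 \<le> 1 / (1 + 1 / real k) ^ k" using le by (intro divide_left_mono) auto
  then have "1 / 3 \<le> (1 - 1 / real r) ^ k" unfolding inv by (simp add: power_divide)
  moreover have "1 / 4 \<le> (1 - 1 / real r) ^ 2"
  proof -
    have "(1 / 2) ^ 2 \<le> (1 - 1 / real r) ^ 2" using r by (intro power_mono) (auto simp: field_simps)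
    then show ?thesis by (simp add: power2_eq_square)
  qed
  ultimately have "1 / 3 * (1 / 4) \<le> (1 - 1 / real r) ^ k * (1 - 1 / real r) ^ 2" by (intro mult_mono) auto
  also have "\<dots> = (1 - 1 / real r) ^ Suc r" unfolding power_add[symmetric] k by simp
  finally show ?thesis by simp
qed

text \<open>The excess keeps the critical factor \<open>1 - r * \<sigma>\<close> above
  \<open>1 / (128 * r ^ 3)\<close>. Bernoulli's inequality bounds the effect of the missing vertices
  by \<open>5 / 8\<close>, attained at \<open>r = 2\<close>, and \<open>1 / 12\<close> accounts for
  the power of \<open>1 - 1 / r\<close>.\<close>

lemma (in adjacency) clique_density:
  fixes n r :: nat
  assumes fin: "finite S" and pp: "principal_pair E S \<mu> x" and r: "2 \<le> r"
    and m: "(1 - 1 / (4 * real r)) * real n \<le> real (card S)"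
    and \<mu>: "1 - 1 / real r + 1 / (128 * real r ^ 4) \<le> \<mu> / real (card S)"
  shows "2 * Suc r * n ^ Suc r \<le> blowup_base r * card (cliques E S (Suc r))"
proof -
  define k where "k = real (card S)"
  define \<sigma> where "\<sigma> = 1 - \<mu> / k"
  have r0: "real r > 0" using r by simp
  have "S \<noteq> {}" using pp by (auto simp: principal_pair_def)
  then have k0: "0 < k" using fin by (simp add: k_def card_gt_0_iff)
  have "\<sigma> \<le> 1 / real r - 1 / (128 * real r ^ 4)" using \<mu> by (simp add: \<sigma>_def k_def)
  then have "real r * \<sigma> \<le> real r * (1 / real r - 1 / (128 * real r ^ 4))" using r0 by (intro mult_left_mono) auto
  also have "\<dots> = 1 - 1 / (128 * real r ^ 3)" using r0 by (simp add: field_simps eval_nat_numeral)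
  finally have rs: "1 / (128 * real r ^ 3) \<le> 1 - real r * \<sigma>" by simp
  have "0 < 1 / (128 * real r ^ 3)" using r0 by simp
  then have rs1: "real r * \<sigma> < 1" using rs by linarith
  have th: "(1 - 1 / real r) * k \<le> \<mu>"
  proof -
    have "1 - 1 / real r \<le> \<mu> / k" using \<mu> r0 unfolding k_def[symmetric] by (smt (verit) divide_nonneg_nonneg zero_le_power)
    then show ?thesis using k0 by (simp add: field_simps)
  qed
  have th0: "0 \<le> 1 - 1 / real r" using r by simp
  have pm: "5 / 8 * real n ^ Suc r \<le> k ^ Suc r"
  proof -
    have "5 / 8 \<le> 1 + real (Suc r) * (- (1 / (4 * real r)))" using r by (simp add: field_simps)
    also have "\<dots> \<le> (1 + - (1 / (4 * real r))) ^ Suc r" using r by (intro Bernoulli_inequality) (simp add: field_simps)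
    finally have "5 / 8 * real n ^ Suc r \<le> (1 - 1 / (4 * real r)) ^ Suc r * real n ^ Suc r"
      by (intro mult_right_mono) auto
    also have "\<dots> = ((1 - 1 / (4 * real r)) * real n) ^ Suc r" by (simp only: power_mult_distrib)
    also have "\<dots> \<le> k ^ Suc r"
      unfolding k_def using r by (intro power_mono[OF m] mult_nonneg_nonneg) (auto simp: field_simps)
    finally show ?thesis .
  qed
  have "1 / 12 * (5 / 8 * real n ^ Suc r) \<le> (1 - 1 / real r) ^ Suc r * k ^ Suc r"
    using one_minus_inverse_power_ge[OF r] pm th0 by (intro mult_mono) auto
  also have "\<dots> = ((1 - 1 / real r) * k) ^ Suc r" by (simp only: power_mult_distrib)
  also have "\<dots> \<le> \<mu> ^ Suc r" using th th0 k0 by (intro power_mono mult_nonneg_nonneg) auto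
  finally have 1: "5 / 96 * real n ^ Suc r \<le> \<mu> ^ Suc r" by simp
  have 2: "fact r / real r ^ r * (1 / (128 * real r ^ 3)) \<le> (\<Prod>k\<le>r. 1 - real k * \<sigma>)"
  proof -
    have "fact r / real r ^ r * (1 / (128 * real r ^ 3)) \<le> fact r / real r ^ r * (1 - real r * \<sigma>)"
      using rs by (intro mult_left_mono) auto
    also have "\<dots> \<le> (\<Prod>k\<le>r. 1 - real k * \<sigma>)" using r rs1 by (intro prod_one_minus_ge) auto
    finally show ?thesis .
  qed
  have "5 / 96 * real n ^ Suc r * (fact r / real r ^ r * (1 / (128 * real r ^ 3)))
      \<le> \<mu> ^ Suc r * (\<Prod>k\<le>r. 1 - real k * \<sigma>)"
    using 1 2 by (intro mult_mono order_trans[OF _ 1]) auto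
  also have "\<dots> \<le> real (card (cliques E S (Suc r)))"
    using r rs1 unfolding \<sigma>_def k_def by (intro card_cliques_spectral_ge[OF fin pp]) auto
  finally have c: "5 * fact r * real n ^ Suc r \<le> 12288 * real r ^ (r + 3) * real (card (cliques E S (Suc r)))"
    using r0 by (simp add: power_add divide_simps mult_ac del: power_Suc)
  have "2 * (real r + 1) * (5 * fact r * real n ^ Suc r) \<le>
      2 * (real r + 1) * (12288 * real r ^ (r + 3) * real (card (cliques E S (Suc r))))"
    using c by (rule mult_left_mono) simp
  also have "\<dots> = (24576 * (real r + 1) * real r ^ (r + 3)) * real (card (cliques E S (Suc r)))" by simp
  also have "\<dots> \<le> real (blowup_base r) * (5 * fact r) * real (card (cliques E S (Suc r)))"
    using blowup_base_ge_cliques[OF r] by (intro mult_right_mono) auto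
  finally have "(2 * (real r + 1) * real n ^ Suc r) * (5 * fact r) \<le>
      (real (blowup_base r) * real (card (cliques E S (Suc r)))) * (5 * fact r)"
    by (simp only: mult_ac)
  then have "2 * (real r + 1) * real n ^ Suc r \<le> real (blowup_base r) * real (card (cliques E S (Suc r)))"
    by (rule mult_right_le_imp_le) simp
  then have "real (2 * Suc r * n ^ Suc r) \<le> real (blowup_base r * card (cliques E S (Suc r)))"
    by (simp add: algebra_simps)
  then show ?thesis by (simp only: of_nat_le_iff)
qed

theorem theorem2:
  fixes G :: "('a, 'b) pre_digraph" and r n :: nat and c :: real
  assumes "r \<ge> 2" and "n > 0"
    and "2 / ln (real n) \<le> c" and "c \<le> 1 / real r ^ ((2 * r + 9) * (r + 1))"
    and "graph G" and "card (verts G) = n"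
    and "largest_eigenvalue G > largest_eigenvalue (with_proj (turan_graph r n))"
  shows "\<exists>H. subgraph H G \<and>
    digraph_iso
      (with_proj (complete_multipartite_plus
        (replicate (r - 1) (nat \<lfloor>c * ln (real n)\<rfloor>) @ [nat \<lceil>real n powr (1 - sqrt c)\<rceil>]))) H"
proof -
  interpret graph G by fact
  define E where "E = (\<lambda>u v. u \<rightarrow>\<^bsub>G\<^esub> v)"
  define V where "V = verts G"
  interpret A: adjacency E unfolding E_def by (rule adjacency_graph) fact
  note r = assms(1) and n = assms(2)
  have r0: "0 < r" "0 < real r" using r by auto
  have fin: "finite V" and cV: "card V = n" using assms(6) by (auto simp: V_def)
  have "V \<noteq> {}" using cV n by auto
  then obtain \<mu>0 x0 where pp0: "principal_pair E V \<mu>0 x0" using A.principal_pair_exists[OF fin] by blast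
  have eq: "largest_eigenvalue G = \<mu>" if "principal_pair E V \<mu> x" for \<mu> x
    using largest_eigenvalue_eq_principal[OF assms(5)] that by (simp add: E_def V_def)
  have clq: "cliques E V (Suc r) \<noteq> {}"
    using A.spectral_turan[OF fin r0(1) _ pp0] eq[OF pp0] assms(7) cV by auto
  define L where "L = ln (real n)"
  \<comment> \<open>In HOL \<open>2 / ln 1 = 0\<close>, so the bounds on \<open>c\<close> do not
    exclude \<open>n = 1\<close>; the existence of an \<open>(r + 1)\<close>-clique does.\<close>
  have "n \<noteq> 1"
  proof
    assume "n = 1"
    then obtain a where "V = {a}" using cV by (metis card_1_singletonE)
    moreover obtain bs where bs: "bs \<in> cliques E V (Suc r)" using clq by blast
    moreover obtain k where "r = Suc k" using r by (cases r) auto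
    ultimately have "E a a" by (auto simp: cliques_def length_Suc_conv)
    then show False by (simp add: A.irrefl)
  qed
  then have L0: "0 < L" using n by (simp add: L_def)
  then have c0: "0 < c" using assms(3) unfolding L_def by (smt (verit) divide_pos_pos)
  have Lc: "2 / c \<le> L" using assms(3) c0 L0 unfolding L_def[symmetric] by (simp add: field_simps)
  define h where "h = blowup_base r"
  have h: "1 \<le> h" "4 * c * real h ^ r \<le> 1"
    using blowup_base_pos[OF r] blowup_base_le[OF r c0 assms(4)] by (auto simp: h_def)
  define s where "s = nat \<lfloor>c * ln (real n)\<rfloor>"
  define t where "t = nat \<lceil>real n powr (1 - sqrt c)\<rceil>"
  note sizes = blowup_size_bounds[OF c0 n L_def Lc h r s_def[folded L_def]]
  \<comment> \<open>Through \<open>1 / c \<le> ln n\<close> the upper bound on \<open>c\<close>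
    forces \<open>n\<close> to be large in terms of \<open>r\<close>.\<close>
  have big: "1024 * real r ^ 5 \<le> real n"
  proof -
    have "1024 \<le> (2::real) ^ 10" by simp
    also have "\<dots> \<le> real r ^ 10" using r by (intro power_mono) auto
    finally have "1024 * real r ^ 5 \<le> real r ^ 10 * real r ^ 5" by (intro mult_right_mono) auto
    also have "\<dots> = real r ^ 15" by (simp add: power_add[symmetric])
    also have "\<dots> \<le> real r ^ ((2 * r + 9) * (r + 1))"
    proof (rule power_increasing)
      have "13 * 3 \<le> (2 * r + 9) * (r + 1)" using r by (intro mult_mono) auto
      then show "15 \<le> (2 * r + 9) * (r + 1)" by simp
    qed (use r in simp)
    also have "\<dots> \<le> 1 / c" using assms(4) c0 r0 by (simp add: field_simps)
    also have "\<dots> \<le> L" using Lc c0 by (smt (verit) divide_right_mono)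
    also have "\<dots> \<le> real n" unfolding L_def using n by (simp add: ln_bound)
    finally show ?thesis .
  qed
  define \<epsilon> where "\<epsilon> = 1 / (4 * real r ^ 3)"
  define \<theta> where "\<theta> = 1 - 1 / real r"
  define b where "b = \<mu>0 / real n"
  define K where "K = nat \<lfloor>real n / (4 * real r)\<rfloor>"
  have "\<theta> * real n - real r / real n \<le> \<mu>0"
    using largest_eigenvalue_turan_ge[OF r0(1) n] assms(7) eq[OF pp0] by (simp add: \<theta>_def)
  then have "(\<theta> * real n - real r / real n) / real n \<le> b"
    unfolding b_def by (rule divide_right_mono) simp
  then have b: "\<theta> - real r / real n ^ 2 \<le> b"
    using n by (simp add: diff_divide_distrib power2_eq_square)
  have n0: "0 < real n" using n by simp
  have r3: "8 \<le> real r ^ 3" using power_mono[of 2 "real r" 3] r by simp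
  have \<epsilon>: "0 < \<epsilon>" "\<epsilon> \<le> 1 / 10" using r0 r3 by (auto simp: \<epsilon>_def field_simps)
  \<comment> \<open>\<open>z\<close> is the gain per deletion, \<open>\<delta>\<close> the possible
    shortfall of the initial ratio below \<open>\<theta>\<close>, and \<open>y\<close> the scale of
    the total gain: \<open>n / (4 * r)\<close> deletions gain \<open>y / 64\<close>.\<close>
  define y where "y = 1 / real r ^ 4"
  define z where "z = \<epsilon> / (4 * real n)"
  define \<delta> where "\<delta> = real r / real n ^ 2"
  have nr: "1024 * real r ^ 4 * real r \<le> real n"
    using big by (simp add: eval_nat_numeral mult_ac)
  have rn: "real r \<le> real n / (1024 * real r ^ 4)" using nr r0 by (simp add: field_simps)
  have r4: "1 \<le> real r ^ 4" "0 < real r ^ 4" using r by auto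
  have rn1: "1024 * real r \<le> real n"
  proof -
    have "1024 * 1 * real r \<le> 1024 * real r ^ 4 * real r" using r4 by (intro mult_right_mono mult_left_mono) auto
    then show ?thesis using nr by linarith
  qed
  \<comment> \<open>A single deletion makes up for the initial shortfall, so after any positive
    number of them the ratio exceeds \<open>\<theta>\<close>.\<close>
  have \<delta>z: "\<delta> < z"
  proof -
    have "\<delta> \<le> (real n / (1024 * real r ^ 4)) / real n ^ 2" unfolding \<delta>_def using rn by (rule divide_right_mono) simp
    also have "\<dots> = 1 / (1024 * real r ^ 4 * real n)" using n0 by (simp add: power2_eq_square)
    also have "\<dots> < z"
    proof -
      have "16 * real r ^ 3 * real n < 1024 * real r ^ 4 * real n"
        using r0 n0 r by (simp add: eval_nat_numeral)
      moreover have "z = 1 / (16 * real r ^ 3 * real n)" by (simp add: z_def \<epsilon>_def)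
      ultimately show ?thesis using r0 n0 by (simp only:) (rule divide_strict_left_mono, auto)
    qed
    finally show ?thesis .
  qed
  have zy: "z \<le> y / 512"
  proof -
    have "512 * real r ^ 4 \<le> 16 * real r ^ 3 * real n"
    proof -
      have "16 * real r ^ 3 * (32 * real r) \<le> 16 * real r ^ 3 * real n" using rn1 r0 by (intro mult_left_mono) auto
      then show ?thesis by (simp add: eval_nat_numeral)
    qed
    then have "1 / (16 * real r ^ 3 * real n) \<le> 1 / (512 * real r ^ 4)"
      using r0 n0 by (intro divide_left_mono) auto
    then show ?thesis by (simp add: z_def \<epsilon>_def y_def)
  qed
  have y\<epsilon>: "y \<le> 4 * \<epsilon>" "y \<le> 1"
  proof -
    have "real r ^ 3 \<le> real r ^ 4" using r by (intro power_increasing) auto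
    then show "y \<le> 4 * \<epsilon>" unfolding y_def \<epsilon>_def using r0 by (simp add: frac_le)
    show "y \<le> 1" using r4 by (simp add: y_def)
  qed
  have b\<delta>: "\<theta> - \<delta> \<le> b" using b by (simp add: \<delta>_def)
  have "1 / 2 \<le> \<theta>" unfolding \<theta>_def using r by (simp add: field_simps)
  then have conds: "\<theta> - \<epsilon> / 2 \<le> b" "2 / 5 \<le> b" using b\<delta> \<delta>z zy y\<epsilon> \<epsilon>(1) by linarith+
  have K: "real K \<le> real n / (4 * real r)" "real n / (4 * real r) - 1 \<le> real K"
  proof -
    have "0 \<le> real n / (4 * real r)" by simp
    then show "real K \<le> real n / (4 * real r)" "real n / (4 * real r) - 1 \<le> real K"
      unfolding K_def by linarith+
  qed
  have cardS: "(1 - 1 / (4 * real r)) * real n \<le> real (n - j)" if "j \<le> K" for j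
  proof -
    have "real j \<le> real n / (4 * real r)" using K(1) that by (meson of_nat_le_iff order_trans)
    moreover have "real n - real j \<le> real (n - j)" by linarith
    moreover have "(1 - 1 / (4 * real r)) * real n = real n - real n / (4 * real r)" by (simp add: algebra_simps)
    ultimately show ?thesis by linarith
  qed
  have K10: "10 \<le> \<epsilon> * real (card V - K)"
  proof -
    have "1 / 2 * real n \<le> (1 - 1 / (4 * real r)) * real n"
      using r by (intro mult_right_mono) (auto simp: field_simps)
    then have "1 / 2 * real n \<le> real (n - K)" using cardS[of K] by linarith
    then have le: "\<epsilon> * (1 / 2 * real n) \<le> \<epsilon> * real (n - K)" using \<epsilon> by (intro mult_left_mono) auto
    have "80 * real r ^ 3 \<le> 1024 * real r ^ 5"
      using r by (intro mult_mono power_increasing) auto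
    then have "80 * real r ^ 3 \<le> real n" using big by linarith
    then have "10 \<le> \<epsilon> * (1 / 2 * real n)" unfolding \<epsilon>_def using r0 by (simp add: field_simps)
    then show ?thesis unfolding cV using le by (rule order_trans)
  qed
  have from_edge: ?thesis if M: "u \<in> V" "v \<in> V" "E u v" "M \<subseteq> cliques E V r"
    "\<forall>ys\<in>M. \<forall>y\<in>set (tl ys). E u y \<and> E v y" "2 * r * n ^ r \<le> h * card M" for u v M
    using embed_from_edge[OF assms(5) r sizes(1), of h u v M t] M h sizes(2)[of "r - 1"] sizes(3) cV
    unfolding E_def V_def s_def t_def by auto
  have mono: "cliques E S k \<subseteq> cliques E V k" if "S \<subseteq> V" for S k using that by (auto simp: cliques_def)
  consider (stop) j S \<mu> x where "j \<le> K" "S \<subseteq> V" "card S = n - j" "principal_pair E S \<mu> x"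
      "b + real j * z \<le> \<mu> / real (card S)"
      "\<forall>w\<in>S. (\<theta> - \<epsilon>) * real (card S) < real (card {v \<in> S. E w v})"
    | (cont) S \<mu> x where "S \<subseteq> V" "card S = n - K" "principal_pair E S \<mu> x"
      "b + real K * z \<le> \<mu> / real (card S)"
    using A.vertex_deletion[OF fin pp0 b_def[folded cV] conds \<epsilon> K10 order_refl]
    unfolding cV z_def[symmetric] by blast
  then show ?thesis
  proof cases
    case stop
    have finS: "finite S" using stop(2) fin by (rule finite_subset)
    have ne: "cliques E S (Suc r) \<noteq> {}"
    proof (cases "j = 0")
      case True
      then have "S = V" using stop cV card_subset_eq[OF fin] by simp
      then show ?thesis using clq by simp
    next
      case False
      define \<sigma> where "\<sigma> = 1 - \<mu> / real (card S)"
      have z0: "0 < z" using \<epsilon> n0 by (simp add: z_def)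
      have "1 * z \<le> real j * z" using False z0 by (intro mult_right_mono) auto
      then have \<theta>\<mu>: "\<theta> < \<mu> / real (card S)" using stop(5) b\<delta> \<delta>z by linarith
      then have "\<sigma> < 1 / real r" by (simp add: \<sigma>_def \<theta>_def)
      then have r\<sigma>: "real r * \<sigma> < 1" using r0 by (simp add: field_simps)
      have "0 < \<mu> / real (card S)" using \<theta>\<mu> \<open>1 / 2 \<le> \<theta>\<close> by linarith
      then have "0 < \<mu>" by (simp add: zero_less_divide_iff)
      moreover have "0 < (\<Prod>k\<le>r. 1 - real k * \<sigma>)"
      proof -
        have "0 < fact r / real r ^ r * (1 - real r * \<sigma>)" using r\<sigma> r0 by (intro mult_pos_pos) auto
        then show ?thesis using prod_one_minus_ge[OF r0(1), of \<sigma>] r\<sigma> by linarith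
      qed
      ultimately have "0 < \<mu> ^ Suc r * (\<Prod>k\<le>r. 1 - real k * \<sigma>)" by (intro mult_pos_pos) auto
      also have "\<dots> \<le> real (card (cliques E S (Suc r)))"
        by (rule A.card_cliques_spectral_ge[OF finS stop(4) r0(1) \<sigma>_def r\<sigma>])
      finally show ?thesis by (intro notI) simp
    qed
    obtain u v M where "u \<in> S" "v \<in> S" "E u v" "M \<subseteq> cliques E S r"
      "\<forall>ys\<in>M. \<forall>y\<in>set (tl ys). E u y \<and> E v y" "2 * r * n ^ r \<le> h * card M"
      using A.edge_density[OF finS r _ _ ne, of n] cardS[OF stop(1)] stop(3,6)
      unfolding h_def \<theta>_def \<epsilon>_def by auto
    then show ?thesis using from_edge[of u v M] mono[OF stop(2), of r] stop(2) by blast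
  next
    case cont
    have finS: "finite S" using cont(1) fin by (rule finite_subset)
    \<comment> \<open>The term \<open>- z\<close> pays for the floor in \<open>K\<close>. Since
      \<open>\<delta> < z \<le> y / 512\<close>, at least \<open>y / 128\<close> remains.\<close>
    have "y / 64 - z \<le> real K * z"
    proof -
      have "(real n / (4 * real r) - 1) * z \<le> real K * z"
        using K(2) \<epsilon> n0 by (intro mult_right_mono) (auto simp: z_def)
      moreover have "real n / (4 * real r) * z = y / 64"
        unfolding z_def \<epsilon>_def y_def using r0 n0 by (simp add: field_simps eval_nat_numeral)
      ultimately show ?thesis by (simp only: left_diff_distrib mult_1_left)
    qed
    moreover have "0 < y" using r4 by (simp add: y_def)
    ultimately have "\<theta> + y / 128 \<le> \<mu> / real (card S)" using cont(4) b\<delta> \<delta>z zy by linarith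
    then have "2 * Suc r * n ^ Suc r \<le> h * card (cliques E S (Suc r))"
      unfolding h_def using cont(2) cardS[of K]
      by (intro A.clique_density[OF finS cont(3) r]) (auto simp: \<theta>_def y_def)
    also have "\<dots> \<le> h * card (cliques E V (Suc r))"
      by (intro mult_left_mono card_mono finite_cliques fin mono cont(1)) simp
    finally have "2 * Suc r * n ^ Suc r \<le> h * card (cliques E V (Suc r))" .
    then show ?thesis
      using embed_from_larger_cliques[OF assms(5) r sizes(1), of h t] h sizes(2)[of r] sizes(3) cV
      unfolding E_def V_def s_def t_def by auto
  qed
qed

end
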